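(* Consider the white-noise linear inverse problem, the needlet system $(\psi_{j\eta})_{\eta\in\mathbb Z_j,\,j\ge -1}$ built on the SVD basis, and the thresholding (NEED-D) estimator $\hat f$ described in the context. Assume that for every $1\le q<\infty$ there are positive constants $C,c_q,C_q,D_q$ such that for all $j$ and all $\eta\in\mathbb Z_j$ $$\mathrm{Card}\,\mathbb Z_j\le C2^j,\qquad c_q2^{j(\frac q2-1)}\le\|\psi_{j\eta}\|_q^q\le C_q2^{j(\frac q2-1)},$$ $$\Big\|\sum_{\eta\in\mathbb Z_j}u_\eta\psi_{j\eta}\Big\|_q^q\le D_q\sum_{\eta\in\mathbb Z_j}|u_\eta|^q\|\psi_{j\eta}\|_q^q\quad\text{for any collection }(u_\eta).$$ Let $1<p<\infty$ and $2\nu+1>0$, and assume $$\sigma_j^2:=\sup_{\eta\in\mathbb Z_j}\sum_i\Big[\frac{\psi_{j\eta}^i}{b_i}\Big]^2\le C2^{2j\nu}\qquad\forall j\ge 0 .$$ Suppose $\kappa^2\ge 16p$ and $2^J=t_\varepsilon^{-2/(2\nu+1)}$, where $t_\varepsilon=\varepsilon\sqrt{\log(1/\varepsilon)}$. Let $M>0$, $\pi\ge1$, $s\ge1/\pi$, $r\ge1$, with the restriction $r\le\pi$ if $s=(\nu+\frac12)(\frac p\pi-1)$. Then there is a constant $C'$ such that, for all sufficiently small $\varepsilon>0$ and all $f\in B^s_{\pi,r}(M)$, $$\mathbb E\|\hat f-f\|_p^p\le C'\,[\log(1/\varepsilon)]^{p-1}\,\big[\varepsilon\sqrt{\log(1/\varepsilon)}\big]^{\mu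 p},$$ where $$\mu=\frac{s}{s+\nu+1/2}\quad\text{if } s\ge\Big(\nu+\frac12\Big)\Big(\frac p\pi-1\Big),$$ $$\mu=\frac{s-1/\pi+1/p}{s+\nu+1/2-1/\pi}\quad\text{if } \frac1\pi\le s<\Big(\nu+\frac12\Big)\Big(\frac p\pi-1\Big).$$
   Context: Model. $\mathbb H,\mathbb K$ are Hilbert spaces with $\mathbb H=\mathbb L_2(\mathcal Y,\mu_{\mathcal Y})$, $\mu_{\mathcal Y}$ a finite positive measure; $\|\cdot\|_q$ is the norm of $\mathbb L_q(\mathcal Y,\mu_{\mathcal Y})$. $K:\mathbb H\to\mathbb K$ is a compact linear operator with singular value decomposition: orthonormal bases $(e_i)$ of $\mathbb H$ and $(g_i)$ of $\mathbb K$ and nonzero numbers $b_i\to0$ with $Ke_i=b_ig_i$, $K^*g_i=b_ie_i$. One observes $Y_\varepsilon=Kf+\varepsilon\dot W$, with $\dot W$ a Gaussian white noise on $\mathbb K$ and $\varepsilon>0$ small; equivalently one observes $Y_i=(Y_\varepsilon,g_i)_{\mathbb K}=b_if_i+\varepsilon\xi_i$, with $f_i=(f,e_i)_{\mathbb H}$ and $(\xi_i)$ i.i.d. standard Gaussian. Needlets. Let $H_k=\mathrm{span}(e_k)$, $k\ge0$, with $H_0$ the constants, and $\mathcal K_k=\bigoplus_{m=0}^kH_m$. It is assumed that $f\in\mathcal K_k,\ g\in\mathcal K_l$ imply $fg\in\mathcal K_{k+l}$, and that for every $k$ there are a finite set $\mathcal X_k\subset\mathcal Y$ and weights $\lambda_\eta>0$,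 $\eta\in\mathcal X_k$, with $\int_{\mathcal Y}h\,d\mu_{\mathcal Y}=\sum_{\eta\in\mathcal X_k}\lambda_\eta h(\eta)$ for all $h\in\mathcal K_k$ ($\#\mathcal X_0=1$). Let $\varphi$ be a $C^\infty$ function supported in $[-1,1]$ with $0\le\varphi\le1$ and $\varphi(\xi)=1$ for $|\xi|\le\frac12$, and let $a\ge0$ be defined by $a^2(\xi)=\varphi(\xi/2)-\varphi(\xi)$. With $L_k(x,y)=e_k(x)\overline{e_k(y)}$, $\mathbb Z_j=\mathcal X_{2^{j+2}-2}$ for $j\ge0$ and $\mathbb Z_{-1}=\mathcal X_0$, set $\psi_{j\eta}(x)=\sqrt{\lambda_\eta}\sum_ka(k/2^j)L_k(x,\eta)$ for $\eta\in\mathbb Z_j$, $j\ge0$; for the single point $\eta\in\mathbb Z_{-1}$, $\psi_{-1,\eta}$ is the $\mathbb L_2$-normalized positive constant. $(\psi_{j\eta})$ is a tight frame: $f=\sum_{j\ge-1}\sum_{\eta\in\mathbb Z_j}\beta_{j\eta}\psi_{j\eta}$ with $\beta_{j\eta}=(f,\psi_{j\eta})_{\mathbb H}$. Put $\psi^i_{j\eta}=(\psi_{j\eta},e_i)_{\mathbb H}$. Estimator. $\hat\beta_{j\eta}=\sum_i\frac{Y_i}{b_i}\psi^i_{j\eta}$ (a finite sum), $t(\hat\beta_{j\eta})=\hat\beta_{j\eta}\,I\{|\hat\beta_{j\eta}|\ge\kappa t_\varepsilon\sigma_j\}$ with $\sigma_j^2=\sup_{\eta\in\mathbb Z_j}\sum_i[\psi^i_{j\eta}/b_i]^2$,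 where $\kappa>0$ is a tuning constant, and $$\hat f=\sum_{-1\le j\le J}\ \sum_{\eta\in\mathbb Z_j}t(\hat\beta_{j\eta})\psi_{j\eta}.$$ Besov balls. $B^s_{\pi,r}(M)$ is the set of $f=\sum_{j\ge-1}\sum_{\eta\in\mathbb Z_j}\beta_{j\eta}\psi_{j\eta}$, $\beta_{j\eta}=(f,\psi_{j\eta})_{\mathbb H}$, such that $\|f\|_{B^s_{\pi,r}}:=\big\|\big(2^{j[s+\frac12-\frac1\pi]}\|(\beta_{j\eta})_{\eta\in\mathbb Z_j}\|_{l_\pi}\big)_{j\ge-1}\big\|_{l_r}\le M$. The constant $C'$ may depend on everything except $\varepsilon$ and $f\in B^s_{\pi,r}(M)$. *)

theory Defs
  imports "HOL-Probability.Probability"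
begin

section \<open>The spaces \<open>L\<^sub>q(Y, \<mu>)\<close>\<close>

text \<open>
  Elements of the Hilbert space \<open>L\<^sub>2\<close> are represented by functions; everything below that depends on
  an element of \<open>L\<^sub>2\<close> only depends on its almost-everywhere class.  The exception are the basis
  functions \<open>e k\<close>, which are evaluated at the cubature points and hence are genuine functions.
\<close>

definition L2_space :: "'y measure \<Rightarrow> ('y \<Rightarrow> real) set" where
  "L2_space M = {f \<in> borel_measurable M. integrable M (\<lambda>x. (f x)\<^sup>2)}"

definition L2_inner :: "'y measure \<Rightarrow> ('y \<Rightarrow> real) \<Rightarrow> ('y \<Rightarrow> real) \<Rightarrow> real" where
  "L2_inner M f h = (\<integral>x. f x * h x \<partial>M)"

definition L2_norm :: "'y measure \<Rightarrow> ('y \<Rightarrow> real) \<Rightarrow> real" where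
  "L2_norm M f = sqrt (L2_inner M f f)"

text \<open>The \<open>q\<close>-th power of the \<open>L\<^sub>q\<close> norm, with value \<open>\<infinity>\<close> outside \<open>L\<^sub>q\<close>.\<close>

definition Lq_norm_pow :: "'y measure \<Rightarrow> real \<Rightarrow> ('y \<Rightarrow> real) \<Rightarrow> ennreal" where
  "Lq_norm_pow M q f = (\<integral>\<^sup>+x. ennreal (\<bar>f x\<bar> powr q) \<partial>M)"

definition L2_orthonormal_basis :: "'y measure \<Rightarrow> (nat \<Rightarrow> 'y \<Rightarrow> real) \<Rightarrow> bool" where
  "L2_orthonormal_basis M e \<longleftrightarrow>
     (\<forall>i. e i \<in> L2_space M) \<and>
     (\<forall>i k. L2_inner M (e i) (e k) = (if i = k then 1 else 0)) \<and>
     (\<forall>f\<in>L2_space M.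
        (\<lambda>n. L2_norm M (\<lambda>x. f x - (\<Sum>i<n. L2_inner M f (e i) * e i x))) \<longlonglongrightarrow> 0)"

definition orthonormal_basis :: "(nat \<Rightarrow> 'k::real_inner) \<Rightarrow> bool" where
  "orthonormal_basis g \<longleftrightarrow>
     (\<forall>i k. inner (g i) (g k) = (if i = k then 1 else 0)) \<and>
     (\<forall>y. (\<lambda>i. inner y (g i) *\<^sub>R g i) sums y)"


section \<open>The inverse problem\<close>

definition L2_compact_operator :: "'y measure \<Rightarrow> (('y \<Rightarrow> real) \<Rightarrow> 'k::real_inner) \<Rightarrow> bool" where
  "L2_compact_operator M K \<longleftrightarrow>
     (\<forall>f\<in>L2_space M. \<forall>h\<in>L2_space M. (AE x in M. f x = h x) \<longrightarrow> K f = K h) \<and>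
     (\<forall>f\<in>L2_space M. \<forall>h\<in>L2_space M. \<forall>c. K (\<lambda>x. c * f x + h x) = c *\<^sub>R K f + K h) \<and>
     compact (closure (K ` {f \<in> L2_space M. L2_norm M f \<le> 1}))"

definition L2_adjoint ::
  "'y measure \<Rightarrow> (('y \<Rightarrow> real) \<Rightarrow> 'k::real_inner) \<Rightarrow> ('k \<Rightarrow> 'y \<Rightarrow> real) \<Rightarrow> bool" where
  "L2_adjoint M K K' \<longleftrightarrow>
     (\<forall>y. K' y \<in> L2_space M) \<and>
     (\<forall>f\<in>L2_space M. \<forall>y. inner (K f) y = L2_inner M f (K' y))"

definition svd ::
  "'y measure \<Rightarrow> (('y \<Rightarrow> real) \<Rightarrow> 'k::{real_inner,complete_space}) \<Rightarrow> (nat \<Rightarrow> 'y \<Rightarrow> real) \<Rightarrow>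
   (nat \<Rightarrow> 'k) \<Rightarrow> (nat \<Rightarrow> real) \<Rightarrow> bool" where
  "svd M K e g b \<longleftrightarrow>
     L2_orthonormal_basis M e \<and> orthonormal_basis g \<and>
     (\<forall>i. b i \<noteq> 0) \<and> b \<longlonglongrightarrow> 0 \<and>
     (\<forall>i. K (e i) = b i *\<^sub>R g i) \<and>
     (\<exists>K'. L2_adjoint M K K' \<and> (\<forall>i. AE x in M. K' (g i) x = b i * e i x))"

text \<open>
  A Gaussian white noise on a Hilbert space is given through its pairings \<open>W h\<close> with the vectors
  \<open>h\<close>: these are almost surely linear in \<open>h\<close>, and the pairings with an orthonormal system are
  independent and standard normal.
\<close>

definition gaussian_white_noise :: "'w measure \<Rightarrow> ('k::real_inner \<Rightarrow> 'w \<Rightarrow> real) \<Rightarrow> bool" where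
  "gaussian_white_noise P W \<longleftrightarrow>
     (\<forall>h. W h \<in> borel_measurable P) \<and>
     (\<forall>h h' c. AE \<omega> in P. W (c *\<^sub>R h + h') \<omega> = c * W h \<omega> + W h' \<omega>) \<and>
     (\<forall>S. pairwise orthogonal S \<and> (\<forall>h\<in>S. norm h = 1) \<longrightarrow>
        prob_space.indep_vars P (\<lambda>_. borel) W S \<and>
        (\<forall>h\<in>S. distributed P lborel (W h) std_normal_density))"

text \<open>The observations \<open>Y\<^sub>i = (Y\<^sub>\<epsilon>, g\<^sub>i)\<close>, where \<open>Y\<^sub>\<epsilon> = K f + \<epsilon> W\<close>.\<close>

definition observation ::
  "(('y \<Rightarrow> real) \<Rightarrow> 'k::real_inner) \<Rightarrow> (nat \<Rightarrow> 'k) \<Rightarrow> ('k \<Rightarrow> 'w \<Rightarrow> real) \<Rightarrow> real \<Rightarrow>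
   ('y \<Rightarrow> real) \<Rightarrow> 'w \<Rightarrow> nat \<Rightarrow> real" where
  "observation K g W \<epsilon> f \<omega> i = inner (K f) (g i) + \<epsilon> * W (g i) \<omega>"


section \<open>Needlets\<close>

definition sum_space :: "'y measure \<Rightarrow> (nat \<Rightarrow> 'y \<Rightarrow> real) \<Rightarrow> nat \<Rightarrow> ('y \<Rightarrow> real) set" where
  "sum_space M e k = {h. \<exists>c. \<forall>x\<in>space M. h x = (\<Sum>m\<le>k. c m * e m x)}"

definition cubature ::
  "'y measure \<Rightarrow> (nat \<Rightarrow> 'y \<Rightarrow> real) \<Rightarrow> (nat \<Rightarrow> 'y set) \<Rightarrow> (nat \<Rightarrow> 'y \<Rightarrow> real) \<Rightarrow> bool" where
  "cubature M e X lam \<longleftrightarrow>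
     (\<forall>k. finite (X k) \<and> X k \<subseteq> space M \<and> (\<forall>\<eta>\<in>X k. lam k \<eta> > 0) \<and>
        (\<forall>h\<in>sum_space M e k. (\<integral>x. h x \<partial>M) = (\<Sum>\<eta>\<in>X k. lam k \<eta> * h \<eta>))) \<and>
     card (X 0) = 1"

definition needlet_window :: "(real \<Rightarrow> real) \<Rightarrow> bool" where
  "needlet_window \<phi> \<longleftrightarrow>
     (\<forall>n x. (deriv ^^ n) \<phi> differentiable (at x)) \<and>
     (\<forall>x. \<bar>x\<bar> > 1 \<longrightarrow> \<phi> x = 0) \<and> (\<forall>x. 0 \<le> \<phi> x \<and> \<phi> x \<le> 1) \<and>
     (\<forall>x. \<bar>x\<bar> \<le> 1/2 \<longrightarrow> \<phi> x = 1)"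

definition needlet_a :: "(real \<Rightarrow> real) \<Rightarrow> real \<Rightarrow> real" where
  "needlet_a \<phi> x = sqrt (\<phi> (x / 2) - \<phi> x)"

text \<open>
  The standing assumptions on the basis \<open>e\<close>, the cubature formulas and the window \<open>\<phi>\<close>.
\<close>

definition needlet_setting ::
  "'y measure \<Rightarrow> (nat \<Rightarrow> 'y \<Rightarrow> real) \<Rightarrow> (nat \<Rightarrow> 'y set) \<Rightarrow> (nat \<Rightarrow> 'y \<Rightarrow> real) \<Rightarrow>
   (real \<Rightarrow> real) \<Rightarrow> bool" where
  "needlet_setting M e X lam \<phi> \<longleftrightarrow>
     (\<exists>c. \<forall>x\<in>space M. e 0 x = c) \<and>
     (\<forall>k l. \<forall>f\<in>sum_space M e k. \<forall>h\<in>sum_space M e l. (\<lambda>x. f x * h x) \<in> sum_space M e (k + l)) \<and>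
     cubature M e X lam \<and> needlet_window \<phi>"

text \<open>Resolution levels \<open>j\<close> are integers with \<open>j \<ge> -1\<close>.\<close>

definition cubature_degree :: "int \<Rightarrow> nat" where
  "cubature_degree j = (if j < 0 then 0 else 2 ^ (nat j + 2) - 2)"

definition Z :: "(nat \<Rightarrow> 'y set) \<Rightarrow> int \<Rightarrow> 'y set" where
  "Z X j = X (cubature_degree j)"

text \<open>The series in \<open>needlet\<close> is a finite sum, as \<open>needlet_a \<phi>\<close> vanishes on \<open>{2..}\<close>.\<close>

definition needlet ::
  "'y measure \<Rightarrow> (nat \<Rightarrow> 'y \<Rightarrow> real) \<Rightarrow> (nat \<Rightarrow> 'y \<Rightarrow> real) \<Rightarrow> (real \<Rightarrow> real) \<Rightarrow>
   int \<Rightarrow> 'y \<Rightarrow> 'y \<Rightarrow> real" where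
  "needlet M e lam \<phi> j \<eta> x =
     (if j < 0 then 1 / sqrt (measure M (space M))
      else sqrt (lam (cubature_degree j) \<eta>) *
             (\<Sum>k. needlet_a \<phi> (real k / 2 powr real_of_int j) * (e k x * e k \<eta>)))"

definition needlet_coord ::
  "'y measure \<Rightarrow> (nat \<Rightarrow> 'y \<Rightarrow> real) \<Rightarrow> (nat \<Rightarrow> 'y \<Rightarrow> real) \<Rightarrow> (real \<Rightarrow> real) \<Rightarrow>
   int \<Rightarrow> 'y \<Rightarrow> nat \<Rightarrow> real" where
  "needlet_coord M e lam \<phi> j \<eta> i = L2_inner M (needlet M e lam \<phi> j \<eta>) (e i)"


section \<open>The thresholding estimator\<close>

definition noise_level_sq ::
  "'y measure \<Rightarrow> (nat \<Rightarrow> 'y \<Rightarrow> real) \<Rightarrow> (nat \<Rightarrow> real) \<Rightarrow> (nat \<Rightarrow> 'y set) \<Rightarrow> (nat \<Rightarrow> 'y \<Rightarrow> real) \<Rightarrow>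
   (real \<Rightarrow> real) \<Rightarrow> int \<Rightarrow> real" where
  "noise_level_sq M e b X lam \<phi> j =
     (SUP \<eta>\<in>Z X j. \<Sum>i. (needlet_coord M e lam \<phi> j \<eta> i / b i)\<^sup>2)"

definition beta_hat ::
  "'y measure \<Rightarrow> (nat \<Rightarrow> 'y \<Rightarrow> real) \<Rightarrow> (nat \<Rightarrow> real) \<Rightarrow> (nat \<Rightarrow> 'y \<Rightarrow> real) \<Rightarrow> (real \<Rightarrow> real) \<Rightarrow>
   (nat \<Rightarrow> real) \<Rightarrow> int \<Rightarrow> 'y \<Rightarrow> real" where
  "beta_hat M e b lam \<phi> Y j \<eta> = (\<Sum>i. Y i / b i * needlet_coord M e lam \<phi> j \<eta> i)"

definition hard_threshold :: "real \<Rightarrow> real \<Rightarrow> real" where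
  "hard_threshold T u = (if \<bar>u\<bar> \<ge> T then u else 0)"

definition t_eps :: "real \<Rightarrow> real" where
  "t_eps \<epsilon> = \<epsilon> * sqrt (ln (1 / \<epsilon>))"

text \<open>The cut-off level \<open>J\<close> need not be an integer.\<close>

definition need_d ::
  "'y measure \<Rightarrow> (nat \<Rightarrow> 'y \<Rightarrow> real) \<Rightarrow> (nat \<Rightarrow> real) \<Rightarrow> (nat \<Rightarrow> 'y set) \<Rightarrow> (nat \<Rightarrow> 'y \<Rightarrow> real) \<Rightarrow>
   (real \<Rightarrow> real) \<Rightarrow> real \<Rightarrow> real \<Rightarrow> real \<Rightarrow> (nat \<Rightarrow> real) \<Rightarrow> 'y \<Rightarrow> real" where
  "need_d M e b X lam \<phi> \<kappa> \<epsilon> J Y x =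
     (\<Sum>j\<in>{j::int. -1 \<le> j \<and> real_of_int j \<le> J}. \<Sum>\<eta>\<in>Z X j.
        hard_threshold (\<kappa> * t_eps \<epsilon> * sqrt (noise_level_sq M e b X lam \<phi> j))
            (beta_hat M e b lam \<phi> Y j \<eta>)
        * needlet M e lam \<phi> j \<eta> x)"


section \<open>Besov balls\<close>

text \<open>The entry of index \<open>j\<close> of the sequence whose \<open>l\<^sub>r\<close> norm is the Besov norm.\<close>

definition besov_term ::
  "'y measure \<Rightarrow> (nat \<Rightarrow> 'y \<Rightarrow> real) \<Rightarrow> (nat \<Rightarrow> 'y set) \<Rightarrow> (nat \<Rightarrow> 'y \<Rightarrow> real) \<Rightarrow> (real \<Rightarrow> real) \<Rightarrow>
   real \<Rightarrow> real \<Rightarrow> ('y \<Rightarrow> real) \<Rightarrow> int \<Rightarrow> real" where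
  "besov_term M e X lam \<phi> s \<pi> f j =
     2 powr (real_of_int j * (s + 1/2 - 1/\<pi>)) *
     (\<Sum>\<eta>\<in>Z X j. \<bar>L2_inner M f (needlet M e lam \<phi> j \<eta>)\<bar> powr \<pi>) powr (1/\<pi>)"

text \<open>The third index \<open>r\<close> of the Besov scale may be infinite.\<close>

definition besov_norm ::
  "'y measure \<Rightarrow> (nat \<Rightarrow> 'y \<Rightarrow> real) \<Rightarrow> (nat \<Rightarrow> 'y set) \<Rightarrow> (nat \<Rightarrow> 'y \<Rightarrow> real) \<Rightarrow> (real \<Rightarrow> real) \<Rightarrow>
   real \<Rightarrow> real \<Rightarrow> ereal \<Rightarrow> ('y \<Rightarrow> real) \<Rightarrow> ereal" where
  "besov_norm M e X lam \<phi> s \<pi> r f =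
     (let u = besov_term M e X lam \<phi> s \<pi> f; r' = real_of_ereal r in
      if r = \<infinity> then (SUP j\<in>{-1..}. ereal (u j))
      else if (\<lambda>j. u j powr r') summable_on {-1..}
      then ereal ((\<Sum>\<^sub>\<infinity>j\<in>{-1..}. u j powr r') powr (1 / r'))
      else \<infinity>)"

text \<open>
  The functions in the ball are the sums of their needlet series, because every \<open>L\<^sub>2\<close> function is:
  the needlets form a tight frame.
\<close>

definition besov_ball ::
  "'y measure \<Rightarrow> (nat \<Rightarrow> 'y \<Rightarrow> real) \<Rightarrow> (nat \<Rightarrow> 'y set) \<Rightarrow> (nat \<Rightarrow> 'y \<Rightarrow> real) \<Rightarrow> (real \<Rightarrow> real) \<Rightarrow>
   real \<Rightarrow> real \<Rightarrow> ereal \<Rightarrow> real \<Rightarrow> ('y \<Rightarrow> real) set" where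
  "besov_ball M e X lam \<phi> s \<pi> r R =
     {f \<in> L2_space M. besov_norm M e X lam \<phi> s \<pi> r f \<le> ereal R}"

end

theory Submission
  imports Defs
begin

text \<open>
  The error of a thresholded coefficient splits into a deterministic and a rare random part
  (\<open>hard_threshold_error\<close>): if \<open>u\<close> is a noisy version of \<open>v\<close>, then thresholding \<open>u\<close> at \<open>T\<close> costs at most
  a constant times \<open>min \<bar>v\<bar> T\<close>, plus a constant times \<open>\<bar>u - v\<bar>\<close> on the event \<open>\<bar>u - v\<bar> > T / 2\<close>.

  The random part is negligible.  The error of the estimated coefficient is \<open>\<epsilon>\<close> times a centred Gaussian
  variable with standard deviation at most \<open>\<sigma>\<^sub>j\<close> (\<open>beta_hat_error\<close>), and the threshold is
  \<open>\<kappa> * sqrt (ln (1 / \<epsilon>))\<close> times \<open>\<epsilon> * \<sigma>\<^sub>j\<close>.  With \<open>\<kappa>\<^sup>2 \<ge> 16 * p\<close>, a Chernoff bound gains a factor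
  \<open>\<epsilon> powr p\<close> (\<open>threshold_risk_le\<close>), which outweighs the sum over all coefficients up to the cut-off \<open>J\<close>.

  The deterministic part is a sum over the levels \<open>j\<close> of
  \<open>2 powr (j * (p / 2 - 1)) * (\<Sum>\<eta>. min \<bar>\<beta> j \<eta>\<bar> (T j) powr p)\<close>, where \<open>T j\<close> is of order \<open>t * 2 powr (j * \<nu>)\<close>
  and \<open>t = t_eps \<epsilon>\<close>.  With \<open>m = \<nu> + 1/2\<close>, a level is bounded by \<open>t powr p * 2 powr (j * p * m)\<close> (all
  coefficients at the threshold), by a negative power of \<open>2\<^sup>j\<close> (no thresholding, Besov regularity), and
  if \<open>\<pi> < p\<close> also by \<open>t powr (p - \<pi>) * 2 powr (j * (m * (p - \<pi>) - \<pi> * s))\<close> (interpolation).  In each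
  regime a growing and a decaying bound are available.  A sum of minima of two such exponentials is of
  the order of their value at the crossing point (\<open>sum_balanced_exponentials_le\<close>), which is
  \<open>t powr (\<mu> * p)\<close>.  On the line between the regimes the interpolated bound is constant in \<open>j\<close>, and
  \<open>r \<le> \<pi>\<close> makes its sum over the levels finite (\<open>sum_threshold_levels_le\<close>).

  The stability of the needlet synthesis turns coefficient errors on one level into \<open>L\<^sub>p\<close> errors.  Adding
  the \<open>O (ln (1 / \<epsilon>))\<close> levels by convexity costs the factor \<open>ln (1 / \<epsilon>) powr (p - 1)\<close>.

  For the bias one needs that \<open>f\<close> is the sum of its needlet series.  As the cubature is exact on
  products of basis functions, level \<open>j\<close> of the series is the multiplier with symbol
  \<open>\<phi> (k / 2 ^ (j + 1)) - \<phi> (k / 2 ^ j)\<close> (\<open>level_nonneg\<close>), and the partial sums telescope to smoothed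
  partial sums of the basis expansion (\<open>sum_levels\<close>).  Fatou's lemma then bounds the levels above \<open>J\<close> in
  \<open>L\<^sub>p\<close> (\<open>bias_le\<close>), and \<open>s \<ge> 1 / \<pi>\<close> makes this bound at most of the order of the rate (\<open>rate_le_decay\<close>).
\<close>


section \<open>Power sums, hard thresholding and exponential sums\<close>

text \<open>
  Convexity of \<open>x \<mapsto> x\<^sup>p\<close> for the weights \<open>w\<close>.  With constant weights it bounds the
  \<open>p\<close>-th power of a sum of \<open>n\<close> terms at the price \<open>n\<^sup>p\<^sup>-\<^sup>1\<close>; with geometric weights the price stays
  bounded as \<open>n\<close> grows, provided that the terms decay faster than the weights.
\<close>

lemma powr_sum_le_weighted:
  fixes a w :: "'i \<Rightarrow> real"
  assumes F: "finite F" and p: "p \<ge> 1" and w: "\<And>j. j \<in> F \<Longrightarrow> w j > 0"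
  shows "\<bar>\<Sum>j\<in>F. a j\<bar> powr p
           \<le> (\<Sum>j\<in>F. w j) powr (p - 1) * (\<Sum>j\<in>F. w j powr (1 - p) * \<bar>a j\<bar> powr p)"
proof -
  \<comment> \<open>Vanishing terms are discarded because convexity of the power is available on the open half-line.\<close>
  define G where "G = {j \<in> F. a j \<noteq> 0}"
  define V where "V = (\<Sum>j\<in>G. w j)"
  have G: "finite G" "G \<subseteq> F" and wG: "\<And>j. j \<in> G \<Longrightarrow> w j > 0"
    using F w by (auto simp: G_def)
  have sums: "(\<Sum>j\<in>F. a j) = (\<Sum>j\<in>G. a j)"
    "(\<Sum>j\<in>F. w j powr (1 - p) * \<bar>a j\<bar> powr p) = (\<Sum>j\<in>G. w j powr (1 - p) * \<bar>a j\<bar> powr p)"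
    unfolding G_def by (rule sum.mono_neutral_right; use F p in auto)+
  show ?thesis
  proof (cases "G = {}")
    case True
    then show ?thesis using sums by simp
  next
    case False
    have V: "V > 0" unfolding V_def using G False wG by (intro sum_pos) auto
    have VW: "V \<le> (\<Sum>j\<in>F. w j)"
      unfolding V_def using G F w by (intro sum_mono2) (auto intro: less_imp_le)
    have "(\<Sum>j\<in>G. \<bar>a j\<bar>) powr p = (\<Sum>j\<in>G. (w j / V) *\<^sub>R (\<bar>a j\<bar> * V / w j)) powr p"
      using wG V by (intro arg_cong[where f = "\<lambda>x. x powr p"] sum.cong) (force simp: field_simps)+
    also have "\<dots> \<le> (\<Sum>j\<in>G. (w j / V) * (\<bar>a j\<bar> * V / w j) powr p)"
    proof (rule convex_on_sum[OF G(1) False powr_convex[OF p]])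
      show "(\<Sum>j\<in>G. w j / V) = 1"
        using V by (simp add: V_def flip: sum_divide_distrib)
    next
      fix j assume j: "j \<in> G"
      then have "a j \<noteq> 0" by (simp add: G_def)
      then show "0 \<le> w j / V" "\<bar>a j\<bar> * V / w j \<in> {0<..}"
        using wG[OF j] V by auto
    qed
    also have "\<dots> = V powr (p - 1) * (\<Sum>j\<in>G. w j powr (1 - p) * \<bar>a j\<bar> powr p)"
      unfolding sum_distrib_left
    proof (intro sum.cong refl)
      fix j assume j: "j \<in> G"
      have "w j / V * (\<bar>a j\<bar> * V / w j) powr p
          = w j / V * (\<bar>a j\<bar> powr p * V powr p / w j powr p)"
        using wG[OF j] V by (simp add: powr_divide powr_mult)
      then show "w j / V * (\<bar>a j\<bar> * V / w j) powr p
          = V powr (p - 1) * (w j powr (1 - p) * \<bar>a j\<bar> powr p)"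
        using wG[OF j] V by (simp add: powr_diff field_simps)
    qed
    also have "\<dots> \<le> (\<Sum>j\<in>F. w j) powr (p - 1) * (\<Sum>j\<in>G. w j powr (1 - p) * \<bar>a j\<bar> powr p)"
      using VW V p by (intro mult_right_mono powr_mono2 sum_nonneg) auto
    finally have "(\<Sum>j\<in>G. \<bar>a j\<bar>) powr p \<le> \<dots>" .
    moreover have "\<bar>\<Sum>j\<in>G. a j\<bar> powr p \<le> (\<Sum>j\<in>G. \<bar>a j\<bar>) powr p"
      using p by (intro powr_mono2) auto
    ultimately show ?thesis
      unfolding sums by linarith
  qed
qed

corollary powr_sum_le_card:
  fixes a :: "'i \<Rightarrow> real"
  assumes "finite F" "p \<ge> 1"
  shows "\<bar>\<Sum>j\<in>F. a j\<bar> powr p \<le> real (card F) powr (p - 1) * (\<Sum>j\<in>F. \<bar>a j\<bar> powr p)"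
  using powr_sum_le_weighted[OF assms, of "\<lambda>_. 1" a] by simp

lemma powr_add_le:
  fixes x y p :: real
  assumes "p \<ge> 0" "x \<ge> 0" "y \<ge> 0"
  shows "(x + y) powr p \<le> 2 powr p * (x powr p + y powr p)"
proof -
  have "(x + y) powr p \<le> (2 * max x y) powr p"
    using assms by (intro powr_mono2) auto
  also have "\<dots> = 2 powr p * max x y powr p"
    using assms by (intro powr_mult) 
  also have "\<dots> \<le> 2 powr p * (x powr p + y powr p)"
    by (intro mult_left_mono) (auto simp: max_def)
  finally show ?thesis .
qed

text \<open>
  If the noise \<open>u - v\<close> is at most \<open>T / 2\<close>, then keeping \<open>u\<close> costs at most \<open>T / 2\<close> and forces
  \<open>\<bar>v\<bar> \<ge> T / 2\<close>, while killing it costs \<open>\<bar>v\<bar>\<close> and forces \<open>\<bar>v\<bar> \<le> 3 T / 2\<close>: both costs are of the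
  order of \<open>min \<bar>v\<bar> T\<close>.  If the noise is larger than \<open>T / 2\<close>, it dominates every cost that
  \<open>min \<bar>v\<bar> T\<close> does not cover.
\<close>

lemma hard_threshold_error:
  assumes "T \<ge> 0"
  shows "\<bar>hard_threshold T u - v\<bar>
           \<le> 3 * min \<bar>v\<bar> T + 3 * (if \<bar>u - v\<bar> > T / 2 then \<bar>u - v\<bar> else 0)"
  using assms unfolding hard_threshold_def min_def by (cases "u \<ge> 0"; cases "v \<ge> 0"; cases "u \<ge> v") (simp_all add: abs_if split: if_splits)

lemma hard_threshold_error_powr:
  assumes T: "T \<ge> 0" and p: "p \<ge> 0"
  shows "\<bar>hard_threshold T u - v\<bar> powr p
           \<le> 6 powr p * (min \<bar>v\<bar> T powr p + (if \<bar>u - v\<bar> > T / 2 then \<bar>u - v\<bar> powr p else 0))"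
proof -
  define d where "d = (if \<bar>u - v\<bar> > T / 2 then \<bar>u - v\<bar> else 0)"
  have d: "d \<ge> 0" "d powr p = (if \<bar>u - v\<bar> > T / 2 then \<bar>u - v\<bar> powr p else 0)"
    by (auto simp: d_def)
  have "\<bar>hard_threshold T u - v\<bar> powr p \<le> (3 * min \<bar>v\<bar> T + 3 * d) powr p"
    using hard_threshold_error[OF T, of u v] p by (intro powr_mono2) (auto simp: d_def)
  also have "\<dots> \<le> 2 powr p * ((3 * min \<bar>v\<bar> T) powr p + (3 * d) powr p)"
    using p T d by (intro powr_add_le) auto
  also have "\<dots> = 6 powr p * (min \<bar>v\<bar> T powr p + d powr p)"
    using T d powr_mult[of 2 3 p]
    by (subst (1 2) powr_mult) (auto simp: algebra_simps)
  finally show ?thesis unfolding d(2) .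
qed

text \<open>
  Comparison of the power sums with exponents \<open>p \<le> q\<close> at the price of a power of the cardinality;
  this is convexity for the exponent \<open>q / p\<close>.
\<close>

lemma sum_powr_le_of_ge_exponent:
  fixes x :: "'i \<Rightarrow> real"
  assumes F: "finite F" and p: "0 < p" "p \<le> q"
  shows "(\<Sum>i\<in>F. x i powr p) \<le> real (card F) powr (1 - p / q) * (\<Sum>i\<in>F. x i powr q) powr (p / q)"
proof -
  have nn: "(\<Sum>i\<in>F. x i powr p) \<ge> 0" by (intro sum_nonneg) auto
  have "(\<Sum>i\<in>F. x i powr p) powr (q / p)
      \<le> real (card F) powr (q / p - 1) * (\<Sum>i\<in>F. \<bar>x i powr p\<bar> powr (q / p))"
    using powr_sum_le_card[OF F, of "q / p" "\<lambda>i. x i powr p"] p nn by simp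
  also have "(\<Sum>i\<in>F. \<bar>x i powr p\<bar> powr (q / p)) = (\<Sum>i\<in>F. x i powr q)"
    using p by (intro sum.cong refl) (auto simp: powr_powr)
  finally have "((\<Sum>i\<in>F. x i powr p) powr (q / p)) powr (p / q)
      \<le> (real (card F) powr (q / p - 1) * (\<Sum>i\<in>F. x i powr q)) powr (p / q)"
    using p by (intro powr_mono2) auto
  also have "\<dots> = real (card F) powr ((q / p - 1) * (p / q)) * (\<Sum>i\<in>F. x i powr q) powr (p / q)"
    by (subst powr_mult) (auto intro: sum_nonneg simp: powr_powr)
  also have "(q / p - 1) * (p / q) = 1 - p / q"
    using p by (simp add: field_simps)
  finally show ?thesis
    using p nn by (simp add: powr_powr)
qed

text \<open>
  The embedding of \<open>l\<^sub>q\<close> in \<open>l\<^sub>p\<close> for \<open>q \<le> p\<close>: no entry exceeds the \<open>l\<^sub>q\<close> norm.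
\<close>

lemma sum_powr_le_of_le_exponent:
  fixes x :: "'i \<Rightarrow> real"
  assumes F: "finite F" and q: "0 < q" "q \<le> p" and x: "\<And>i. i \<in> F \<Longrightarrow> x i \<ge> 0"
  shows "(\<Sum>i\<in>F. x i powr p) \<le> (\<Sum>i\<in>F. x i powr q) powr (p / q)"
proof -
  define S where "S = (\<Sum>i\<in>F. x i powr q)"
  have S: "S \<ge> 0" unfolding S_def by (intro sum_nonneg) auto
  have le: "x i \<le> S powr (1 / q)" if i: "i \<in> F" for i
  proof -
    have "x i powr q \<le> S"
      unfolding S_def using F i by (intro member_le_sum) auto
    then have "(x i powr q) powr (1 / q) \<le> S powr (1 / q)"
      using q by (intro powr_mono2) auto
    then show ?thesis using q x[OF i] by (simp add: powr_powr)
  qed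
  have "(\<Sum>i\<in>F. x i powr p) \<le> (\<Sum>i\<in>F. x i powr q * S powr ((p - q) / q))"
  proof (intro sum_mono)
    fix i assume i: "i \<in> F"
    have "x i powr p = x i powr q * x i powr (p - q)"
      using x[OF i] by (simp flip: powr_add)
    also have "\<dots> \<le> x i powr q * (S powr (1 / q)) powr (p - q)"
      using x[OF i] le[OF i] q by (intro mult_left_mono powr_mono2) auto
    finally show "x i powr p \<le> x i powr q * S powr ((p - q) / q)"
      by (simp add: powr_powr)
  qed
  also have "\<dots> = S powr 1 * S powr ((p - q) / q)"
    using S by (simp add: S_def sum_distrib_right)
  also have "\<dots> = S powr (1 + (p - q) / q)"
    by (rule powr_add[symmetric])
  also have "1 + (p - q) / q = p / q"
    using q by (simp add: field_simps)
  finally show ?thesis unfolding S_def .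
qed

lemma sum_powr_min_le:
  fixes x :: "'i \<Rightarrow> real"
  assumes q: "0 < q" "q \<le> p" and T: "T \<ge> 0" and x: "\<And>i. i \<in> F \<Longrightarrow> x i \<ge> 0"
  shows "(\<Sum>i\<in>F. min (x i) T powr p) \<le> T powr (p - q) * (\<Sum>i\<in>F. x i powr q)"
  unfolding sum_distrib_left
proof (intro sum_mono)
  fix i assume i: "i \<in> F"
  have "min (x i) T powr p = min (x i) T powr (p - q) * min (x i) T powr q"
    using x[OF i] T by (simp flip: powr_add)
  also have "\<dots> \<le> T powr (p - q) * x i powr q"
    using x[OF i] T q by (intro mult_mono powr_mono2) auto
  finally show "min (x i) T powr p \<le> T powr (p - q) * x i powr q" .
qed

lemma sum_geometric_above:
  fixes F :: "int set"
  assumes F: "finite F" and \<gamma>: "\<gamma> > 0" and z: "\<And>j. j \<in> F \<Longrightarrow> z \<le> real_of_int j"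
  shows "(\<Sum>j\<in>F. 2 powr (- \<gamma> * (real_of_int j - z))) \<le> 1 / (1 - 2 powr (- \<gamma>))"
proof -
  define n where "n j = nat (j - \<lceil>z\<rceil>)" for j
  have ge: "j \<ge> \<lceil>z\<rceil>" if "j \<in> F" for j
    using z[OF that] by (simp add: ceiling_le_iff)
  have inj: "inj_on n F"
  proof (rule inj_onI)
    fix i j assume "i \<in> F" "j \<in> F" "n i = n j"
    then show "i = j" using ge[of i] ge[of j] by (auto simp: n_def)
  qed
  have q: "0 < (2::real) powr (- \<gamma>)" "(2::real) powr (- \<gamma>) < 1"
    using \<gamma> by (auto simp: powr_less_one)
  have "(\<Sum>j\<in>F. 2 powr (- \<gamma> * (real_of_int j - z))) \<le> (\<Sum>j\<in>F. (2 powr (- \<gamma>)) ^ n j)"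
  proof (intro sum_mono)
    fix j assume j: "j \<in> F"
    have "real (n j) \<le> real_of_int j - z"
      using ge[OF j] le_of_int_ceiling[of z] by (simp add: n_def)
    then have "- \<gamma> * (real_of_int j - z) \<le> - \<gamma> * real (n j)"
      using \<gamma> by simp
    then have "(2::real) powr (- \<gamma> * (real_of_int j - z)) \<le> 2 powr (- \<gamma> * real (n j))"
      by (intro powr_mono) auto
    also have "\<dots> = (2 powr (- \<gamma>)) ^ n j"
      by (subst powr_realpow[symmetric]) (auto simp: powr_powr)
    finally show "(2::real) powr (- \<gamma> * (real_of_int j - z)) \<le> (2 powr (- \<gamma>)) ^ n j" .
  qed
  also have "\<dots> = (\<Sum>k\<in>n ` F. (2 powr (- \<gamma>)) ^ k)"
    using inj by (simp add: sum.reindex)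
  also have "\<dots> \<le> (\<Sum>k. (2 powr (- \<gamma>)) ^ k)"
    using q F by (intro sum_le_suminf summable_geometric) auto
  also have "\<dots> = 1 / (1 - 2 powr (- \<gamma>))"
    using q by (intro suminf_geometric) auto
  finally show ?thesis .
qed

lemma sum_geometric_below:
  fixes F :: "int set"
  assumes F: "finite F" and \<gamma>: "\<gamma> > 0" and z: "\<And>j. j \<in> F \<Longrightarrow> real_of_int j \<le> z"
  shows "(\<Sum>j\<in>F. 2 powr (\<gamma> * (real_of_int j - z))) \<le> 1 / (1 - 2 powr (- \<gamma>))"
proof -
  have "(\<Sum>j\<in>uminus ` F. 2 powr (- \<gamma> * (real_of_int j - (- z)))) \<le> 1 / (1 - 2 powr (- \<gamma>))"
    using F z by (intro sum_geometric_above[OF _ \<gamma>]) auto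
  also have "(\<Sum>j\<in>uminus ` F. 2 powr (- \<gamma> * (real_of_int j - (- z))))
      = (\<Sum>j\<in>F. 2 powr (\<gamma> * (real_of_int j - z)))"
    by (subst sum.reindex) (auto simp: algebra_simps intro!: sum.cong)
  finally show ?thesis .
qed

lemma geometric_limit_nonneg: "\<gamma> > 0 \<Longrightarrow> 0 \<le> 1 / (1 - 2 powr (- \<gamma> :: real))"
  by (simp add: powr_less_one less_imp_le)

text \<open>
  The terms are bounded by a growing and by a decaying exponential in \<open>j\<close>.  The two bounds cross
  where \<open>2\<^sup>j = t powr (- \<zeta>)\<close>, at the common height \<open>A * t powr \<rho>\<close>, and decay geometrically away from the
  crossing point on either side.  So the sum is of the order of that height, without a factor
  counting the terms.  The conditions on \<open>\<zeta>\<close> and \<open>\<rho>\<close> locate the crossing point.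
\<close>

lemma sum_balanced_exponentials_le:
  fixes F :: "int set" and c :: "int \<Rightarrow> real"
  assumes F: "finite F" and \<alpha>: "\<alpha> > 0" and \<beta>: "\<beta> > 0" and t: "t > 0" and A: "A \<ge> 0"
    and up: "\<And>j. j \<in> F \<Longrightarrow> c j \<le> A * t powr a * 2 powr (real_of_int j * \<alpha>)"
    and down: "\<And>j. j \<in> F \<Longrightarrow> c j \<le> A * t powr b * 2 powr (- (real_of_int j * \<beta>))"
    and a: "a - \<zeta> * \<alpha> = \<rho>" and b: "b + \<zeta> * \<beta> = \<rho>"
  shows "(\<Sum>j\<in>F. c j) \<le> A * (1 / (1 - 2 powr (- \<alpha>)) + 1 / (1 - 2 powr (- \<beta>))) * t powr \<rho>"
proof -
  define z where "z = - \<zeta> * log 2 t"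
  define D where "D = {j \<in> F. real_of_int j \<le> z}"
  define U where "U = {j \<in> F. \<not> real_of_int j \<le> z}"
  have tz: "t powr x = 2 powr (x * log 2 t)" for x
    using t by (simp add: powr_def log_def)
  have a': "t powr a * 2 powr (real_of_int j * \<alpha>) = t powr \<rho> * 2 powr (\<alpha> * (real_of_int j - z))" for j
    unfolding tz a[symmetric] z_def by (simp add: algebra_simps flip: powr_add)
  have b': "t powr b * 2 powr (- (real_of_int j * \<beta>)) = t powr \<rho> * 2 powr (- \<beta> * (real_of_int j - z))" for j
    unfolding tz b[symmetric] z_def by (simp add: algebra_simps flip: powr_add)
  have "(\<Sum>j\<in>F. c j) = (\<Sum>j\<in>D. c j) + (\<Sum>j\<in>U. c j)"
    using F by (subst sum.union_disjoint[symmetric]) (auto simp: D_def U_def intro!: sum.cong)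
  also have "(\<Sum>j\<in>D. c j) \<le> (\<Sum>j\<in>D. A * t powr \<rho> * 2 powr (\<alpha> * (real_of_int j - z)))"
    using up a' by (intro sum_mono) (simp add: D_def mult.assoc)
  also have "\<dots> = A * t powr \<rho> * (\<Sum>j\<in>D. 2 powr (\<alpha> * (real_of_int j - z)))"
    by (simp add: sum_distrib_left)
  also have "\<dots> \<le> A * t powr \<rho> * (1 / (1 - 2 powr (- \<alpha>)))"
    using F A by (intro mult_left_mono sum_geometric_below[OF _ \<alpha>]) (auto simp: D_def)
  also have "(\<Sum>j\<in>U. c j) \<le> (\<Sum>j\<in>U. A * t powr \<rho> * 2 powr (- \<beta> * (real_of_int j - z)))"
    using down b' by (intro sum_mono) (simp add: U_def mult.assoc)
  also have "\<dots> = A * t powr \<rho> * (\<Sum>j\<in>U. 2 powr (- \<beta> * (real_of_int j - z)))"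
    by (simp add: sum_distrib_left)
  also have "\<dots> \<le> A * t powr \<rho> * (1 / (1 - 2 powr (- \<beta>)))"
    using F A by (intro mult_left_mono sum_geometric_above[OF _ \<beta>]) (auto simp: U_def)
  finally show ?thesis by (simp add: algebra_simps)
qed

section \<open>Truncated moments of Gaussian white noise\<close>

text \<open>
  The tilt \<open>exp (z\<^sup>2 / 4)\<close> is what a tail estimate gains.  It uses up half of the Gaussian decay; the
  other half keeps the integral convergent.
\<close>

definition tilted_moment :: "real \<Rightarrow> real" where
  "tilted_moment p = (\<integral>z. std_normal_density z * (\<bar>z\<bar> powr p * exp (z\<^sup>2 / 4)) \<partial>lborel)"

lemma integrable_tilted_moment:
  assumes p: "p \<ge> 0"
  shows "integrable lborel (\<lambda>z. std_normal_density z * (\<bar>z\<bar> powr p * exp (z\<^sup>2 / 4)))"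
proof -
  define n where "n = nat \<lceil>p\<rceil>"
  have n: "p \<le> real n" using p unfolding n_def by linarith
  have dens: "std_normal_density z * exp (z\<^sup>2 / 4) = sqrt 2 * normal_density 0 (sqrt 2) z" for z
  proof -
    have "- z\<^sup>2 / 2 + z\<^sup>2 / 4 = - z\<^sup>2 / 4" by simp
    then have "exp (- z\<^sup>2 / 2) * exp (z\<^sup>2 / 4) = exp (- z\<^sup>2 / 4)"
      by (simp only: exp_add[symmetric])
    then show ?thesis
      by (simp add: normal_density_def real_sqrt_mult field_simps)
  qed
  have "integrable lborel (\<lambda>z. sqrt 2 * (normal_density 0 (sqrt 2) z * \<bar>z - 0\<bar> ^ 0 + normal_density 0 (sqrt 2) z * \<bar>z - 0\<bar> ^ n))"
    by (intro integrable_mult_right Bochner_Integration.integrable_add integrable_normal_moment_abs) auto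
  then show ?thesis
  proof (rule Bochner_Integration.integrable_bound)
    show "AE z in lborel. norm (std_normal_density z * (\<bar>z\<bar> powr p * exp (z\<^sup>2 / 4)))
        \<le> norm (sqrt 2 * (normal_density 0 (sqrt 2) z * \<bar>z - 0\<bar> ^ 0 + normal_density 0 (sqrt 2) z * \<bar>z - 0\<bar> ^ n))"
    proof (rule AE_I2)
      fix z :: real
      have "\<bar>z\<bar> powr p \<le> 1 + \<bar>z\<bar> ^ n"
      proof (cases "\<bar>z\<bar> \<le> 1")
        case True
        then have "\<bar>z\<bar> powr p \<le> 1" using p by (simp add: powr_le1)
        then show ?thesis by (simp add: add_increasing2)
      next
        case False
        then have "\<bar>z\<bar> powr p \<le> \<bar>z\<bar> powr real n" using n by (intro powr_mono) auto
        then show ?thesis using False by (auto simp: powr_realpow)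
      qed
      then have "sqrt 2 * normal_density 0 (sqrt 2) z * \<bar>z\<bar> powr p
          \<le> sqrt 2 * normal_density 0 (sqrt 2) z * (1 + \<bar>z\<bar> ^ n)"
        by (intro mult_left_mono) auto
      moreover have "std_normal_density z * (\<bar>z\<bar> powr p * exp (z\<^sup>2 / 4))
          = sqrt 2 * normal_density 0 (sqrt 2) z * \<bar>z\<bar> powr p"
        using dens[of z] by (metis mult.assoc mult.commute)
      ultimately have "std_normal_density z * (\<bar>z\<bar> powr p * exp (z\<^sup>2 / 4))
          \<le> sqrt 2 * normal_density 0 (sqrt 2) z * (1 + \<bar>z\<bar> ^ n)"
        by (simp only:)
      then show "norm (std_normal_density z * (\<bar>z\<bar> powr p * exp (z\<^sup>2 / 4)))
        \<le> norm (sqrt 2 * (normal_density 0 (sqrt 2) z * \<bar>z - 0\<bar> ^ 0 + normal_density 0 (sqrt 2) z * \<bar>z - 0\<bar> ^ n))"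
        by (simp add: algebra_simps)
    qed
  qed simp
qed

lemma tilted_moment_nonneg: "tilted_moment p \<ge> 0"
  unfolding tilted_moment_def by (intro integral_nonneg_AE) auto

text \<open>
  A Chernoff bound: on the event \<open>\<bar>\<xi>\<bar> > x\<close> the tilt is at least \<open>exp (x\<^sup>2 / 4)\<close>.
\<close>

lemma std_normal_truncated_moment_le:
  assumes \<xi>: "distributed P lborel \<xi> std_normal_density" and p: "p \<ge> 0" and x: "x \<ge> 0"
  shows "(\<integral>\<^sup>+\<omega>. ennreal (if \<bar>\<xi> \<omega>\<bar> > x then \<bar>\<xi> \<omega>\<bar> powr p else 0) \<partial>P)
           \<le> ennreal (tilted_moment p * exp (- x\<^sup>2 / 4))"
proof -
  have [measurable]: "\<xi> \<in> borel_measurable P"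
    using distributed_measurable[OF \<xi>] by simp
  have "(\<integral>\<^sup>+\<omega>. ennreal (if \<bar>\<xi> \<omega>\<bar> > x then \<bar>\<xi> \<omega>\<bar> powr p else 0) \<partial>P)
      \<le> (\<integral>\<^sup>+\<omega>. ennreal (exp (- x\<^sup>2 / 4)) * ennreal (\<bar>\<xi> \<omega>\<bar> powr p * exp ((\<xi> \<omega>)\<^sup>2 / 4)) \<partial>P)"
  proof (intro nn_integral_mono)
    fix \<omega>
    have "\<bar>\<xi> \<omega>\<bar> powr p \<le> exp (- x\<^sup>2 / 4) * (\<bar>\<xi> \<omega>\<bar> powr p * exp ((\<xi> \<omega>)\<^sup>2 / 4))" if "\<bar>\<xi> \<omega>\<bar> > x"
    proof -
      have "x\<^sup>2 \<le> (\<xi> \<omega>)\<^sup>2"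
        using that x by (intro abs_le_square_iff[THEN iffD1]) auto
      then have "1 \<le> exp (- x\<^sup>2 / 4 + (\<xi> \<omega>)\<^sup>2 / 4)" by simp
      then have "\<bar>\<xi> \<omega>\<bar> powr p * 1 \<le> \<bar>\<xi> \<omega>\<bar> powr p * exp (- x\<^sup>2 / 4 + (\<xi> \<omega>)\<^sup>2 / 4)"
        by (intro mult_left_mono) auto
      then show ?thesis by (simp only: exp_add) (simp add: algebra_simps)
    qed
    then show "ennreal (if \<bar>\<xi> \<omega>\<bar> > x then \<bar>\<xi> \<omega>\<bar> powr p else 0)
        \<le> ennreal (exp (- x\<^sup>2 / 4)) * ennreal (\<bar>\<xi> \<omega>\<bar> powr p * exp ((\<xi> \<omega>)\<^sup>2 / 4))"
      by (auto simp flip: ennreal_mult')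
  qed
  also have "\<dots> = ennreal (exp (- x\<^sup>2 / 4)) * (\<integral>\<^sup>+\<omega>. ennreal (\<bar>\<xi> \<omega>\<bar> powr p * exp ((\<xi> \<omega>)\<^sup>2 / 4)) \<partial>P)"
    by (intro nn_integral_cmult) measurable
  also have "(\<integral>\<^sup>+\<omega>. ennreal (\<bar>\<xi> \<omega>\<bar> powr p * exp ((\<xi> \<omega>)\<^sup>2 / 4)) \<partial>P)
      = (\<integral>\<^sup>+z. ennreal (std_normal_density z) * ennreal (\<bar>z\<bar> powr p * exp (z\<^sup>2 / 4)) \<partial>lborel)"
    by (rule distributed_nn_integral[OF \<xi>, symmetric]) measurable
  also have "\<dots> = (\<integral>\<^sup>+z. ennreal (std_normal_density z * (\<bar>z\<bar> powr p * exp (z\<^sup>2 / 4))) \<partial>lborel)"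
    by (intro nn_integral_cong) (simp add: ennreal_mult')
  also have "\<dots> = ennreal (tilted_moment p)"
    unfolding tilted_moment_def
    by (intro nn_integral_eq_integral integrable_tilted_moment[OF p] AE_I2) simp
  finally show ?thesis
    by (subst (asm) ennreal_mult'[symmetric]) (simp_all add: mult.commute)
qed

lemma white_noise_zero:
  assumes W: "gaussian_white_noise P W"
  shows "AE \<omega> in P. W 0 \<omega> = 0"
proof -
  have "AE \<omega> in P. W (1 *\<^sub>R 0 + 0) \<omega> = 1 * W 0 \<omega> + W 0 \<omega>"
    using W unfolding gaussian_white_noise_def by blast
  then show ?thesis by eventually_elim simp
qed

lemma white_noise_sum:
  assumes W: "gaussian_white_noise P W" and I: "finite I"
  shows "AE \<omega> in P. W (\<Sum>i\<in>I. c i *\<^sub>R h i) \<omega> = (\<Sum>i\<in>I. c i * W (h i) \<omega>)"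
  using I
proof (induction I)
  case empty
  then show ?case using white_noise_zero[OF W] by simp
next
  case (insert i I)
  have "AE \<omega> in P. W (c i *\<^sub>R h i + (\<Sum>i\<in>I. c i *\<^sub>R h i)) \<omega>
      = c i * W (h i) \<omega> + W (\<Sum>i\<in>I. c i *\<^sub>R h i) \<omega>"
    using W unfolding gaussian_white_noise_def by blast
  with insert.IH show ?case
    by eventually_elim (use insert.hyps in simp)
qed

lemma white_noise_normalized:
  assumes W: "gaussian_white_noise P W" and h: "h \<noteq> 0"
  shows "AE \<omega> in P. W h \<omega> = norm h * W (h /\<^sub>R norm h) \<omega>"
    and "distributed P lborel (W (h /\<^sub>R norm h)) std_normal_density"
proof -
  have "AE \<omega> in P. W (norm h *\<^sub>R (h /\<^sub>R norm h) + 0) \<omega> = norm h * W (h /\<^sub>R norm h) \<omega> + W 0 \<omega>"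
    using W unfolding gaussian_white_noise_def by blast
  then show "AE \<omega> in P. W h \<omega> = norm h * W (h /\<^sub>R norm h) \<omega>"
    using white_noise_zero[OF W] by eventually_elim (use h in simp)
  have "pairwise orthogonal {h /\<^sub>R norm h} \<and> (\<forall>h\<in>{h /\<^sub>R norm h}. norm h = 1)"
    using h by simp
  then show "distributed P lborel (W (h /\<^sub>R norm h)) std_normal_density"
    using W unfolding gaussian_white_noise_def by blast
qed

text \<open>
  The pairing of the white noise with \<open>h\<close> is \<open>norm h\<close> times a standard normal variable, so truncating
  it at \<open>x\<close> times an upper bound \<open>\<sigma>\<close> of its standard deviation is at least as severe as truncating
  the normalized variable at \<open>x\<close>.
\<close>

lemma white_noise_truncated_moment_le:
  assumes W: "gaussian_white_noise P W" and h: "norm h \<le> \<sigma>"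
    and \<epsilon>: "\<epsilon> > 0" and p: "p \<ge> 0" and x: "x \<ge> 0"
  shows "(\<integral>\<^sup>+\<omega>. ennreal (if \<bar>\<epsilon> * W h \<omega>\<bar> > \<epsilon> * \<sigma> * x then \<bar>\<epsilon> * W h \<omega>\<bar> powr p else 0) \<partial>P)
           \<le> ennreal ((\<epsilon> * \<sigma>) powr p * (tilted_moment p * exp (- x\<^sup>2 / 4)))"
proof (cases "h = 0")
  case True
  have \<sigma>: "\<sigma> \<ge> 0" using h norm_ge_zero order_trans by blast
  have "AE \<omega> in P. ennreal (if \<bar>\<epsilon> * W h \<omega>\<bar> > \<epsilon> * \<sigma> * x then \<bar>\<epsilon> * W h \<omega>\<bar> powr p else 0) = 0"
    using white_noise_zero[OF W] unfolding True by eventually_elim (use \<sigma> \<epsilon> x in auto)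
  then have "(\<integral>\<^sup>+\<omega>. ennreal (if \<bar>\<epsilon> * W h \<omega>\<bar> > \<epsilon> * \<sigma> * x then \<bar>\<epsilon> * W h \<omega>\<bar> powr p else 0) \<partial>P) = 0"
    by (subst nn_integral_cong_AE[where v = "\<lambda>_. 0"]) auto
  then show ?thesis by simp
next
  case False
  define \<xi> where "\<xi> = W (h /\<^sub>R norm h)"
  have \<xi>: "distributed P lborel \<xi> std_normal_density" and W\<xi>: "AE \<omega> in P. W h \<omega> = norm h * \<xi> \<omega>"
    unfolding \<xi>_def using white_noise_normalized[OF W False] by auto
  have nh: "norm h > 0" using False by simp
  have \<sigma>: "\<sigma> > 0" using h nh by linarith
  have [measurable]: "\<xi> \<in> borel_measurable P"
    using distributed_measurable[OF \<xi>] by simp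
  have "(\<integral>\<^sup>+\<omega>. ennreal (if \<bar>\<epsilon> * W h \<omega>\<bar> > \<epsilon> * \<sigma> * x then \<bar>\<epsilon> * W h \<omega>\<bar> powr p else 0) \<partial>P)
      \<le> (\<integral>\<^sup>+\<omega>. ennreal ((\<epsilon> * \<sigma>) powr p) * ennreal (if \<bar>\<xi> \<omega>\<bar> > x then \<bar>\<xi> \<omega>\<bar> powr p else 0) \<partial>P)"
  proof (intro nn_integral_mono_AE)
    show "AE \<omega> in P. ennreal (if \<bar>\<epsilon> * W h \<omega>\<bar> > \<epsilon> * \<sigma> * x then \<bar>\<epsilon> * W h \<omega>\<bar> powr p else 0)
        \<le> ennreal ((\<epsilon> * \<sigma>) powr p) * ennreal (if \<bar>\<xi> \<omega>\<bar> > x then \<bar>\<xi> \<omega>\<bar> powr p else 0)"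
      using W\<xi>
    proof eventually_elim
      fix \<omega> assume eq: "W h \<omega> = norm h * \<xi> \<omega>"
      have le: "\<bar>\<epsilon> * W h \<omega>\<bar> \<le> \<epsilon> * \<sigma> * \<bar>\<xi> \<omega>\<bar>"
        unfolding eq abs_mult using \<epsilon> h by (simp add: mult_right_mono)
      have "\<bar>\<epsilon> * W h \<omega>\<bar> powr p \<le> (\<epsilon> * \<sigma> * \<bar>\<xi> \<omega>\<bar>) powr p"
        using le p by (intro powr_mono2) auto
      also have "\<dots> = (\<epsilon> * \<sigma>) powr p * \<bar>\<xi> \<omega>\<bar> powr p"
        using \<epsilon> \<sigma> by (simp add: powr_mult)
      finally have "\<bar>\<epsilon> * W h \<omega>\<bar> powr p \<le> (\<epsilon> * \<sigma>) powr p * \<bar>\<xi> \<omega>\<bar> powr p" .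
      moreover have "\<bar>\<xi> \<omega>\<bar> > x" if "\<bar>\<epsilon> * W h \<omega>\<bar> > \<epsilon> * \<sigma> * x"
      proof -
        have "\<epsilon> * \<sigma> * x < \<epsilon> * \<sigma> * \<bar>\<xi> \<omega>\<bar>" using that le by linarith
        then show ?thesis using \<epsilon> \<sigma> by (simp add: mult_less_cancel_left)
      qed
      ultimately show "ennreal (if \<bar>\<epsilon> * W h \<omega>\<bar> > \<epsilon> * \<sigma> * x then \<bar>\<epsilon> * W h \<omega>\<bar> powr p else 0)
        \<le> ennreal ((\<epsilon> * \<sigma>) powr p) * ennreal (if \<bar>\<xi> \<omega>\<bar> > x then \<bar>\<xi> \<omega>\<bar> powr p else 0)"
        by (auto simp flip: ennreal_mult')
    qed
  qed
  also have "\<dots> = ennreal ((\<epsilon> * \<sigma>) powr p) *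
      (\<integral>\<^sup>+\<omega>. ennreal (if \<bar>\<xi> \<omega>\<bar> > x then \<bar>\<xi> \<omega>\<bar> powr p else 0) \<partial>P)"
    by (intro nn_integral_cmult) measurable
  also have "\<dots> \<le> ennreal ((\<epsilon> * \<sigma>) powr p) * ennreal (tilted_moment p * exp (- x\<^sup>2 / 4))"
    by (intro mult_left_mono std_normal_truncated_moment_le[OF \<xi> p x]) auto
  finally show ?thesis by (simp add: ennreal_mult')
qed

section \<open>Needlet series as smoothed basis expansions\<close>

locale needlet_frame =
  fixes M :: "'y measure" and e :: "nat \<Rightarrow> 'y \<Rightarrow> real" and X :: "nat \<Rightarrow> 'y set"
    and lam :: "nat \<Rightarrow> 'y \<Rightarrow> real" and \<phi> :: "real \<Rightarrow> real"
  assumes finite_M: "finite_measure M"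
    and basis: "L2_orthonormal_basis M e"
    and setting: "needlet_setting M e X lam \<phi>"
begin

sublocale finite_measure M by (rule finite_M)

abbreviation psi :: "int \<Rightarrow> 'y \<Rightarrow> 'y \<Rightarrow> real" where
  "psi \<equiv> needlet M e lam \<phi>"

definition level :: "('y \<Rightarrow> real) \<Rightarrow> int \<Rightarrow> 'y \<Rightarrow> real" where
  "level f j x = (\<Sum>\<eta>\<in>Z X j. L2_inner M f (psi j \<eta>) * psi j \<eta> x)"

lemma e_L2: "e k \<in> L2_space M"
  using basis by (simp add: L2_orthonormal_basis_def)

lemma e_measurable [measurable]: "e k \<in> borel_measurable M"
  using e_L2[of k] by (simp add: L2_space_def)

lemma e_orthonormal: "L2_inner M (e i) (e k) = (if i = k then 1 else 0)"
  using basis by (simp add: L2_orthonormal_basis_def)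

lemma L2_integrable_mult:
  assumes "f \<in> L2_space M" "h \<in> L2_space M"
  shows "integrable M (\<lambda>x. f x * h x)"
proof (rule Bochner_Integration.integrable_bound)
  show "integrable M (\<lambda>x. (f x)\<^sup>2 + (h x)\<^sup>2)"
    using assms by (simp add: L2_space_def)
  show "(\<lambda>x. f x * h x) \<in> borel_measurable M"
    using assms by (intro borel_measurable_times) (auto simp: L2_space_def)
  have "\<bar>u * v\<bar> \<le> u\<^sup>2 + v\<^sup>2" for u v :: real
    using sum_squares_bound[of "\<bar>u\<bar>" "\<bar>v\<bar>"] mult_nonneg_nonneg[of "\<bar>u\<bar>" "\<bar>v\<bar>"]
    unfolding abs_mult power2_abs by linarith
  then show "AE x in M. norm (f x * h x) \<le> norm ((f x)\<^sup>2 + (h x)\<^sup>2)"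
    by auto
qed

lemma L2_inner_cong:
  "(\<And>x. x \<in> space M \<Longrightarrow> f x = f' x) \<Longrightarrow> (\<And>x. x \<in> space M \<Longrightarrow> h x = h' x)
    \<Longrightarrow> L2_inner M f h = L2_inner M f' h'"
  unfolding L2_inner_def by (intro Bochner_Integration.integral_cong) auto

lemma L2_inner_commute: "L2_inner M f h = L2_inner M h f"
  by (simp add: L2_inner_def mult.commute)

lemma L2_inner_span:
  assumes f: "f \<in> L2_space M"
  shows "L2_inner M f (\<lambda>x. \<Sum>k<n. a k * e k x) = (\<Sum>k<n. a k * L2_inner M f (e k))"
proof -
  have "L2_inner M f (\<lambda>x. \<Sum>k<n. a k * e k x) = (\<integral>x. (\<Sum>k<n. a k * (f x * e k x)) \<partial>M)"
    unfolding L2_inner_def by (simp add: sum_distrib_left algebra_simps)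
  also have "\<dots> = (\<Sum>k<n. a k * L2_inner M f (e k))"
    unfolding L2_inner_def using L2_integrable_mult[OF f e_L2]
    by (subst Bochner_Integration.integral_sum) auto
  finally show ?thesis .
qed

lemma span_L2: "(\<lambda>x. \<Sum>k<n. a k * e k x) \<in> L2_space M"
proof -
  have "integrable M (\<lambda>x. \<Sum>k<n. \<Sum>l<n. (a k * a l) * (e k x * e l x))"
    using L2_integrable_mult[OF e_L2 e_L2]
    by (intro Bochner_Integration.integrable_sum integrable_mult_right)
  then show ?thesis
    unfolding L2_space_def by (simp add: power2_eq_square sum_product algebra_simps)
qed

lemma L2_space_cong:
  assumes "f \<in> L2_space M" and "\<And>x. x \<in> space M \<Longrightarrow> f x = h x"
  shows "h \<in> L2_space M"
proof -
  have "h \<in> borel_measurable M \<longleftrightarrow> f \<in> borel_measurable M"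
    using assms by (intro measurable_cong) auto
  moreover have "integrable M (\<lambda>x. (h x)\<^sup>2) \<longleftrightarrow> integrable M (\<lambda>x. (f x)\<^sup>2)"
    using assms by (intro Bochner_Integration.integrable_cong) auto
  ultimately show ?thesis using assms by (simp add: L2_space_def)
qed

text \<open>
  The distance of \<open>f\<close> to an arbitrary element of a coordinate subspace, not only to its projection;
  the smoothed partial sums produced by the needlets are of this kind.
\<close>

lemma integral_square_diff_span:
  assumes f: "f \<in> L2_space M"
  shows "(\<integral>x. (f x - (\<Sum>k<n. a k * e k x))\<^sup>2 \<partial>M)
           = (\<integral>x. (f x)\<^sup>2 \<partial>M) + (\<Sum>k<n. (a k)\<^sup>2 - 2 * a k * L2_inner M f (e k))"
proof -
  define S where "S x = (\<Sum>k<n. a k * e k x)" for x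
  have S: "S \<in> L2_space M" using span_L2[where n = n and a = a] by (simp add: S_def[abs_def])
  have fS: "(\<integral>x. f x * S x \<partial>M) = (\<Sum>k<n. a k * L2_inner M f (e k))"
    using L2_inner_span[OF f, where n = n and a = a] by (simp add: L2_inner_def S_def)
  have Se: "L2_inner M S (e k) = (if k < n then a k else 0)" for k
    using L2_inner_span[OF e_L2, where n = n and a = a and k1 = k]
    by (subst L2_inner_commute) (simp add: S_def[abs_def] e_orthonormal if_distrib cong: if_cong)
  have SS: "(\<integral>x. S x * S x \<partial>M) = (\<Sum>k<n. (a k)\<^sup>2)"
    using L2_inner_span[OF S, where n = n and a = a] Se
    by (simp add: L2_inner_def S_def[abs_def] power2_eq_square)
  have "(\<integral>x. (f x - S x)\<^sup>2 \<partial>M) = (\<integral>x. (f x)\<^sup>2 - 2 * (f x * S x) + S x * S x \<partial>M)"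
    by (intro Bochner_Integration.integral_cong) (auto simp: power2_eq_square algebra_simps)
  also have "\<dots> = (\<integral>x. (f x)\<^sup>2 \<partial>M) - 2 * (\<integral>x. f x * S x \<partial>M) + (\<integral>x. S x * S x \<partial>M)"
    using L2_integrable_mult[OF f S] L2_integrable_mult[OF S S] f
    by (simp add: L2_space_def)
  finally show ?thesis
    unfolding fS SS S_def[symmetric]
    by (simp add: sum_subtractf sum_distrib_left algebra_simps)
qed

lemma phi_bounds: "0 \<le> \<phi> x" "\<phi> x \<le> 1"
  using setting by (auto simp: needlet_setting_def needlet_window_def)

lemma phi_eq_1: "\<bar>x\<bar> \<le> 1 / 2 \<Longrightarrow> \<phi> x = 1"
  using setting by (auto simp: needlet_setting_def needlet_window_def)

text \<open>
  The support condition gives this for \<open>x > 1\<close>; continuity gives it at the end point.  That \<open>\<phi> 1 = 0\<close>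
  matters: it removes the frequency \<open>2 ^ (n + 1)\<close> from level \<open>n\<close>, and the cubature of that level
  integrates products of exactly the remaining frequencies.
\<close>

lemma phi_eq_0: 
  assumes "x \<ge> 1" shows "\<phi> x = 0"
proof (cases "x = 1")
  case False
  then show ?thesis
    using setting assms by (auto simp: needlet_setting_def needlet_window_def)
next
  case True
  have "(deriv ^^ 0) \<phi> differentiable (at x)"
    using setting unfolding needlet_setting_def needlet_window_def by blast
  then have "isCont \<phi> x"
    by (simp add: differentiable_imp_continuous_within)
  then have "(\<phi> \<longlongrightarrow> \<phi> x) (at_right x)"
    by (simp add: isCont_def filterlim_at_split)
  moreover have "\<forall>\<^sub>F y in at_right x. \<phi> y = 0"
    unfolding True eventually_at_right_field
    using setting by (intro exI[of _ 2]) (auto simp: needlet_setting_def needlet_window_def)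
  then have "(\<phi> \<longlongrightarrow> 0) (at_right x)"
    by (rule tendsto_eventually)
  ultimately show ?thesis
    using tendsto_unique trivial_limit_at_right_real by blast
qed

text \<open>
  The square root in the definition of the window is that of a nonnegative number even if \<open>\<phi>\<close> is not
  monotone, since \<open>\<phi> (x / 2) = 1\<close> wherever \<open>\<phi> x\<close> can be nonzero.
\<close>

lemma needlet_a_square:
  assumes "x \<ge> 0" shows "needlet_a \<phi> x * needlet_a \<phi> x = \<phi> (x / 2) - \<phi> x"
proof -
  have "\<phi> x \<le> \<phi> (x / 2)"
    using phi_eq_0[of x] phi_eq_1[of "x / 2"] phi_bounds assms by (cases "x \<ge> 1") auto
  then show ?thesis by (simp add: needlet_a_def)
qed

lemma needlet_a_eq_0: "x \<ge> 2 \<Longrightarrow> needlet_a \<phi> x = 0"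
  using phi_eq_0[of x] phi_eq_0[of "x / 2"] by (simp add: needlet_a_def)

lemma e0_const:
  obtains c where "\<forall>x\<in>space M. e 0 x = c" "c\<^sup>2 * measure M (space M) = 1"
proof -
  obtain c where c: "\<forall>x\<in>space M. e 0 x = c"
    using setting unfolding needlet_setting_def by blast
  have "1 = L2_inner M (e 0) (e 0)" by (simp add: e_orthonormal)
  also have "\<dots> = L2_inner M (\<lambda>_. c) (\<lambda>_. c)" by (intro L2_inner_cong) (simp_all add: c)
  also have "\<dots> = c\<^sup>2 * measure M (space M)" by (simp add: L2_inner_def power2_eq_square)
  finally show ?thesis by (intro that[of c]) (simp_all add: c)
qed

lemma needlet_nonneg_level:
  "psi (int n) \<eta> x = sqrt (lam (cubature_degree (int n)) \<eta>) *
     (\<Sum>k<2 ^ (n + 1). needlet_a \<phi> (real k / 2 ^ n) * (e k x * e k \<eta>))"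
proof -
  have "(\<Sum>k. needlet_a \<phi> (real k / 2 ^ n) * (e k x * e k \<eta>))
      = (\<Sum>k<2 ^ (n + 1). needlet_a \<phi> (real k / 2 ^ n) * (e k x * e k \<eta>))"
  proof (rule suminf_finite)
    fix k :: nat assume "k \<notin> {..<2 ^ (n + 1)}"
    then have "real (2 ^ (n + 1)) \<le> real k" by (subst of_nat_le_iff) auto
    then have "2 \<le> real k / 2 ^ n" by (simp add: field_simps)
    then show "needlet_a \<phi> (real k / 2 ^ n) * (e k x * e k \<eta>) = 0"
      by (simp add: needlet_a_eq_0)
  qed simp
  then show ?thesis by (simp add: needlet_def powr_realpow)
qed

lemma needlet_in_span:
  "\<exists>n a. \<forall>x\<in>space M. psi j \<eta> x = (\<Sum>k<n. a k * e k x)"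
proof (cases "j < 0")
  case True
  obtain c where c: "\<forall>x\<in>space M. e 0 x = c" "c\<^sup>2 * measure M (space M) = 1"
    using e0_const by blast
  then have "c \<noteq> 0" by auto
  then show ?thesis
    using True c(1) by (intro exI[of _ "Suc 0"] exI[of _ "\<lambda>_. 1 / sqrt (measure M (space M)) / c"]) (simp add: needlet_def)
next
  case False
  then obtain n where j: "j = int n" by (metis not_less zero_le_imp_eq_int)
  show ?thesis
    by (intro exI[of _ "2 ^ (n + 1)"] exI[of _ "\<lambda>k. sqrt (lam (cubature_degree (int n)) \<eta>) * (needlet_a \<phi> (real k / 2 ^ n) * e k \<eta>)"])
      (simp only: j needlet_nonneg_level sum_distrib_left mult_ac ball_triv simp_thms)
qed

lemma needlet_L2: "psi j \<eta> \<in> L2_space M"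
proof -
  obtain n a where "\<forall>x\<in>space M. psi j \<eta> x = (\<Sum>k<n. a k * e k x)"
    using needlet_in_span[of j \<eta>] by blast
  then show ?thesis
    by (intro L2_space_cong[OF span_L2[where n = n and a = a]]) simp
qed

lemma needlet_measurable [measurable]: "psi j \<eta> \<in> borel_measurable M"
  using needlet_L2 by (simp add: L2_space_def)

text \<open>
  A needlet has finitely many coordinates, so the series in the estimator is a finite sum.
\<close>

lemma L2_inner_needlet:
  obtains n where "\<forall>i\<ge>n. needlet_coord M e lam \<phi> j \<eta> i = 0"
    and "\<forall>f\<in>L2_space M.
      L2_inner M f (psi j \<eta>) = (\<Sum>i<n. needlet_coord M e lam \<phi> j \<eta> i * L2_inner M f (e i))"
proof -
  obtain n a where a: "\<forall>x\<in>space M. psi j \<eta> x = (\<Sum>k<n. a k * e k x)"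
    using needlet_in_span[of j \<eta>] by blast
  have inner: "L2_inner M f (psi j \<eta>) = (\<Sum>k<n. a k * L2_inner M f (e k))"
    if "f \<in> L2_space M" for f
    using L2_inner_span[OF that, where n = n and a = a] a
    by (subst L2_inner_cong[of f f "psi j \<eta>" "\<lambda>x. \<Sum>k<n. a k * e k x"]) auto
  have coord: "needlet_coord M e lam \<phi> j \<eta> i = (if i < n then a i else 0)" for i
    unfolding needlet_coord_def using inner[OF e_L2, of i]
    by (subst L2_inner_commute) (simp add: e_orthonormal if_distrib cong: if_cong)
  show ?thesis
    by (rule that[of n]) (simp_all add: coord inner)
qed

lemma e_in_sum_space: "k \<le> n \<Longrightarrow> e k \<in> sum_space M e n"
  unfolding sum_space_def by (auto intro!: exI[of _ "\<lambda>m. if m = k then 1 else 0"] simp: if_distrib[of "\<lambda>c. c * _"] cong: if_cong)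

text \<open>
  Both frequencies are at most \<open>2 ^ (n + 1) - 1\<close>, so their product lies in the span of degree
  \<open>2 ^ (n + 2) - 2\<close>, which is the degree of exactness of the cubature: on the cubature points of a level
  the basis is still orthonormal.
\<close>

lemma cubature_orthonormal:
  assumes "i < 2 ^ (n + 1)" "k < 2 ^ (n + 1)"
  shows "(\<Sum>\<eta>\<in>Z X (int n). lam (cubature_degree (int n)) \<eta> * (e i \<eta> * e k \<eta>)) = (if i = k then 1 else 0)"
proof -
  define m :: nat where "m = 2 ^ (n + 1) - 1"
  have deg: "cubature_degree (int n) = m + m"
    by (simp add: cubature_degree_def m_def)
  have "i \<le> m" "k \<le> m" using assms by (auto simp: m_def)
  then have "(\<lambda>x. e i x * e k x) \<in> sum_space M e (m + m)"
    using setting e_in_sum_space unfolding needlet_setting_def by blast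
  then have "(\<integral>x. e i x * e k x \<partial>M) = (\<Sum>\<eta>\<in>X (m + m). lam (m + m) \<eta> * (e i \<eta> * e k \<eta>))"
    using setting unfolding needlet_setting_def cubature_def by (elim conjE) blast
  then show ?thesis
    using e_orthonormal[of i k] by (simp add: L2_inner_def Z_def deg)
qed

lemma Z_properties:
  "finite (Z X j)" "\<eta> \<in> Z X j \<Longrightarrow> lam (cubature_degree j) \<eta> > 0"
  using setting by (auto simp: Z_def needlet_setting_def cubature_def)

text \<open>
  The cubature has to integrate the square of \<open>e 0\<close>, whose integral is \<open>1\<close>.
\<close>

lemma Z_nonempty: "Z X j \<noteq> {}"
proof (cases "j < 0")
  case True
  then have "card (Z X j) = 1"
    using setting by (simp add: Z_def cubature_degree_def needlet_setting_def cubature_def)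
  then show ?thesis by auto
next
  case False
  then obtain n where "j = int n" by (metis not_less zero_le_imp_eq_int)
  then show ?thesis using cubature_orthonormal[of 0 n 0] by auto
qed

lemma L2_inner_needlet_nonneg_level:
  assumes f: "f \<in> L2_space M"
  shows "L2_inner M f (psi (int n) \<eta>) = sqrt (lam (cubature_degree (int n)) \<eta>) *
     (\<Sum>k<2 ^ (n + 1). needlet_a \<phi> (real k / 2 ^ n) * e k \<eta> * L2_inner M f (e k))"
proof -
  have "psi (int n) \<eta> = (\<lambda>x. \<Sum>k<2 ^ (n + 1). (sqrt (lam (cubature_degree (int n)) \<eta>) * (needlet_a \<phi> (real k / 2 ^ n) * e k \<eta>)) * e k x)"
    by (rule ext) (simp only: needlet_nonneg_level sum_distrib_left mult_ac)
  then have "L2_inner M f (psi (int n) \<eta>)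
      = (\<Sum>k<2 ^ (n + 1). (sqrt (lam (cubature_degree (int n)) \<eta>) * (needlet_a \<phi> (real k / 2 ^ n) * e k \<eta>)) * L2_inner M f (e k))"
    by (simp only: L2_inner_span[OF f])
  then show ?thesis
    by (simp only: sum_distrib_left mult_ac)
qed

text \<open>
  Discrete orthonormality at the cubature points collapses the synthesis of the coefficients of a
  level to a multiplier on the basis coefficients.  The multiplier is the square of the window, a
  difference of two dilates of \<open>\<phi>\<close>.
\<close>

lemma level_nonneg:
  assumes f: "f \<in> L2_space M"
  shows "level f (int n) x = (\<Sum>k<2 ^ (n + 1).
           (\<phi> (real k / 2 ^ (n + 1)) - \<phi> (real k / 2 ^ n)) * (L2_inner M f (e k) * e k x))"
proof -
  define l where "l = lam (cubature_degree (int n))"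
  define a where "a k = needlet_a \<phi> (real k / 2 ^ n)" for k
  define c where "c k = L2_inner M f (e k)" for k
  define I :: "nat set" where "I = {..<2 ^ (n + 1)}"
  have factor: "s * A * (s * B) = l * (A * B)" if "s * s = l" for s A B l :: real
    unfolding that[symmetric] by (simp only: mult_ac)
  have "level f (int n) x = (\<Sum>\<eta>\<in>Z X (int n). l \<eta> * ((\<Sum>k\<in>I. a k * e k \<eta> * c k) * (\<Sum>i\<in>I. a i * (e i x * e i \<eta>))))"
    unfolding level_def
  proof (intro sum.cong refl)
    fix \<eta> assume "\<eta> \<in> Z X (int n)"
    then have "sqrt (l \<eta>) * sqrt (l \<eta>) = l \<eta>"
      using Z_properties(2)[of \<eta> "int n"] by (simp add: l_def)
    then show "L2_inner M f (psi (int n) \<eta>) * psi (int n) \<eta> x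
        = l \<eta> * ((\<Sum>k\<in>I. a k * e k \<eta> * c k) * (\<Sum>i\<in>I. a i * (e i x * e i \<eta>)))"
      unfolding L2_inner_needlet_nonneg_level[OF f] needlet_nonneg_level l_def a_def c_def I_def
      by (rule factor)
  qed
  also have "\<dots> = (\<Sum>\<eta>\<in>Z X (int n). \<Sum>k\<in>I. \<Sum>i\<in>I. (a k * c k * (a i * e i x)) * (l \<eta> * (e k \<eta> * e i \<eta>)))"
    by (intro sum.cong refl, subst sum_product) (simp add: sum_distrib_left mult_ac)
  also have "\<dots> = (\<Sum>k\<in>I. \<Sum>i\<in>I. \<Sum>\<eta>\<in>Z X (int n). (a k * c k * (a i * e i x)) * (l \<eta> * (e k \<eta> * e i \<eta>)))"
    by (subst sum.swap) (intro sum.cong refl sum.swap)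
  also have "\<dots> = (\<Sum>k\<in>I. \<Sum>i\<in>I. (a k * c k * (a i * e i x)) * (if k = i then 1 else 0))"
    unfolding sum_distrib_left[symmetric] l_def
    by (intro sum.cong refl arg_cong2[where f = "(*)"] cubature_orthonormal) (auto simp: I_def)
  also have "\<dots> = (\<Sum>k\<in>I. a k * c k * (a k * e k x))"
    by (intro sum.cong refl) (simp add: I_def if_distrib cong: if_cong)
  also have "\<dots> = (\<Sum>k\<in>I. (\<phi> (real k / 2 ^ (n + 1)) - \<phi> (real k / 2 ^ n)) * (c k * e k x))"
  proof (intro sum.cong refl)
    fix k
    have "a k * a k = \<phi> (real k / 2 ^ (n + 1)) - \<phi> (real k / 2 ^ n)"
      unfolding a_def by (subst needlet_a_square) (auto simp: field_simps)
    then show "a k * c k * (a k * e k x) = (\<phi> (real k / 2 ^ (n + 1)) - \<phi> (real k / 2 ^ n)) * (c k * e k x)"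
      by (metis mult.assoc mult.left_commute)
  qed
  finally show ?thesis by (simp add: I_def c_def)
qed

text \<open>
  The coarsest level is the projection onto the constants.  The multipliers of all other levels
  vanish at frequency \<open>0\<close>.
\<close>

lemma level_minus_one:
  assumes x: "x \<in> space M"
  shows "level f (-1) x = L2_inner M f (e 0) * e 0 x"
proof -
  obtain c where c: "\<forall>x\<in>space M. e 0 x = c" "c\<^sup>2 * measure M (space M) = 1"
    using e0_const by blast
  define w where "w = 1 / sqrt (measure M (space M))"
  have w: "w * w = c * c"
    using c(2) by (simp add: w_def power2_eq_square) (metis mult.commute nonzero_eq_divide_eq mult_zero_right zero_neq_one mult.assoc)
  have "card (Z X (-1)) = 1"
    using setting by (simp add: Z_def cubature_degree_def needlet_setting_def cubature_def)
  then obtain \<eta> where \<eta>: "Z X (-1) = {\<eta>}" by (auto simp: card_1_singleton_iff)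
  have "psi (-1) \<eta> = (\<lambda>_. w)" by (rule ext) (simp add: needlet_def w_def)
  then have "level f (-1) x = L2_inner M f (\<lambda>_. w) * w"
    by (simp add: level_def \<eta>)
  also have "\<dots> = (w * w) * (\<integral>x. f x \<partial>M)" by (simp add: L2_inner_def)
  also have "\<dots> = L2_inner M f (\<lambda>_. c) * c" by (simp add: L2_inner_def w)
  also have "L2_inner M f (\<lambda>_. c) = L2_inner M f (e 0)"
    by (intro L2_inner_cong) (simp_all add: c)
  finally show ?thesis using c(1) x by simp
qed

text \<open>
  The multipliers of consecutive levels telescope.
\<close>

lemma sum_levels:
  assumes f: "f \<in> L2_space M" and x: "x \<in> space M"
  shows "(\<Sum>j\<in>{-1..int n}. level f j x)
      = (\<Sum>k<2 ^ (n + 1). \<phi> (real k / 2 ^ (n + 1)) * L2_inner M f (e k) * e k x)"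
proof (induction n)
  case 0
  have "{-1..int 0} = {-1, 0}" by auto
  then have "(\<Sum>j\<in>{-1..int 0}. level f j x) = level f (-1) x + level f (int 0) x"
    by simp
  also have "level f (int 0) x = (\<phi> (1/2) - \<phi> 1) * (L2_inner M f (e 1) * e 1 x)"
    by (subst level_nonneg[OF f]) (simp add: numeral_2_eq_2)
  finally show ?case
    using level_minus_one[OF x] phi_eq_0[of 1] phi_eq_1[of 0] by (simp add: numeral_2_eq_2)
next
  case (Suc n)
  define c where "c k = L2_inner M f (e k) * e k x" for k
  have "{-1..int (Suc n)} = insert (int (Suc n)) {-1..int n}" by auto
  then have "(\<Sum>j\<in>{-1..int (Suc n)}. level f j x)
      = level f (int (Suc n)) x + (\<Sum>j\<in>{-1..int n}. level f j x)"
    by simp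
  also have "(\<Sum>j\<in>{-1..int n}. level f j x) = (\<Sum>k<2 ^ (n + 1). \<phi> (real k / 2 ^ (n + 1)) * c k)"
    unfolding Suc.IH c_def by (simp only: mult.assoc)
  also have "\<dots> = (\<Sum>k<2 ^ (Suc n + 1). \<phi> (real k / 2 ^ (n + 1)) * c k)"
  proof (rule sum.mono_neutral_left)
    show "{..<2 ^ (n + 1)} \<subseteq> {..<(2::nat) ^ (Suc n + 1)}" by auto
    show "\<forall>k\<in>{..<2 ^ (Suc n + 1)} - {..<2 ^ (n + 1)}. \<phi> (real k / 2 ^ (n + 1)) * c k = 0"
    proof
      fix k :: nat assume "k \<in> {..<2 ^ (Suc n + 1)} - {..<2 ^ (n + 1)}"
      then have "real (2 ^ (n + 1)) \<le> real k" by (subst of_nat_le_iff) auto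
      then have "1 \<le> real k / 2 ^ (n + 1)" by (simp add: field_simps)
      then show "\<phi> (real k / 2 ^ (n + 1)) * c k = 0" by (simp add: phi_eq_0)
    qed
  qed simp
  also have "level f (int (Suc n)) x = (\<Sum>k<2 ^ (Suc n + 1).
           (\<phi> (real k / 2 ^ (Suc n + 1)) - \<phi> (real k / 2 ^ (n + 1))) * c k)"
    unfolding c_def by (subst level_nonneg[OF f]) simp
  finally show ?case
    by (simp add: c_def algebra_simps flip: sum.distrib)
qed

text \<open>
  The smoothed partial sum of order \<open>2 ^ (n + 1)\<close> agrees with \<open>f\<close> in the coordinates below \<open>2 ^ n\<close>, and
  a multiplier in \<open>[0, 1]\<close> only brings it closer to \<open>f\<close> in the others.  So it is at least as close to
  \<open>f\<close> as the sharp partial sum of order \<open>2 ^ n\<close>.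
\<close>

lemma sum_levels_tendsto_L2:
  assumes f: "f \<in> L2_space M"
  shows "(\<lambda>n. \<integral>x. (f x - (\<Sum>j\<in>{-1..int n}. level f j x))\<^sup>2 \<partial>M) \<longlonglongrightarrow> 0"
proof -
  define c where "c k = L2_inner M f (e k)" for k
  define I where "I n = (\<integral>x. (f x - (\<Sum>k<n. c k * e k x))\<^sup>2 \<partial>M)" for n
  have "(\<lambda>n. L2_norm M (\<lambda>x. f x - (\<Sum>i<n. L2_inner M f (e i) * e i x))) \<longlonglongrightarrow> 0"
    using basis f unfolding L2_orthonormal_basis_def by blast
  then have "(\<lambda>n. (L2_norm M (\<lambda>x. f x - (\<Sum>i<n. L2_inner M f (e i) * e i x)))\<^sup>2) \<longlonglongrightarrow> 0\<^sup>2"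
    by (rule tendsto_power)
  moreover have "(L2_norm M (\<lambda>x. f x - (\<Sum>i<n. L2_inner M f (e i) * e i x)))\<^sup>2 = I n" for n
    by (simp add: L2_norm_def L2_inner_def I_def c_def flip: power2_eq_square)
  ultimately have "I \<longlonglongrightarrow> 0" by simp
  then have lim: "(\<lambda>n. I (2 ^ n)) \<longlonglongrightarrow> 0"
    by (rule LIMSEQ_subseq_LIMSEQ[unfolded comp_def]) (simp add: strict_mono_def)
  show ?thesis
  proof (rule tendsto_sandwich[OF _ _ tendsto_const lim])
    show "\<forall>\<^sub>F n in sequentially. 0 \<le> (\<integral>x. (f x - (\<Sum>j\<in>{-1..int n}. level f j x))\<^sup>2 \<partial>M)"
      by simp
    have "(\<integral>x. (f x - (\<Sum>j\<in>{-1..int n}. level f j x))\<^sup>2 \<partial>M) \<le> I (2 ^ n)" for n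
    proof -
      define q where "q k = \<phi> (real k / 2 ^ (n + 1))" for k
      have q: "0 \<le> q k" "q k \<le> 1" for k using phi_bounds by (auto simp: q_def)
      have q1: "q k = 1" if "k < 2 ^ n" for k
      proof -
        have "real k < real (2 ^ n)" using that by (subst of_nat_less_iff)
        then show ?thesis unfolding q_def by (intro phi_eq_1) (simp add: field_simps)
      qed
      have "(\<integral>x. (f x - (\<Sum>j\<in>{-1..int n}. level f j x))\<^sup>2 \<partial>M)
          = (\<integral>x. (f x - (\<Sum>k<2 ^ (n + 1). q k * c k * e k x))\<^sup>2 \<partial>M)"
        by (intro Bochner_Integration.integral_cong refl) (simp add: sum_levels[OF f] q_def c_def)
      also have "\<dots> = (\<integral>x. (f x)\<^sup>2 \<partial>M) + (\<Sum>k<2 ^ (n + 1). (q k * c k)\<^sup>2 - 2 * (q k * c k) * c k)"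
        using integral_square_diff_span[OF f, where n = "2 ^ (n + 1)" and a = "\<lambda>k. q k * c k"]
        by (simp only: c_def)
      also have "(\<Sum>k<2 ^ (n + 1). (q k * c k)\<^sup>2 - 2 * (q k * c k) * c k)
          \<le> (\<Sum>k<2 ^ n. (q k * c k)\<^sup>2 - 2 * (q k * c k) * c k)"
      proof -
        have "(q k * c k)\<^sup>2 - 2 * (q k * c k) * c k \<le> 0" for k
        proof -
          have "(q k * c k)\<^sup>2 - 2 * (q k * c k) * c k = - (q k * (2 - q k) * (c k)\<^sup>2)"
            by (simp add: power2_eq_square algebra_simps)
          also have "\<dots> \<le> 0" using q[of k] by simp
          finally show ?thesis .
        qed
        then have "(\<Sum>k<2 ^ n. - ((q k * c k)\<^sup>2 - 2 * (q k * c k) * c k))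
            \<le> (\<Sum>k<2 ^ (n + 1). - ((q k * c k)\<^sup>2 - 2 * (q k * c k) * c k))"
          by (intro sum_mono2) auto
        then show ?thesis by (simp only: sum_negf neg_le_iff_le)
      qed
      also have "(\<Sum>k<2 ^ n. (q k * c k)\<^sup>2 - 2 * (q k * c k) * c k)
          = (\<Sum>k<2 ^ n. (c k)\<^sup>2 - 2 * c k * c k)"
        using q1 by (intro sum.cong) auto
      also have "(\<integral>x. (f x)\<^sup>2 \<partial>M) + \<dots> = I (2 ^ n)"
        unfolding I_def using integral_square_diff_span[OF f, where n = "2 ^ n" and a = c]
        by (simp only: c_def)
      finally show ?thesis by simp
    qed
    then show "\<forall>\<^sub>F n in sequentially. (\<integral>x. (f x - (\<Sum>j\<in>{-1..int n}. level f j x))\<^sup>2 \<partial>M) \<le> I (2 ^ n)"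
      by simp
  qed
qed

lemma level_measurable [measurable]: "level f j \<in> borel_measurable M"
  unfolding level_def[abs_def] by measurable

lemma sum_levels_AE_subseq:
  assumes f: "f \<in> L2_space M"
  obtains r :: "nat \<Rightarrow> nat" where "strict_mono r"
    "AE x in M. (\<lambda>n. \<Sum>j\<in>{-1..int (r n)}. level f j x) \<longlonglongrightarrow> f x"
proof -
  define u where "u n x = (f x - (\<Sum>j\<in>{-1..int n}. level f j x))\<^sup>2" for n x
  have [measurable]: "f \<in> borel_measurable M" using f by (simp add: L2_space_def)
  have "integrable M (u n)" for n
  proof -
    have "integrable M (\<lambda>x. (f x - (\<Sum>k<2 ^ (n + 1). \<phi> (real k / 2 ^ (n + 1)) * L2_inner M f (e k) * e k x))\<^sup>2)"
    proof -
      define S where "S x = (\<Sum>k<2 ^ (n + 1). \<phi> (real k / 2 ^ (n + 1)) * L2_inner M f (e k) * e k x)" for x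
      have S: "S \<in> L2_space M" unfolding S_def[abs_def] by (rule span_L2)
      have "integrable M (\<lambda>x. f x * f x - 2 * (f x * S x) + S x * S x)"
        by (intro Bochner_Integration.integrable_add Bochner_Integration.integrable_diff
            integrable_mult_right L2_integrable_mult f S)
      then show ?thesis unfolding S_def[symmetric]
        by (simp add: power2_eq_square algebra_simps)
    qed
    then show ?thesis
      unfolding u_def[abs_def]
      by (subst Bochner_Integration.integrable_cong[OF refl]) (simp_all add: sum_levels[OF f])
  qed
  moreover have "(\<lambda>n. \<integral>x. norm (u n x) \<partial>M) \<longlonglongrightarrow> 0"
    using sum_levels_tendsto_L2[OF f] by (simp add: u_def)
  ultimately obtain r where r: "strict_mono r" "AE x in M. (\<lambda>n. u (r n) x) \<longlonglongrightarrow> 0"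
    using tendsto_L1_AE_subseq by blast
  show ?thesis
  proof (rule that[OF r(1)])
    show "AE x in M. (\<lambda>n. \<Sum>j\<in>{-1..int (r n)}. level f j x) \<longlonglongrightarrow> f x"
      using r(2)
    proof eventually_elim
      fix x assume "(\<lambda>n. u (r n) x) \<longlonglongrightarrow> 0"
      then have "(\<lambda>n. sqrt (u (r n) x)) \<longlonglongrightarrow> sqrt 0" by (rule tendsto_real_sqrt)
      then have "(\<lambda>n. f x - (\<Sum>j\<in>{-1..int (r n)}. level f j x)) \<longlonglongrightarrow> 0"
        by (simp add: u_def tendsto_rabs_zero_iff)
      then have "(\<lambda>n. f x - (f x - (\<Sum>j\<in>{-1..int (r n)}. level f j x))) \<longlonglongrightarrow> f x - 0"
        by (intro tendsto_intros)
      then show "(\<lambda>n. \<Sum>j\<in>{-1..int (r n)}. level f j x) \<longlonglongrightarrow> f x" by simp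
    qed
  qed
qed

text \<open>
  Applying the adjoint to \<open>g i\<close> shows that the signal part of the observation, divided by \<open>b i\<close>, is the
  \<open>i\<close>-th coefficient of \<open>f\<close>: the estimated coefficient is unbiased.  Its error is the white noise
  paired with one vector \<open>h\<close> with coordinates \<open>\<psi>\<^sup>i / b i\<close>, chosen independently of \<open>f\<close> and \<open>\<epsilon>\<close>, whose
  squared norm is one of the numbers in the supremum that defines the noise level.
\<close>

lemma beta_hat_error:
  assumes svd: "svd M K e g b" and W: "gaussian_white_noise P W" and \<eta>: "\<eta> \<in> Z X j"
  shows "\<exists>h. norm h \<le> sqrt (noise_level_sq M e b X lam \<phi> j) \<and>
    (\<forall>f\<in>L2_space M. \<forall>\<epsilon>. AE \<omega> in P.
      beta_hat M e b lam \<phi> (observation K g W \<epsilon> f \<omega>) j \<eta> - L2_inner M f (psi j \<eta>) = \<epsilon> * W h \<omega>)"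
proof -
  define y where "y = needlet_coord M e lam \<phi> j \<eta>"
  obtain n where n: "\<forall>i\<ge>n. y i = 0"
    and inner: "\<forall>f\<in>L2_space M. L2_inner M f (psi j \<eta>) = (\<Sum>i<n. y i * L2_inner M f (e i))"
    using L2_inner_needlet[of j \<eta>] unfolding y_def by blast
  have b: "b i \<noteq> 0" for i using svd by (simp add: svd_def)
  have Kg: "inner (K f) (g i) = b i * L2_inner M f (e i)" if f: "f \<in> L2_space M" for f i
  proof -
    obtain K' where K': "L2_adjoint M K K'" "\<And>i. AE x in M. K' (g i) x = b i * e i x"
      using svd unfolding svd_def by blast
    have [measurable]: "f \<in> borel_measurable M" "K' (g i) \<in> borel_measurable M"
      using f K'(1) by (auto simp: L2_space_def L2_adjoint_def)
    have "inner (K f) (g i) = L2_inner M f (K' (g i))"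
      using K'(1) f by (simp add: L2_adjoint_def)
    also have "\<dots> = (\<integral>x. b i * (f x * e i x) \<partial>M)"
      unfolding L2_inner_def using K'(2)[of i]
      by (intro integral_cong_AE) (measurable, auto simp: algebra_simps)
    finally show ?thesis by (simp add: L2_inner_def)
  qed
  define h where "h = (\<Sum>i<n. (y i / b i) *\<^sub>R g i)"
  have gg: "inner (g i) (g k) = (if i = k then 1 else 0)" for i k
    using svd by (simp add: svd_def orthonormal_basis_def)
  have "(norm h)\<^sup>2 = (\<Sum>i<n. (y i / b i)\<^sup>2)"
    unfolding power2_norm_eq_inner h_def
    by (simp add: inner_sum_left inner_sum_right gg power2_eq_square if_distrib cong: if_cong)
  also have "\<dots> = (\<Sum>i. (y i / b i)\<^sup>2)"
    using n by (intro suminf_finite[symmetric]) auto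
  also have "\<dots> \<le> noise_level_sq M e b X lam \<phi> j"
    unfolding noise_level_sq_def y_def
    using \<eta> Z_properties(1)[of j] by (intro cSUP_upper) auto
  finally have norm: "norm h \<le> sqrt (noise_level_sq M e b X lam \<phi> j)"
    by (rule real_le_rsqrt)
  show ?thesis
  proof (intro exI[of _ h] conjI norm ballI allI)
    fix f \<epsilon> assume f: "f \<in> L2_space M"
    have "AE \<omega> in P. W h \<omega> = (\<Sum>i<n. (y i / b i) * W (g i) \<omega>)"
      unfolding h_def by (rule white_noise_sum[OF W]) simp
    then show "AE \<omega> in P. beta_hat M e b lam \<phi> (observation K g W \<epsilon> f \<omega>) j \<eta> - L2_inner M f (psi j \<eta>) = \<epsilon> * W h \<omega>"
    proof eventually_elim
      fix \<omega> assume Wh: "W h \<omega> = (\<Sum>i<n. (y i / b i) * W (g i) \<omega>)"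
      have "beta_hat M e b lam \<phi> (observation K g W \<epsilon> f \<omega>) j \<eta>
          = (\<Sum>i<n. observation K g W \<epsilon> f \<omega> i / b i * y i)"
        unfolding beta_hat_def y_def[symmetric] using n by (intro suminf_finite) auto
      also have "\<dots> = (\<Sum>i<n. y i * L2_inner M f (e i) + \<epsilon> * ((y i / b i) * W (g i) \<omega>))"
        using b by (intro sum.cong) (auto simp: observation_def Kg[OF f] field_simps)
      finally show "beta_hat M e b lam \<phi> (observation K g W \<epsilon> f \<omega>) j \<eta> - L2_inner M f (psi j \<eta>) = \<epsilon> * W h \<omega>"
        unfolding inner[rule_format, OF f] Wh by (simp add: sum.distrib sum_distrib_left)
    qed
  qed
qed

end

section \<open>The threshold error of Besov coefficients\<close>

text \<open>
  The arithmetic of the four parameters, separated from the function spaces.  Each coefficient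
  sequence is seen only through the quantities \<open>scaled_norm\<close>, level by level.
\<close>

locale besov_exponents =
  fixes p \<nu> \<pi> s :: real
  assumes p: "1 < p" and ill_posed: "2 * \<nu> + 1 > 0" and pi: "\<pi> \<ge> 1" and s: "s \<ge> 1 / \<pi>"
begin

abbreviation m :: real where
  "m \<equiv> \<nu> + 1 / 2"

definition rate :: real where
  "rate = (if s \<ge> m * (p / \<pi> - 1) then s / (s + m) else (s - 1 / \<pi> + 1 / p) / (s + m - 1 / \<pi>))"

text \<open>
  The exponent of the decay of a level in \<open>L\<^sub>p\<close>: the embedding of the \<open>\<pi>\<close>-scale in the \<open>p\<close>-scale costs
  \<open>1 / \<pi> - 1 / p\<close> derivatives if \<open>\<pi> < p\<close>, and nothing otherwise.
\<close>

definition decay :: real where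
  "decay = (if p \<le> \<pi> then s else s - 1 / \<pi> + 1 / p)"

definition scaled_norm :: "int \<Rightarrow> 'i set \<Rightarrow> ('i \<Rightarrow> real) \<Rightarrow> real" where
  "scaled_norm j I x =
     2 powr (real_of_int j * (s + 1 / 2 - 1 / \<pi>)) * (\<Sum>\<eta>\<in>I. \<bar>x \<eta>\<bar> powr \<pi>) powr (1 / \<pi>)"

lemma m_pos: "m > 0"
  using ill_posed by simp

lemma s_pos: "s > 0"
  using s pi by (smt (verit) divide_pos_pos)

lemma decay_pos: "decay > 0"
proof -
  have "1 / p > 0" using p by simp
  then show ?thesis
    unfolding decay_def using s s_pos by (smt (verit))
qed

text \<open>
  In the sparse regime \<open>s \<ge> 1 / \<pi>\<close> forces \<open>m * (p - \<pi>) > 1\<close>.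
\<close>

lemma sparse_imp:
  assumes "\<not> s \<ge> m * (p / \<pi> - 1)"
  shows "\<pi> < p" "1 / p < m"
proof -
  have "1 / \<pi> < m * (p / \<pi> - 1)" using assms s by linarith
  also have "\<dots> = m * (p - \<pi>) / \<pi>" using pi by (simp add: field_simps)
  finally have 1: "1 < m * (p - \<pi>)" using pi by (simp add: divide_less_cancel)
  then have "0 < m * (p - \<pi>)" by simp
  then show 2: "\<pi> < p" using m_pos by (simp add: zero_less_mult_iff)
  have "m * (p - \<pi>) \<le> m * p" using m_pos pi by simp
  then have "1 < m * p" using 1 by linarith
  then show "1 / p < m" using p by (simp add: field_simps)
qed

lemma rate_le_1: "rate \<le> 1"
proof (cases "s \<ge> m * (p / \<pi> - 1)")
  case True
  then show ?thesis unfolding rate_def using s_pos m_pos by (auto simp: field_simps)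
next
  case False
  have "s + m - 1 / \<pi> > 0" using s m_pos by linarith
  then show ?thesis
    unfolding rate_def using False sparse_imp(2)[OF False] by (simp add: divide_le_eq_1)
qed

text \<open>
  The levels above the cut-off contribute \<open>t powr (decay * p / m)\<close>, so this is the condition under
  which the bias does not spoil the rate.  In the dense regime with \<open>\<pi> < p\<close> it comes down to
  \<open>m * d \<le> s * (s - d)\<close> with \<open>d = 1 / \<pi> - 1 / p\<close>.  The regime gives \<open>m * d \<le> s / p\<close>, and
  \<open>s \<ge> 1 / \<pi>\<close> gives \<open>s - d \<ge> 1 / p\<close>.
\<close>

lemma rate_le_decay: "rate \<le> decay / m"
proof (cases "s \<ge> m * (p / \<pi> - 1)")
  case dense: True
  have r: "rate = s / (s + m)" using dense by (simp add: rate_def)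
  show ?thesis
  proof (cases "p \<le> \<pi>")
    case True
    have "s / (s + m) \<le> s / m" using s_pos m_pos by (intro divide_left_mono) auto
    then show ?thesis unfolding r decay_def using True by simp
  next
    case False
    define d where "d = 1 / \<pi> - 1 / p"
    have d: "decay = s - d" using False by (simp add: decay_def d_def)
    have "d * p = p / \<pi> - 1" using p by (simp add: d_def left_diff_distrib)
    then have "m * d * p = m * (p / \<pi> - 1)" by (simp only: mult.assoc)
    then have "m * d * p \<le> s" using dense by (simp only:)
    then have 1: "m * d \<le> s * (1 / p)" using p by (simp add: field_simps)
    have "1 / p \<le> s - d" using s by (simp add: d_def)
    then have "s * (1 / p) \<le> s * (s - d)" using s_pos by (intro mult_left_mono) auto
    then have "s * m \<le> (s - d) * (s + m)" using 1 by (simp add: field_simps)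
    then show ?thesis unfolding r d using s_pos m_pos by (simp add: field_simps)
  qed
next
  case False
  have "rate = decay / (s + m - 1 / \<pi>)"
    using False sparse_imp(1)[OF False] by (simp add: rate_def decay_def)
  also have "\<dots> \<le> decay / m"
    using s m_pos decay_pos by (intro divide_left_mono) auto
  finally show ?thesis .
qed

lemma scaled_norm_nonneg: "scaled_norm j I x \<ge> 0"
  by (simp add: scaled_norm_def)

lemma sum_powr_eq_scaled_norm:
  "(\<Sum>\<eta>\<in>I. \<bar>x \<eta>\<bar> powr \<pi>) = 2 powr (- (real_of_int j * (\<pi> * s + \<pi> / 2 - 1))) * scaled_norm j I x powr \<pi>"
proof -
  define S where "S = (\<Sum>\<eta>\<in>I. \<bar>x \<eta>\<bar> powr \<pi>)"
  have S: "S \<ge> 0" unfolding S_def by (intro sum_nonneg) auto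
  have "scaled_norm j I x powr \<pi> = (2 powr (real_of_int j * (s + 1 / 2 - 1 / \<pi>))) powr \<pi> * (S powr (1 / \<pi>)) powr \<pi>"
    unfolding scaled_norm_def S_def by (rule powr_mult)
  also have "(S powr (1 / \<pi>)) powr \<pi> = S"
    using S pi by (simp add: powr_powr)
  also have "(2 powr (real_of_int j * (s + 1 / 2 - 1 / \<pi>))) powr \<pi> = 2 powr (real_of_int j * (\<pi> * s + \<pi> / 2 - 1))"
    unfolding powr_powr using pi by (intro arg_cong[where f = "\<lambda>u. 2 powr u"]) (simp add: field_simps)
  finally show ?thesis
    unfolding S_def[symmetric] by (simp flip: powr_add mult.assoc)
qed

lemma level_energy_le:
  assumes I: "finite I" and card: "real (card I) \<le> C * 2 powr real_of_int j"
    and C: "C > 0" and R: "scaled_norm j I x \<le> R"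
  shows "2 powr (real_of_int j * (p / 2 - 1)) * (\<Sum>\<eta>\<in>I. \<bar>x \<eta>\<bar> powr p)
           \<le> max 1 C * R powr p * 2 powr (- (real_of_int j * (p * decay)))"
proof -
  define S where "S = (\<Sum>\<eta>\<in>I. \<bar>x \<eta>\<bar> powr \<pi>)"
  have "S powr (p / \<pi>) = (2 powr (- (real_of_int j * (\<pi> * s + \<pi> / 2 - 1)))) powr (p / \<pi>) * (scaled_norm j I x powr \<pi>) powr (p / \<pi>)"
    unfolding S_def by (subst sum_powr_eq_scaled_norm[of _ _ j]) (rule powr_mult; simp)
  also have "\<dots> = 2 powr (- (real_of_int j * (p * s + p / 2 - p / \<pi>))) * scaled_norm j I x powr p"
    using pi by (simp add: powr_powr) (simp add: field_simps)
  also have "\<dots> \<le> 2 powr (- (real_of_int j * (p * s + p / 2 - p / \<pi>))) * R powr p"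
    using R p scaled_norm_nonneg by (intro mult_left_mono powr_mono2) auto
  finally have S: "S powr (p / \<pi>) \<le> 2 powr (- (real_of_int j * (p * s + p / 2 - p / \<pi>))) * R powr p" .
  show ?thesis
  proof (cases "p \<le> \<pi>")
    case True
    have "(\<Sum>\<eta>\<in>I. \<bar>x \<eta>\<bar> powr p) \<le> real (card I) powr (1 - p / \<pi>) * S powr (p / \<pi>)"
      unfolding S_def using True p I by (intro sum_powr_le_of_ge_exponent) auto
    also have "\<dots> \<le> (max 1 C * 2 powr (real_of_int j * (1 - p / \<pi>))) *
        (2 powr (- (real_of_int j * (p * s + p / 2 - p / \<pi>))) * R powr p)"
    proof (intro mult_mono S)
      have pp: "0 \<le> 1 - p / \<pi>" "1 - p / \<pi> \<le> 1" using True p by (auto simp: field_simps)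
      have "real (card I) powr (1 - p / \<pi>) \<le> (max 1 C * 2 powr real_of_int j) powr (1 - p / \<pi>)"
        using pp card C
        by (intro powr_mono2) (auto intro: order_trans mult_right_mono)
      also have "\<dots> = max 1 C powr (1 - p / \<pi>) * 2 powr (real_of_int j * (1 - p / \<pi>))"
        by (subst powr_mult) (auto simp: powr_powr)
      also have "max 1 C powr (1 - p / \<pi>) \<le> max 1 C powr 1"
        using pp by (intro powr_mono) auto
      finally show "real (card I) powr (1 - p / \<pi>) \<le> max 1 C * 2 powr (real_of_int j * (1 - p / \<pi>))"
        by (simp add: mult_right_mono)
    qed auto
    finally have "2 powr (real_of_int j * (p / 2 - 1)) * (\<Sum>\<eta>\<in>I. \<bar>x \<eta>\<bar> powr p)
      \<le> 2 powr (real_of_int j * (p / 2 - 1)) * ((max 1 C * 2 powr (real_of_int j * (1 - p / \<pi>))) *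
        (2 powr (- (real_of_int j * (p * s + p / 2 - p / \<pi>))) * R powr p))"
      by (intro mult_left_mono) auto
    also have "\<dots> = max 1 C * R powr p * (2 powr (real_of_int j * (p / 2 - 1)) * 2 powr (real_of_int j * (1 - p / \<pi>)) *
        2 powr (- (real_of_int j * (p * s + p / 2 - p / \<pi>))))"
      by (simp only: mult_ac)
    also have "2 powr (real_of_int j * (p / 2 - 1)) * 2 powr (real_of_int j * (1 - p / \<pi>)) *
        2 powr (- (real_of_int j * (p * s + p / 2 - p / \<pi>))) = 2 powr (- (real_of_int j * (p * s)))"
      unfolding powr_add[symmetric] by (simp add: algebra_simps)
    finally show ?thesis using True by (simp add: decay_def)
  next
    case False
    have "(\<Sum>\<eta>\<in>I. \<bar>x \<eta>\<bar> powr p) \<le> S powr (p / \<pi>)"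
      unfolding S_def using False pi I by (intro sum_powr_le_of_le_exponent) auto
    then have "2 powr (real_of_int j * (p / 2 - 1)) * (\<Sum>\<eta>\<in>I. \<bar>x \<eta>\<bar> powr p)
      \<le> 2 powr (real_of_int j * (p / 2 - 1)) * (2 powr (- (real_of_int j * (p * s + p / 2 - p / \<pi>))) * R powr p)"
      using S by (intro mult_left_mono) auto
    also have "\<dots> = R powr p * (2 powr (real_of_int j * (p / 2 - 1)) * 2 powr (- (real_of_int j * (p * s + p / 2 - p / \<pi>))))"
      by (simp only: mult_ac)
    also have "2 powr (real_of_int j * (p / 2 - 1)) * 2 powr (- (real_of_int j * (p * s + p / 2 - p / \<pi>)))
        = 2 powr (- (real_of_int j * (p * decay)))"
      unfolding powr_add[symmetric] decay_def using False p by (simp add: algebra_simps)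
    also have "R powr p * 2 powr (- (real_of_int j * (p * decay))) \<le> max 1 C * (R powr p * 2 powr (- (real_of_int j * (p * decay))))"
      using mult_right_mono[of 1 "max 1 C" "R powr p * 2 powr (- (real_of_int j * (p * decay)))"] by simp
    finally show ?thesis by (simp only: mult.assoc)
  qed
qed

text \<open>
  All coefficients of the level are taken to be at the threshold.
\<close>

lemma level_threshold_le_noise:
  assumes I: "finite I" and card: "real (card I) \<le> C * 2 powr real_of_int j"
    and T: "0 \<le> T" "T \<le> B * t * 2 powr (real_of_int j * \<nu>)" and B: "B > 0" and t: "t > 0" and C: "C > 0"
  shows "2 powr (real_of_int j * (p / 2 - 1)) * (\<Sum>\<eta>\<in>I. min \<bar>x \<eta>\<bar> T powr p)
           \<le> C * B powr p * t powr p * 2 powr (real_of_int j * (p * m))"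
proof -
  have "(\<Sum>\<eta>\<in>I. min \<bar>x \<eta>\<bar> T powr p) \<le> (\<Sum>\<eta>\<in>I. (B * t * 2 powr (real_of_int j * \<nu>)) powr p)"
    using T p by (intro sum_mono powr_mono2) auto
  also have "\<dots> = real (card I) * (B powr p * t powr p * 2 powr (real_of_int j * \<nu> * p))"
    using B t by (simp add: powr_mult powr_powr)
  also have "\<dots> \<le> (C * 2 powr real_of_int j) * (B powr p * t powr p * 2 powr (real_of_int j * \<nu> * p))"
    by (intro mult_right_mono card) auto
  finally have "2 powr (real_of_int j * (p / 2 - 1)) * (\<Sum>\<eta>\<in>I. min \<bar>x \<eta>\<bar> T powr p)
     \<le> 2 powr (real_of_int j * (p / 2 - 1)) * ((C * 2 powr real_of_int j) * (B powr p * t powr p * 2 powr (real_of_int j * \<nu> * p)))"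
    by (intro mult_left_mono) auto
  also have "\<dots> = C * B powr p * t powr p * (2 powr (real_of_int j * (p / 2 - 1)) * 2 powr real_of_int j * 2 powr (real_of_int j * \<nu> * p))"
    by (simp only: mult_ac)
  also have "2 powr (real_of_int j * (p / 2 - 1)) * 2 powr real_of_int j * 2 powr (real_of_int j * \<nu> * p)
      = 2 powr (real_of_int j * (p * m))"
    unfolding powr_add[symmetric] by (simp add: algebra_simps)
  finally show ?thesis .
qed

text \<open>
  Interpolation between the two trivial bounds: \<open>p - \<pi>\<close> of the \<open>p\<close> powers are bounded by the threshold,
  the other \<open>\<pi>\<close> by the coefficient.  The exponent of \<open>2\<^sup>j\<close> changes sign on the line that separates
  the dense from the sparse regime.
\<close>

lemma level_threshold_le_mixed:
  assumes T: "0 \<le> T" "T \<le> B * t * 2 powr (real_of_int j * \<nu>)" and B: "B > 0" and t: "t > 0" and "\<pi> < p"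
  shows "2 powr (real_of_int j * (p / 2 - 1)) * (\<Sum>\<eta>\<in>I. min \<bar>x \<eta>\<bar> T powr p)
           \<le> B powr (p - \<pi>) * t powr (p - \<pi>) * scaled_norm j I x powr \<pi> * 2 powr (real_of_int j * (m * (p - \<pi>) - \<pi> * s))"
proof -
  have "(\<Sum>\<eta>\<in>I. min \<bar>x \<eta>\<bar> T powr p) \<le> T powr (p - \<pi>) * (\<Sum>\<eta>\<in>I. \<bar>x \<eta>\<bar> powr \<pi>)"
    using assms pi by (intro sum_powr_min_le) auto
  also have "\<dots> \<le> (B * t * 2 powr (real_of_int j * \<nu>)) powr (p - \<pi>) * (\<Sum>\<eta>\<in>I. \<bar>x \<eta>\<bar> powr \<pi>)"
    using assms by (intro mult_right_mono powr_mono2 sum_nonneg) auto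
  also have "\<dots> = B powr (p - \<pi>) * t powr (p - \<pi>) * 2 powr (real_of_int j * \<nu> * (p - \<pi>)) *
      (2 powr (- (real_of_int j * (\<pi> * s + \<pi> / 2 - 1))) * scaled_norm j I x powr \<pi>)"
    unfolding sum_powr_eq_scaled_norm[of _ _ j] using B t by (simp add: powr_mult powr_powr)
  finally have "2 powr (real_of_int j * (p / 2 - 1)) * (\<Sum>\<eta>\<in>I. min \<bar>x \<eta>\<bar> T powr p)
     \<le> 2 powr (real_of_int j * (p / 2 - 1)) * (B powr (p - \<pi>) * t powr (p - \<pi>) * 2 powr (real_of_int j * \<nu> * (p - \<pi>)) *
      (2 powr (- (real_of_int j * (\<pi> * s + \<pi> / 2 - 1))) * scaled_norm j I x powr \<pi>))"
    by (intro mult_left_mono) auto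
  also have "\<dots> = B powr (p - \<pi>) * t powr (p - \<pi>) * scaled_norm j I x powr \<pi> *
      (2 powr (real_of_int j * (p / 2 - 1)) * 2 powr (real_of_int j * \<nu> * (p - \<pi>)) * 2 powr (- (real_of_int j * (\<pi> * s + \<pi> / 2 - 1))))"
    by (simp only: mult_ac)
  also have "2 powr (real_of_int j * (p / 2 - 1)) * 2 powr (real_of_int j * \<nu> * (p - \<pi>)) * 2 powr (- (real_of_int j * (\<pi> * s + \<pi> / 2 - 1)))
     = 2 powr (real_of_int j * (m * (p - \<pi>) - \<pi> * s))"
    unfolding powr_add[symmetric] by (rule arg_cong[where f = "\<lambda>u. 2 powr u"]) (simp add: field_simps)
  finally show ?thesis .
qed

text \<open>
  The hypotheses on the coefficients \<open>x\<close> and thresholds \<open>T\<close> of the levels in \<open>F\<close> under which the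
  threshold error has the rate.  On the critical line the power sum over the levels takes the place of
  geometric decay.
\<close>

definition admissible_levels ::
  "real \<Rightarrow> real \<Rightarrow> real \<Rightarrow> real \<Rightarrow> int set \<Rightarrow> (int \<Rightarrow> 'i set) \<Rightarrow> (int \<Rightarrow> 'i \<Rightarrow> real) \<Rightarrow> (int \<Rightarrow> real) \<Rightarrow> bool" where
  "admissible_levels C B R t F I x T \<longleftrightarrow> finite F \<and>
     (\<forall>j\<in>F. finite (I j) \<and> real (card (I j)) \<le> C * 2 powr real_of_int j \<and>
        0 \<le> T j \<and> T j \<le> B * t * 2 powr (real_of_int j * \<nu>) \<and> scaled_norm j (I j) (x j) \<le> R) \<and>
     (s = m * (p / \<pi> - 1) \<longrightarrow> (\<Sum>j\<in>F. scaled_norm j (I j) (x j) powr \<pi>) \<le> R powr \<pi>)"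

text \<open>
  In each regime two of the three bounds of a level are balanced against each other: noise against
  energy if \<open>p \<le> \<pi>\<close>, noise against the decaying mixed bound in the rest of the dense regime, and the
  growing mixed bound against energy in the sparse regime.  On the critical line the mixed bound
  neither grows nor decays; there the sum over the levels converges because the Besov norms are
  summable to the power \<open>\<pi>\<close>, and the mixed bound alone gives the rate.
\<close>

lemma sum_threshold_levels_le:
  assumes C: "C > 0" and B: "B > 0" and R: "R > 0"
  shows "\<exists>A\<ge>0. \<forall>t>0. \<forall>F (I :: int \<Rightarrow> 'i set) x T. admissible_levels C B R t F I x T \<longrightarrow>
    (\<Sum>j\<in>F. 2 powr (real_of_int j * (p / 2 - 1)) * (\<Sum>\<eta>\<in>I j. min \<bar>x j \<eta>\<bar> (T j) powr p)) \<le> A * t powr (rate * p)"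
proof -
  define c where "c I x T j = 2 powr (real_of_int j * (p / 2 - 1)) * (\<Sum>\<eta>\<in>I j. min \<bar>x j \<eta>\<bar> (T j) powr p)"
    for I :: "int \<Rightarrow> 'i set" and x T and j :: int
  define A where "A = max (C * B powr p) (max (max 1 C * R powr p) (B powr (p - \<pi>) * R powr \<pi>))"
  have A: "A \<ge> 0" by (simp add: A_def le_max_iff_disj)
  have noise: "c I x T j \<le> A * t powr p * 2 powr (real_of_int j * (p * m))"
    and energy: "c I x T j \<le> A * t powr 0 * 2 powr (- (real_of_int j * (p * decay)))"
    and mixed: "\<pi> < p \<Longrightarrow> c I x T j \<le> A * t powr (p - \<pi>) * 2 powr (real_of_int j * (m * (p - \<pi>) - \<pi> * s))"
    if "t > 0" "admissible_levels C B R t F I x T" "j \<in> F" for t F I x T j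
  proof -
    have adm: "finite (I j)" "real (card (I j)) \<le> C * 2 powr real_of_int j" "0 \<le> T j"
      "T j \<le> B * t * 2 powr (real_of_int j * \<nu>)" "scaled_norm j (I j) (x j) \<le> R"
      using that by (auto simp: admissible_levels_def)
    have "c I x T j \<le> C * B powr p * t powr p * 2 powr (real_of_int j * (p * m))"
      unfolding c_def using adm B \<open>t > 0\<close> C by (intro level_threshold_le_noise) auto
    also have "\<dots> \<le> A * t powr p * 2 powr (real_of_int j * (p * m))"
      by (intro mult_right_mono) (auto simp: A_def)
    finally show "c I x T j \<le> A * t powr p * 2 powr (real_of_int j * (p * m))" .
    have "c I x T j \<le> 2 powr (real_of_int j * (p / 2 - 1)) * (\<Sum>\<eta>\<in>I j. \<bar>x j \<eta>\<bar> powr p)"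
      unfolding c_def using p adm by (intro mult_left_mono sum_mono powr_mono2) auto
    also have "\<dots> \<le> max 1 C * R powr p * 2 powr (- (real_of_int j * (p * decay)))"
      using adm C by (intro level_energy_le) auto
    also have "\<dots> \<le> A * 2 powr (- (real_of_int j * (p * decay)))"
      by (intro mult_right_mono) (auto simp: A_def)
    finally show "c I x T j \<le> A * t powr 0 * 2 powr (- (real_of_int j * (p * decay)))"
      using \<open>t > 0\<close> by simp
    assume "\<pi> < p"
    then have "c I x T j \<le> B powr (p - \<pi>) * t powr (p - \<pi>) * scaled_norm j (I j) (x j) powr \<pi> *
        2 powr (real_of_int j * (m * (p - \<pi>) - \<pi> * s))"
      unfolding c_def using adm B \<open>t > 0\<close> by (intro level_threshold_le_mixed) auto
    also have "\<dots> \<le> B powr (p - \<pi>) * t powr (p - \<pi>) * R powr \<pi> * 2 powr (real_of_int j * (m * (p - \<pi>) - \<pi> * s))"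
      using adm pi scaled_norm_nonneg by (intro mult_right_mono mult_left_mono powr_mono2) auto
    also have "\<dots> = B powr (p - \<pi>) * R powr \<pi> * (t powr (p - \<pi>) * 2 powr (real_of_int j * (m * (p - \<pi>) - \<pi> * s)))"
      by (simp only: mult_ac)
    also have "\<dots> \<le> A * (t powr (p - \<pi>) * 2 powr (real_of_int j * (m * (p - \<pi>) - \<pi> * s)))"
      by (intro mult_right_mono) (auto simp: A_def)
    finally show "c I x T j \<le> A * t powr (p - \<pi>) * 2 powr (real_of_int j * (m * (p - \<pi>) - \<pi> * s))"
      by (simp only: mult.assoc)
  qed
  have pos: "s + m > 0" "m + s - 1 / \<pi> > 0" using s_pos m_pos s by linarith+
  consider (dense_hom) "p \<le> \<pi>" | (dense) "\<pi> < p" "s > m * (p / \<pi> - 1)"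
    | (critical) "\<pi> < p" "s = m * (p / \<pi> - 1)" | (sparse) "\<pi> < p" "s < m * (p / \<pi> - 1)"
    by linarith
  then have "\<exists>A\<ge>0. \<forall>t>0. \<forall>F I x T. admissible_levels C B R t F I x T \<longrightarrow> (\<Sum>j\<in>F. c I x T j) \<le> A * t powr (rate * p)"
  proof cases
    case dense_hom
    have r: "rate = s / (s + m)"
    proof -
      have "m * (p / \<pi> - 1) \<le> 0" using dense_hom pi m_pos by (intro mult_nonneg_nonpos) auto
      then show ?thesis using s_pos by (auto simp: rate_def)
    qed
    have d: "decay = s" using dense_hom by (simp add: decay_def)
    show ?thesis
    proof (intro exI[of _ "A * (1 / (1 - 2 powr - (p * m)) + 1 / (1 - 2 powr - (p * decay)))"] conjI allI impI)
      show "0 \<le> A * (1 / (1 - 2 powr - (p * m)) + 1 / (1 - 2 powr - (p * decay)))"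
        using A p m_pos decay_pos by (intro mult_nonneg_nonneg add_nonneg_nonneg geometric_limit_nonneg) auto
    next
      fix t :: real and F and I :: "int \<Rightarrow> 'i set" and x T
      assume t: "t > 0" and adm: "admissible_levels C B R t F I x T"
      show "(\<Sum>j\<in>F. c I x T j) \<le> A * (1 / (1 - 2 powr - (p * m)) + 1 / (1 - 2 powr - (p * decay))) * t powr (rate * p)"
      proof (rule sum_balanced_exponentials_le[OF _ _ _ t A noise[OF t adm] energy[OF t adm]])
        \<comment> \<open>The bounds cross at \<open>2\<^sup>j = t powr (- 1 / (s + m))\<close>.\<close>
        show "p - 1 / (s + m) * (p * m) = rate * p" "0 + 1 / (s + m) * (p * decay) = rate * p"
          unfolding r d using pos by (auto simp: field_simps)
      qed (use adm p m_pos decay_pos in \<open>auto simp: admissible_levels_def\<close>)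
    qed
  next
    case dense
    have r: "rate = s / (s + m)" using dense by (simp add: rate_def)
    define \<beta> where "\<beta> = \<pi> * s - m * (p - \<pi>)"
    have "m * (p / \<pi> - 1) = m * (p - \<pi>) / \<pi>" using pi by (simp add: field_simps)
    then have \<beta>: "\<beta> > 0" using dense(2) pi by (simp add: \<beta>_def field_simps)
    show ?thesis
    proof (intro exI[of _ "A * (1 / (1 - 2 powr - (p * m)) + 1 / (1 - 2 powr - \<beta>))"] conjI allI impI)
      show "0 \<le> A * (1 / (1 - 2 powr - (p * m)) + 1 / (1 - 2 powr - \<beta>))"
        using A p m_pos \<beta> by (intro mult_nonneg_nonneg add_nonneg_nonneg geometric_limit_nonneg) auto
    next
      fix t :: real and F and I :: "int \<Rightarrow> 'i set" and x T
      assume t: "t > 0" and adm: "admissible_levels C B R t F I x T"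
      show "(\<Sum>j\<in>F. c I x T j) \<le> A * (1 / (1 - 2 powr - (p * m)) + 1 / (1 - 2 powr - \<beta>)) * t powr (rate * p)"
      proof (rule sum_balanced_exponentials_le[OF _ _ _ t A noise[OF t adm]])
        show "p - 1 / (s + m) * (p * m) = rate * p" 
          unfolding r using pos by (simp add: field_simps)
        show "(p - \<pi>) + 1 / (s + m) * \<beta> = rate * p"
          unfolding r \<beta>_def using pos by (simp add: field_simps)
        show "c I x T j \<le> A * t powr (p - \<pi>) * 2 powr (- (real_of_int j * \<beta>))" if "j \<in> F" for j
          using mixed[OF t adm that dense(1)] by (simp add: \<beta>_def algebra_simps)
      qed (use adm p m_pos \<beta> in \<open>auto simp: admissible_levels_def\<close>)
    qed
  next
    case critical
    have r: "rate = s / (s + m)" unfolding rate_def by (rule if_P) (use critical in linarith)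
    have sm: "\<pi> * s = m * (p - \<pi>)" using critical(2) pi by (simp add: field_simps)
    have rp: "rate * p = p - \<pi>"
    proof -
      have "s * p = (p - \<pi>) * (s + m)" using sm by (simp add: algebra_simps)
      then show ?thesis unfolding r using pos by (simp add: field_simps)
    qed
    show ?thesis
    proof (intro exI[of _ "B powr (p - \<pi>) * R powr \<pi>"] conjI allI impI)
      fix t :: real and F and I :: "int \<Rightarrow> 'i set" and x T
      assume t: "t > 0" and adm: "admissible_levels C B R t F I x T"
      have "(\<Sum>j\<in>F. c I x T j) \<le> (\<Sum>j\<in>F. B powr (p - \<pi>) * t powr (p - \<pi>) * scaled_norm j (I j) (x j) powr \<pi>)"
      proof (intro sum_mono)
        fix j assume j: "j \<in> F"
        have "c I x T j \<le> B powr (p - \<pi>) * t powr (p - \<pi>) * scaled_norm j (I j) (x j) powr \<pi> *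
          2 powr (real_of_int j * (m * (p - \<pi>) - \<pi> * s))"
          unfolding c_def using adm j B t critical(1) by (intro level_threshold_le_mixed) (auto simp: admissible_levels_def)
        then show "c I x T j \<le> B powr (p - \<pi>) * t powr (p - \<pi>) * scaled_norm j (I j) (x j) powr \<pi>"
          by (simp add: sm)
      qed
      also have "\<dots> = B powr (p - \<pi>) * t powr (p - \<pi>) * (\<Sum>j\<in>F. scaled_norm j (I j) (x j) powr \<pi>)"
        by (simp add: sum_distrib_left)
      also have "(\<Sum>j\<in>F. scaled_norm j (I j) (x j) powr \<pi>) \<le> R powr \<pi>"
        using adm critical(2) unfolding admissible_levels_def by blast
      finally have "(\<Sum>j\<in>F. c I x T j) \<le> B powr (p - \<pi>) * t powr (p - \<pi>) * R powr \<pi>"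
        by (simp add: mult_left_mono)
      then show "(\<Sum>j\<in>F. c I x T j) \<le> B powr (p - \<pi>) * R powr \<pi> * t powr (rate * p)"
        unfolding rp by (simp only: mult_ac)
    qed simp
  next
    case sparse
    define \<alpha> where "\<alpha> = m * (p - \<pi>) - \<pi> * s"
    have "m * (p / \<pi> - 1) = m * (p - \<pi>) / \<pi>" using pi by (simp add: field_simps)
    then have \<alpha>: "\<alpha> > 0" using sparse(2) pi by (simp add: \<alpha>_def field_simps)
    have d: "decay = s - 1 / \<pi> + 1 / p" using sparse by (simp add: decay_def)
    have r: "rate = decay / (m + s - 1 / \<pi>)" using sparse by (simp add: rate_def d add.commute)
    show ?thesis
    proof (intro exI[of _ "A * (1 / (1 - 2 powr - \<alpha>) + 1 / (1 - 2 powr - (p * decay)))"] conjI allI impI)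
      show "0 \<le> A * (1 / (1 - 2 powr - \<alpha>) + 1 / (1 - 2 powr - (p * decay)))"
        using A p \<alpha> decay_pos by (intro mult_nonneg_nonneg add_nonneg_nonneg geometric_limit_nonneg) auto
    next
      fix t :: real and F and I :: "int \<Rightarrow> 'i set" and x T
      assume t: "t > 0" and adm: "admissible_levels C B R t F I x T"
      show "(\<Sum>j\<in>F. c I x T j) \<le> A * (1 / (1 - 2 powr - \<alpha>) + 1 / (1 - 2 powr - (p * decay))) * t powr (rate * p)"
      proof (rule sum_balanced_exponentials_le[OF _ _ _ t A _ energy[OF t adm]])
        show "c I x T j \<le> A * t powr (p - \<pi>) * 2 powr (real_of_int j * \<alpha>)" if "j \<in> F" for j
          using mixed[OF t adm that sparse(1)] by (simp add: \<alpha>_def)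
        \<comment> \<open>The bounds cross at \<open>2\<^sup>j = t powr (- 1 / (m + s - 1 / \<pi>))\<close>.\<close>
        show "0 + 1 / (m + s - 1 / \<pi>) * (p * decay) = rate * p"
          unfolding r by simp
        have "(p - \<pi>) * (m + s - 1 / \<pi>) - \<alpha> = decay * p"
          unfolding d \<alpha>_def using pi p by (simp add: field_simps)
        then have "(p - \<pi>) - \<alpha> / (m + s - 1 / \<pi>) = decay * p / (m + s - 1 / \<pi>)"
          using pos(2) by (metis diff_divide_distrib nonzero_mult_div_cancel_right less_irrefl)
        then show "(p - \<pi>) - 1 / (m + s - 1 / \<pi>) * \<alpha> = rate * p"
          unfolding r by simp
      qed (use adm p \<alpha> decay_pos in \<open>auto simp: admissible_levels_def\<close>)
    qed
  qed
  then show ?thesis unfolding c_def by blast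
qed

end

section \<open>The bias\<close>

lemma Lq_norm_pow_sum_weighted:
  fixes a :: "'i \<Rightarrow> 'y \<Rightarrow> real" and w :: "'i \<Rightarrow> real"
  assumes F: "finite F" and q: "q \<ge> 1" and w: "\<And>j. j \<in> F \<Longrightarrow> w j > 0"
    and [measurable]: "\<And>j. j \<in> F \<Longrightarrow> a j \<in> borel_measurable M"
  shows "Lq_norm_pow M q (\<lambda>x. \<Sum>j\<in>F. a j x)
           \<le> ennreal ((\<Sum>j\<in>F. w j) powr (q - 1)) * (\<Sum>j\<in>F. ennreal (w j powr (1 - q)) * Lq_norm_pow M q (a j))"
proof -
  have "Lq_norm_pow M q (\<lambda>x. \<Sum>j\<in>F. a j x)
      \<le> (\<integral>\<^sup>+x. ennreal ((\<Sum>j\<in>F. w j) powr (q - 1)) * (\<Sum>j\<in>F. ennreal (w j powr (1 - q)) * ennreal (\<bar>a j x\<bar> powr q)) \<partial>M)"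
    unfolding Lq_norm_pow_def
  proof (intro nn_integral_mono)
    fix x
    have "ennreal (\<bar>\<Sum>j\<in>F. a j x\<bar> powr q)
        \<le> ennreal ((\<Sum>j\<in>F. w j) powr (q - 1) * (\<Sum>j\<in>F. w j powr (1 - q) * \<bar>a j x\<bar> powr q))"
      by (intro ennreal_leI powr_sum_le_weighted F q w)
    then show "ennreal (\<bar>\<Sum>j\<in>F. a j x\<bar> powr q)
        \<le> ennreal ((\<Sum>j\<in>F. w j) powr (q - 1)) * (\<Sum>j\<in>F. ennreal (w j powr (1 - q)) * ennreal (\<bar>a j x\<bar> powr q))"
      by (simp add: ennreal_mult' flip: sum_ennreal)
  qed
  also have "\<dots> = ennreal ((\<Sum>j\<in>F. w j) powr (q - 1)) * (\<Sum>j\<in>F. ennreal (w j powr (1 - q)) * Lq_norm_pow M q (a j))"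
    unfolding Lq_norm_pow_def by (simp add: nn_integral_cmult nn_integral_sum)
  finally show ?thesis .
qed

lemma Lq_norm_pow_add_le:
  assumes q: "q \<ge> 0" and [measurable]: "f \<in> borel_measurable M" "h \<in> borel_measurable M"
  shows "Lq_norm_pow M q (\<lambda>x. f x + h x) \<le> ennreal (2 powr q) * (Lq_norm_pow M q f + Lq_norm_pow M q h)"
proof -
  have "Lq_norm_pow M q (\<lambda>x. f x + h x)
      \<le> (\<integral>\<^sup>+x. ennreal (2 powr q) * (ennreal (\<bar>f x\<bar> powr q) + ennreal (\<bar>h x\<bar> powr q)) \<partial>M)"
    unfolding Lq_norm_pow_def
  proof (intro nn_integral_mono)
    fix x
    have "\<bar>f x + h x\<bar> powr q \<le> (\<bar>f x\<bar> + \<bar>h x\<bar>) powr q"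
      using q by (intro powr_mono2) auto
    also have "\<dots> \<le> 2 powr q * (\<bar>f x\<bar> powr q + \<bar>h x\<bar> powr q)"
      using q by (intro powr_add_le) auto
    finally have "ennreal (\<bar>f x + h x\<bar> powr q) \<le> ennreal (2 powr q * (\<bar>f x\<bar> powr q + \<bar>h x\<bar> powr q))"
      by (rule ennreal_leI)
    then show "ennreal (\<bar>f x + h x\<bar> powr q) \<le> ennreal (2 powr q) * (ennreal (\<bar>f x\<bar> powr q) + ennreal (\<bar>h x\<bar> powr q))"
      by (simp add: ennreal_mult')
  qed
  also have "\<dots> = ennreal (2 powr q) * (Lq_norm_pow M q f + Lq_norm_pow M q h)"
    unfolding Lq_norm_pow_def by (simp add: nn_integral_cmult nn_integral_add)
  finally show ?thesis .
qed

text \<open>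
  The assumption \<open>synthesis\<close> combines the stability of the needlet synthesis in \<open>L\<^sub>p\<close> with the upper bound
  on the \<open>L\<^sub>p\<close> norms of the needlets, for the one exponent \<open>p\<close> of the risk.
\<close>

locale needlet_estimation =
  needlet_frame M e X lam \<phi> + besov_exponents p \<nu> \<pi> s
  for M :: "'y measure" and e X lam \<phi> p \<nu> \<pi> s +
  fixes C G :: real
  assumes C: "C > 0" and G: "G > 0"
    and card_Z: "\<And>j. j \<ge> -1 \<Longrightarrow> real (card (Z X j)) \<le> C * 2 powr real_of_int j"
    and synthesis: "\<And>j u. j \<ge> -1 \<Longrightarrow> Lq_norm_pow M p (\<lambda>x. \<Sum>\<eta>\<in>Z X j. u \<eta> * psi j \<eta> x)
      \<le> ennreal (G * (2 powr (real_of_int j * (p / 2 - 1)) * (\<Sum>\<eta>\<in>Z X j. \<bar>u \<eta>\<bar> powr p)))"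
begin

abbreviation coef :: "('y \<Rightarrow> real) \<Rightarrow> int \<Rightarrow> 'y \<Rightarrow> real" where
  "coef f j \<eta> \<equiv> L2_inner M f (psi j \<eta>)"

lemma besov_term_eq_scaled_norm: "besov_term M e X lam \<phi> s \<pi> f j = scaled_norm j (Z X j) (coef f j)"
  by (simp add: besov_term_def scaled_norm_def)

lemma besov_ball_finite_sum_le:
  assumes f: "f \<in> besov_ball M e X lam \<phi> s \<pi> r R" and r: "r \<ge> 1" "r < \<infinity>" and R: "R > 0"
    and F: "finite F" "F \<subseteq> {-1..}"
  shows "(\<Sum>j\<in>F. scaled_norm j (Z X j) (coef f j) powr real_of_ereal r) \<le> R powr real_of_ereal r"
proof -
  obtain r' where r': "r = ereal r'" "r' \<ge> 1" using r by (cases r) auto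
  define u where "u j = scaled_norm j (Z X j) (coef f j)" for j
  have u: "besov_term M e X lam \<phi> s \<pi> f = u"
    by (rule ext) (simp add: u_def besov_term_eq_scaled_norm)
  have n: "besov_norm M e X lam \<phi> s \<pi> r f \<le> ereal R"
    using f by (simp add: besov_ball_def)
  then have summable: "(\<lambda>j. u j powr r') summable_on {-1..}"
    unfolding besov_norm_def u r'(1) by (auto simp: Let_def split: if_splits)
  with n have le: "(\<Sum>\<^sub>\<infinity>j\<in>{-1..}. u j powr r') powr (1 / r') \<le> R"
    unfolding besov_norm_def u r'(1) by (simp add: Let_def)
  have nonneg: "(\<Sum>\<^sub>\<infinity>j\<in>{-1..}. u j powr r') \<ge> 0"
    by (intro infsum_nonneg) auto
  have "(\<Sum>j\<in>F. u j powr r') \<le> (\<Sum>\<^sub>\<infinity>j\<in>{-1..}. u j powr r')"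
    using F summable by (intro finite_sum_le_infsum) auto
  also have "\<dots> = ((\<Sum>\<^sub>\<infinity>j\<in>{-1..}. u j powr r') powr (1 / r')) powr r'"
    using nonneg r' by (simp add: powr_powr)
  also have "\<dots> \<le> R powr r'"
    using le r' by (intro powr_mono2) auto
  finally show ?thesis by (simp add: u_def r'(1))
qed

lemma besov_ball_scaled_norm_le:
  assumes f: "f \<in> besov_ball M e X lam \<phi> s \<pi> r R" and r: "r \<ge> 1" and R: "R > 0" and j: "j \<ge> -1"
  shows "scaled_norm j (Z X j) (coef f j) \<le> R"
proof (cases "r = \<infinity>")
  case True
  have "ereal (besov_term M e X lam \<phi> s \<pi> f j) \<le> (SUP j\<in>{-1..}. ereal (besov_term M e X lam \<phi> s \<pi> f j))"
    using j by (intro SUP_upper) auto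
  also have "\<dots> \<le> ereal R"
    using f True by (simp add: besov_ball_def besov_norm_def)
  finally show ?thesis by (simp add: besov_term_eq_scaled_norm)
next
  case False
  then obtain r' where r': "r = ereal r'" "r' \<ge> 1" using r by (cases r) auto
  have "scaled_norm j (Z X j) (coef f j) powr r' \<le> R powr r'"
    using besov_ball_finite_sum_le[OF f r _ R, of "{j}"] j r' by simp
  then show ?thesis
    using r' R by (meson linorder_not_le powr_less_mono2 less_le_trans zero_less_one less_imp_le)
qed

text \<open>
  This is where \<open>r \<le> \<pi>\<close> enters, through the embedding of \<open>l\<^sub>r\<close> in \<open>l\<^sub>\<pi>\<close>.
\<close>

lemma besov_ball_sum_powr_le:
  assumes f: "f \<in> besov_ball M e X lam \<phi> s \<pi> r R" and r: "r \<ge> 1" "r \<le> ereal \<pi>" and R: "R > 0"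
    and F: "finite F" "F \<subseteq> {-1..}"
  shows "(\<Sum>j\<in>F. scaled_norm j (Z X j) (coef f j) powr \<pi>) \<le> R powr \<pi>"
proof -
  obtain r' where r': "r = ereal r'" "r' \<ge> 1" "r' \<le> \<pi>" using r by (cases r) auto
  define u where "u j = scaled_norm j (Z X j) (coef f j)" for j
  have "(\<Sum>j\<in>F. u j powr \<pi>) \<le> (\<Sum>j\<in>F. u j powr r') powr (\<pi> / r')"
    using r' F scaled_norm_nonneg by (intro sum_powr_le_of_le_exponent) (auto simp: u_def)
  also have "\<dots> \<le> (R powr r') powr (\<pi> / r')"
    using besov_ball_finite_sum_le[OF f r(1) _ R F] r'
    by (intro powr_mono2 sum_nonneg) (auto simp: u_def)
  also have "\<dots> = R powr \<pi>"
    using r' by (simp add: powr_powr)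
  finally show ?thesis by (simp add: u_def)
qed

text \<open>
  The first factor comes from the total mass of the weights in \<open>level_block_le\<close>, the last one from the
  sum of the weighted level norms.
\<close>

definition bias_const :: "real \<Rightarrow> real" where
  "bias_const R = (1 / (1 - 2 powr (- (decay / 2)))) powr (p - 1) *
     (G * (max 1 C * R powr p) * (1 / (1 - 2 powr (- (decay * (p + 1) / 2)))))"

lemma bias_const_nonneg: "bias_const R \<ge> 0"
  unfolding bias_const_def using G decay_pos p
  by (intro mult_nonneg_nonneg geometric_limit_nonneg) auto

text \<open>
  The bound does not depend on the last level \<open>N\<close>.  The levels decay like \<open>2 powr (- decay * j)\<close> in
  \<open>L\<^sub>p\<close>; half of this decay is spent on the weights that replace the triangle inequality.
\<close>

lemma level_block_le:
  assumes f: "f \<in> besov_ball M e X lam \<phi> s \<pi> r R" and r: "r \<ge> 1" and R: "R > 0"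
  shows "Lq_norm_pow M p (\<lambda>x. \<Sum>j\<in>{int n + 1..N}. level f j x)
           \<le> ennreal (bias_const R * 2 powr (- ((real n + 1) * (p * decay))))"
proof -
  define F where "F = {int n + 1..N}"
  define z where "z = real n + 1"
  define w where "w j = 2 powr (- (decay / 2) * (real_of_int j - z))" for j :: int
  define A where "A = G * (max 1 C * R powr p)"
  have A: "A \<ge> 0" using G by (simp add: A_def)
  have F: "finite F" "\<And>j. j \<in> F \<Longrightarrow> j \<ge> -1" "\<And>j. j \<in> F \<Longrightarrow> z \<le> real_of_int j"
    by (auto simp: F_def z_def)
  have lev: "Lq_norm_pow M p (level f j) \<le> ennreal (A * 2 powr (- (real_of_int j * (p * decay))))"
    if j: "j \<in> F" for j
  proof -
    have "Lq_norm_pow M p (level f j)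
        \<le> ennreal (G * (2 powr (real_of_int j * (p / 2 - 1)) * (\<Sum>\<eta>\<in>Z X j. \<bar>coef f j \<eta>\<bar> powr p)))"
      unfolding level_def[abs_def] by (rule synthesis[OF F(2)[OF j]])
    also have "\<dots> \<le> ennreal (G * (max 1 C * R powr p * 2 powr (- (real_of_int j * (p * decay)))))"
      using G C card_Z[OF F(2)[OF j]] besov_ball_scaled_norm_le[OF f r R F(2)[OF j]] Z_properties(1)
      by (intro ennreal_leI mult_left_mono level_energy_le) auto
    finally show ?thesis by (simp add: A_def mult.assoc)
  qed
  have "Lq_norm_pow M p (\<lambda>x. \<Sum>j\<in>F. level f j x)
      \<le> ennreal ((\<Sum>j\<in>F. w j) powr (p - 1)) * (\<Sum>j\<in>F. ennreal (w j powr (1 - p)) * Lq_norm_pow M p (level f j))"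
    using F p by (intro Lq_norm_pow_sum_weighted) (auto simp: w_def)
  also have "\<dots> \<le> ennreal ((\<Sum>j\<in>F. w j) powr (p - 1)) *
      (\<Sum>j\<in>F. ennreal (w j powr (1 - p)) * ennreal (A * 2 powr (- (real_of_int j * (p * decay)))))"
    by (intro mult_left_mono sum_mono lev) auto
  also have "\<dots> = ennreal ((\<Sum>j\<in>F. w j) powr (p - 1) *
      (\<Sum>j\<in>F. w j powr (1 - p) * (A * 2 powr (- (real_of_int j * (p * decay))))))"
    using A by (simp add: ennreal_mult' flip: sum_ennreal)
  also have "\<dots> \<le> ennreal ((1 / (1 - 2 powr (- (decay / 2)))) powr (p - 1) *
      (A * (1 / (1 - 2 powr (- (decay * (p + 1) / 2)))) * 2 powr (- (z * (p * decay)))))"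
  proof (intro ennreal_leI mult_mono)
    have "(\<Sum>j\<in>F. w j) \<le> 1 / (1 - 2 powr (- (decay / 2)))"
      unfolding w_def using F decay_pos by (intro sum_geometric_above) auto
    then show "(\<Sum>j\<in>F. w j) powr (p - 1) \<le> (1 / (1 - 2 powr (- (decay / 2)))) powr (p - 1)"
      using p by (intro powr_mono2 sum_nonneg) (auto simp: w_def)
    have "(\<Sum>j\<in>F. w j powr (1 - p) * (A * 2 powr (- (real_of_int j * (p * decay)))))
        = (\<Sum>j\<in>F. A * 2 powr (- (z * (p * decay))) * 2 powr (- (decay * (p + 1) / 2) * (real_of_int j - z)))"
    proof (intro sum.cong refl)
      fix j
      have "2 powr (- (decay / 2) * (real_of_int j - z) * (1 - p)) * 2 powr (- (real_of_int j * (p * decay)))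
          = 2 powr (- (z * (p * decay))) * (2::real) powr (- (decay * (p + 1) / 2) * (real_of_int j - z))"
        unfolding powr_add[symmetric] by (intro arg_cong[where f = "\<lambda>u. 2 powr u"]) (simp add: field_simps)
      then show "w j powr (1 - p) * (A * 2 powr (- (real_of_int j * (p * decay))))
          = A * 2 powr (- (z * (p * decay))) * 2 powr (- (decay * (p + 1) / 2) * (real_of_int j - z))"
        unfolding w_def powr_powr by (metis (no_types, opaque_lifting) mult.assoc mult.left_commute)
    qed
    also have "\<dots> = A * 2 powr (- (z * (p * decay))) * (\<Sum>j\<in>F. 2 powr (- (decay * (p + 1) / 2) * (real_of_int j - z)))"
      by (simp only: sum_distrib_left)
    also have "\<dots> \<le> A * 2 powr (- (z * (p * decay))) * (1 / (1 - 2 powr (- (decay * (p + 1) / 2))))"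
      using F decay_pos A p by (intro mult_left_mono sum_geometric_above) auto
    finally show "(\<Sum>j\<in>F. w j powr (1 - p) * (A * 2 powr (- (real_of_int j * (p * decay)))))
        \<le> A * (1 / (1 - 2 powr (- (decay * (p + 1) / 2)))) * 2 powr (- (z * (p * decay)))"
      by (simp only: mult_ac)
  qed (use A in \<open>auto intro!: sum_nonneg\<close>)
  finally show ?thesis by (simp add: F_def bias_const_def A_def z_def mult.assoc)
qed

text \<open>
  The needlet series converges to \<open>f\<close> in \<open>L\<^sub>2\<close>, hence almost everywhere along a subsequence, and Fatou's
  lemma carries the uniform \<open>L\<^sub>p\<close> bound on the blocks of levels over to the tail of the series.
\<close>

lemma bias_le:
  assumes f: "f \<in> besov_ball M e X lam \<phi> s \<pi> r R" and r: "r \<ge> 1" and R: "R > 0"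
  shows "Lq_norm_pow M p (\<lambda>x. (\<Sum>j\<in>{-1..int n}. level f j x) - f x)
           \<le> ennreal (bias_const R * 2 powr (- ((real n + 1) * (p * decay))))"
proof -
  have f2: "f \<in> L2_space M" using f by (simp add: besov_ball_def)
  obtain k :: "nat \<Rightarrow> nat" where k: "strict_mono k"
    and lim: "AE x in M. (\<lambda>i. \<Sum>j\<in>{-1..int (k i)}. level f j x) \<longlonglongrightarrow> f x"
    using sum_levels_AE_subseq[OF f2] by blast
  \<comment> \<open>The index is shifted by \<open>n\<close> so that every partial sum contains the levels up to \<open>n\<close>.\<close>
  define v where "v i x = (\<Sum>j\<in>{int n + 1..int (k (i + n))}. level f j x)" for i x
  have split: "(\<Sum>j\<in>{-1..int (k (i + n))}. level f j x) = (\<Sum>j\<in>{-1..int n}. level f j x) + v i x" for i x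
  proof -
    have "n \<le> k (i + n)" using seq_suble[OF k, of "i + n"] by linarith
    then have "{-1..int (k (i + n))} = {-1..int n} \<union> {int n + 1..int (k (i + n))}" by auto
    then show ?thesis unfolding v_def by (simp add: sum.union_disjoint)
  qed
  have "Lq_norm_pow M p (\<lambda>x. (\<Sum>j\<in>{-1..int n}. level f j x) - f x)
      \<le> (\<integral>\<^sup>+x. liminf (\<lambda>i. ennreal (\<bar>v i x\<bar> powr p)) \<partial>M)"
    unfolding Lq_norm_pow_def
  proof (intro nn_integral_mono_AE)
    show "AE x in M. ennreal (\<bar>(\<Sum>j\<in>{-1..int n}. level f j x) - f x\<bar> powr p) \<le> liminf (\<lambda>i. ennreal (\<bar>v i x\<bar> powr p))"
      using lim
    proof eventually_elim
      fix x assume "(\<lambda>i. \<Sum>j\<in>{-1..int (k i)}. level f j x) \<longlonglongrightarrow> f x"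
      then have "(\<lambda>i. \<Sum>j\<in>{-1..int (k (i + n))}. level f j x) \<longlonglongrightarrow> f x"
        by (rule LIMSEQ_ignore_initial_segment)
      then have "(\<lambda>i. ((\<Sum>j\<in>{-1..int n}. level f j x) + v i x) - (\<Sum>j\<in>{-1..int n}. level f j x))
          \<longlonglongrightarrow> f x - (\<Sum>j\<in>{-1..int n}. level f j x)"
        unfolding split by (intro tendsto_diff tendsto_const)
      then have "(\<lambda>i. v i x) \<longlonglongrightarrow> f x - (\<Sum>j\<in>{-1..int n}. level f j x)" by simp
      then have "(\<lambda>i. ennreal (\<bar>v i x\<bar> powr p)) \<longlonglongrightarrow> ennreal (\<bar>f x - (\<Sum>j\<in>{-1..int n}. level f j x)\<bar> powr p)"
        using p by (intro tendsto_ennrealI tendsto_powr2 tendsto_rabs tendsto_const) auto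
      then have "liminf (\<lambda>i. ennreal (\<bar>v i x\<bar> powr p)) = ennreal (\<bar>f x - (\<Sum>j\<in>{-1..int n}. level f j x)\<bar> powr p)"
        by (intro lim_imp_Liminf) auto
      then show "ennreal (\<bar>(\<Sum>j\<in>{-1..int n}. level f j x) - f x\<bar> powr p) \<le> liminf (\<lambda>i. ennreal (\<bar>v i x\<bar> powr p))"
        by (simp add: abs_minus_commute)
    qed
  qed
  also have "\<dots> \<le> liminf (\<lambda>i. \<integral>\<^sup>+x. ennreal (\<bar>v i x\<bar> powr p) \<partial>M)"
    by (rule nn_integral_liminf) (simp add: v_def)
  also have "\<dots> \<le> liminf (\<lambda>i::nat. ennreal (bias_const R * 2 powr (- ((real n + 1) * (p * decay)))))"
    using level_block_le[OF f r R]
    by (intro Liminf_mono always_eventually allI) (simp add: Lq_norm_pow_def v_def)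
  also have "\<dots> = ennreal (bias_const R * 2 powr (- ((real n + 1) * (p * decay))))"
    by (simp add: Liminf_const)
  finally show ?thesis .
qed

text \<open>
  For every realization of the data, the error splits into the errors of the thresholded coefficients
  and the truncation of the needlet series.  The factor \<open>card F powr (p - 1)\<close>, paid for
  adding up the levels, is the source of the logarithmic factor in the rate.
\<close>

lemma need_d_error_le:
  fixes J :: real
  assumes f: "f \<in> L2_space M"
  defines "F \<equiv> {j::int. -1 \<le> j \<and> real_of_int j \<le> J}"
  shows "Lq_norm_pow M p (\<lambda>x. need_d M e b X lam \<phi> \<kappa> \<epsilon> J Y x - f x)
    \<le> ennreal (2 powr p) * (ennreal (real (card F) powr (p - 1) * G) *
          ennreal (\<Sum>j\<in>F. 2 powr (real_of_int j * (p / 2 - 1)) * (\<Sum>\<eta>\<in>Z X j.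
            \<bar>hard_threshold (\<kappa> * t_eps \<epsilon> * sqrt (noise_level_sq M e b X lam \<phi> j)) (beta_hat M e b lam \<phi> Y j \<eta>)
              - coef f j \<eta>\<bar> powr p))
        + Lq_norm_pow M p (\<lambda>x. (\<Sum>j\<in>F. level f j x) - f x))"
proof -
  define d where "d j \<eta> = hard_threshold (\<kappa> * t_eps \<epsilon> * sqrt (noise_level_sq M e b X lam \<phi> j)) (beta_hat M e b lam \<phi> Y j \<eta>)
              - coef f j \<eta>" for j \<eta>
  have "F \<subseteq> {-1..\<lfloor>J\<rfloor>}" by (auto simp: F_def le_floor_iff)
  then have F: "finite F" by (rule finite_subset) simp
  have [measurable]: "f \<in> borel_measurable M" using f by (simp add: L2_space_def)
  have "need_d M e b X lam \<phi> \<kappa> \<epsilon> J Y x - f x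
      = (\<Sum>j\<in>F. \<Sum>\<eta>\<in>Z X j. d j \<eta> * psi j \<eta> x) + ((\<Sum>j\<in>F. level f j x) - f x)" for x
    by (simp add: need_d_def F_def[symmetric] level_def d_def left_diff_distrib sum_subtractf)
  then have "Lq_norm_pow M p (\<lambda>x. need_d M e b X lam \<phi> \<kappa> \<epsilon> J Y x - f x)
      \<le> ennreal (2 powr p) * (Lq_norm_pow M p (\<lambda>x. \<Sum>j\<in>F. \<Sum>\<eta>\<in>Z X j. d j \<eta> * psi j \<eta> x)
        + Lq_norm_pow M p (\<lambda>x. (\<Sum>j\<in>F. level f j x) - f x))"
    using p by (simp only:) (intro Lq_norm_pow_add_le; measurable; simp)
  also have "\<dots> \<le> ennreal (2 powr p) * (ennreal (real (card F) powr (p - 1) * G) *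
          ennreal (\<Sum>j\<in>F. 2 powr (real_of_int j * (p / 2 - 1)) * (\<Sum>\<eta>\<in>Z X j. \<bar>d j \<eta>\<bar> powr p))
        + Lq_norm_pow M p (\<lambda>x. (\<Sum>j\<in>F. level f j x) - f x))"
  proof (intro mult_left_mono add_right_mono)
    have "Lq_norm_pow M p (\<lambda>x. \<Sum>j\<in>F. \<Sum>\<eta>\<in>Z X j. d j \<eta> * psi j \<eta> x)
        \<le> ennreal ((\<Sum>j\<in>F. 1) powr (p - 1)) *
          (\<Sum>j\<in>F. ennreal (1 powr (1 - p)) * Lq_norm_pow M p (\<lambda>x. \<Sum>\<eta>\<in>Z X j. d j \<eta> * psi j \<eta> x))"
      using F p by (intro Lq_norm_pow_sum_weighted) auto
    also have "\<dots> \<le> ennreal ((\<Sum>j\<in>F. 1) powr (p - 1)) *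
          (\<Sum>j\<in>F. ennreal (1 powr (1 - p)) * ennreal (G * (2 powr (real_of_int j * (p / 2 - 1)) * (\<Sum>\<eta>\<in>Z X j. \<bar>d j \<eta>\<bar> powr p))))"
      by (intro mult_left_mono sum_mono synthesis) (auto simp: F_def)
    also have "\<dots> = ennreal (real (card F) powr (p - 1) * G *
        (\<Sum>j\<in>F. 2 powr (real_of_int j * (p / 2 - 1)) * (\<Sum>\<eta>\<in>Z X j. \<bar>d j \<eta>\<bar> powr p)))"
      using G by (simp add: sum_distrib_left mult.assoc sum_nonneg flip: ennreal_mult')
    also have "\<dots> = ennreal (real (card F) powr (p - 1) * G) *
        ennreal (\<Sum>j\<in>F. 2 powr (real_of_int j * (p / 2 - 1)) * (\<Sum>\<eta>\<in>Z X j. \<bar>d j \<eta>\<bar> powr p))"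
      using G by (intro ennreal_mult') auto
    finally show "Lq_norm_pow M p (\<lambda>x. \<Sum>j\<in>F. \<Sum>\<eta>\<in>Z X j. d j \<eta> * psi j \<eta> x)
      \<le> ennreal (real (card F) powr (p - 1) * G) *
        ennreal (\<Sum>j\<in>F. 2 powr (real_of_int j * (p / 2 - 1)) * (\<Sum>\<eta>\<in>Z X j. \<bar>d j \<eta>\<bar> powr p))" .
  qed auto
  finally show ?thesis unfolding d_def .
qed

end

section \<open>The risk over Besov balls\<close>

context needlet_estimation
begin

text \<open>
  Half the threshold is \<open>x = \<kappa> * sqrt (ln (1 / \<epsilon>)) / 2\<close> times the bound \<open>\<epsilon> * \<sigma>\<close> on the standard deviation of
  the noise.  Since \<open>\<kappa>\<^sup>2 \<ge> 16 * p\<close>, the Gaussian tail \<open>exp (- x\<^sup>2 / 4)\<close> is at most \<open>\<epsilon> powr p\<close>.  So large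
  deviations contribute \<open>\<epsilon> powr (2 * p)\<close>, once from the size of the noise and once from its rarity.
\<close>

lemma threshold_risk_le:
  assumes svd: "svd M K e g b" and P: "prob_space P" and W: "gaussian_white_noise P W"
    and f: "f \<in> L2_space M" and \<epsilon>: "0 < \<epsilon>" "\<epsilon> < 1" and \<kappa>: "\<kappa> > 0" "\<kappa>\<^sup>2 \<ge> 16 * p"
    and \<eta>: "\<eta> \<in> Z X j"
  defines "T \<equiv> \<kappa> * t_eps \<epsilon> * sqrt (noise_level_sq M e b X lam \<phi> j)"
  shows "(\<integral>\<^sup>+\<omega>. ennreal (\<bar>hard_threshold T (beta_hat M e b lam \<phi> (observation K g W \<epsilon> f \<omega>) j \<eta>) - coef f j \<eta>\<bar> powr p) \<partial>P)
    \<le> ennreal (6 powr p * (min \<bar>coef f j \<eta>\<bar> T powr p +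
        tilted_moment p * \<epsilon> powr (2 * p) * sqrt (noise_level_sq M e b X lam \<phi> j) powr p))"
proof -
  interpret P: prob_space P by (rule P)
  define \<sigma> where "\<sigma> = sqrt (noise_level_sq M e b X lam \<phi> j)"
  define L where "L = ln (1 / \<epsilon>)"
  have L: "L > 0" using \<epsilon> by (simp add: L_def)
  define x where "x = \<kappa> * sqrt L / 2"
  have x: "x \<ge> 0" using \<kappa> L by (simp add: x_def)
  obtain h where h: "norm h \<le> \<sigma>"
    and err: "AE \<omega> in P. beta_hat M e b lam \<phi> (observation K g W \<epsilon> f \<omega>) j \<eta> - coef f j \<eta> = \<epsilon> * W h \<omega>"
    using beta_hat_error[OF svd W \<eta>] f unfolding \<sigma>_def by blast
  have [measurable]: "W h \<in> borel_measurable P"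
    using W by (simp add: gaussian_white_noise_def)
  have \<sigma>: "\<sigma> \<ge> 0" using h norm_ge_zero order_trans by blast
  have T: "T = 2 * (\<epsilon> * \<sigma> * x)" "T \<ge> 0"
    using \<kappa> \<epsilon> L \<sigma> by (simp_all add: T_def \<sigma>_def[symmetric] x_def t_eps_def L_def[symmetric])
  define tail where "tail \<omega> = (if \<bar>\<epsilon> * W h \<omega>\<bar> > \<epsilon> * \<sigma> * x then \<bar>\<epsilon> * W h \<omega>\<bar> powr p else 0)" for \<omega>
  have exp_le: "exp (- x\<^sup>2 / 4) \<le> \<epsilon> powr p"
  proof -
    have "x\<^sup>2 / 4 = \<kappa>\<^sup>2 / 16 * L"
      using L by (simp add: x_def power_mult_distrib power_divide)
    also have "\<dots> \<ge> p * L" using \<kappa>(2) L by (intro mult_right_mono) auto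
    finally have "- x\<^sup>2 / 4 \<le> - (p * L)" by simp
    then have "exp (- x\<^sup>2 / 4) \<le> exp (- (p * L))" by simp
    also have "\<dots> = \<epsilon> powr p" using \<epsilon> by (simp add: powr_def L_def ln_div)
    finally show ?thesis .
  qed
  have "(\<integral>\<^sup>+\<omega>. ennreal (\<bar>hard_threshold T (beta_hat M e b lam \<phi> (observation K g W \<epsilon> f \<omega>) j \<eta>) - coef f j \<eta>\<bar> powr p) \<partial>P)
      \<le> (\<integral>\<^sup>+\<omega>. ennreal (6 powr p) * (ennreal (min \<bar>coef f j \<eta>\<bar> T powr p) + ennreal (tail \<omega>)) \<partial>P)"
  proof (intro nn_integral_mono_AE)
    show "AE \<omega> in P. ennreal (\<bar>hard_threshold T (beta_hat M e b lam \<phi> (observation K g W \<epsilon> f \<omega>) j \<eta>) - coef f j \<eta>\<bar> powr p)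
        \<le> ennreal (6 powr p) * (ennreal (min \<bar>coef f j \<eta>\<bar> T powr p) + ennreal (tail \<omega>))"
      using err
    proof eventually_elim
      fix \<omega> assume eq: "beta_hat M e b lam \<phi> (observation K g W \<epsilon> f \<omega>) j \<eta> - coef f j \<eta> = \<epsilon> * W h \<omega>"
      have "\<bar>hard_threshold T (beta_hat M e b lam \<phi> (observation K g W \<epsilon> f \<omega>) j \<eta>) - coef f j \<eta>\<bar> powr p
          \<le> 6 powr p * (min \<bar>coef f j \<eta>\<bar> T powr p + tail \<omega>)"
        using hard_threshold_error_powr[OF T(2), of p "beta_hat M e b lam \<phi> (observation K g W \<epsilon> f \<omega>) j \<eta>" "coef f j \<eta>"] p
        unfolding eq tail_def by (simp add: T(1))
      then have "ennreal (\<bar>hard_threshold T (beta_hat M e b lam \<phi> (observation K g W \<epsilon> f \<omega>) j \<eta>) - coef f j \<eta>\<bar> powr p)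
          \<le> ennreal (6 powr p * (min \<bar>coef f j \<eta>\<bar> T powr p + tail \<omega>))"
        by (rule ennreal_leI)
      then show "ennreal (\<bar>hard_threshold T (beta_hat M e b lam \<phi> (observation K g W \<epsilon> f \<omega>) j \<eta>) - coef f j \<eta>\<bar> powr p)
          \<le> ennreal (6 powr p) * (ennreal (min \<bar>coef f j \<eta>\<bar> T powr p) + ennreal (tail \<omega>))"
        by (simp add: ennreal_mult' tail_def)
    qed
  qed
  also have "\<dots> = ennreal (6 powr p) * (ennreal (min \<bar>coef f j \<eta>\<bar> T powr p) + (\<integral>\<^sup>+\<omega>. ennreal (tail \<omega>) \<partial>P))"
    unfolding tail_def by (simp add: nn_integral_cmult nn_integral_add P.emeasure_space_1)
  also have "\<dots> \<le> ennreal (6 powr p) * (ennreal (min \<bar>coef f j \<eta>\<bar> T powr p) +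
      ennreal (tilted_moment p * \<epsilon> powr (2 * p) * \<sigma> powr p))"
  proof (intro mult_left_mono add_left_mono)
    have "(\<integral>\<^sup>+\<omega>. ennreal (tail \<omega>) \<partial>P) \<le> ennreal ((\<epsilon> * \<sigma>) powr p * (tilted_moment p * exp (- x\<^sup>2 / 4)))"
      unfolding tail_def using p by (intro white_noise_truncated_moment_le[OF W h \<epsilon>(1) _ x]) auto
    also have "\<dots> \<le> ennreal ((\<epsilon> * \<sigma>) powr p * (tilted_moment p * \<epsilon> powr p))"
      by (intro ennreal_leI mult_left_mono exp_le tilted_moment_nonneg) auto
    also have "(\<epsilon> * \<sigma>) powr p * (tilted_moment p * \<epsilon> powr p) = tilted_moment p * (\<epsilon> powr p * \<epsilon> powr p) * \<sigma> powr p"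
      unfolding powr_mult by (simp only: mult_ac)
    also have "\<epsilon> powr p * \<epsilon> powr p = \<epsilon> powr (2 * p)"
      by (simp flip: powr_add)
    finally show "(\<integral>\<^sup>+\<omega>. ennreal (tail \<omega>) \<partial>P) \<le> ennreal (tilted_moment p * \<epsilon> powr (2 * p) * \<sigma> powr p)" .
  qed auto
  also have "\<dots> = ennreal (6 powr p * (min \<bar>coef f j \<eta>\<bar> T powr p + tilted_moment p * \<epsilon> powr (2 * p) * \<sigma> powr p))"
    by (subst ennreal_mult') (simp_all add: ennreal_plus[symmetric] tilted_moment_nonneg del: ennreal_plus)
  finally show ?thesis
    unfolding \<sigma>_def .
qed

text \<open>
  The cut-off is the level at which the threshold, of order \<open>t * 2 powr (j * \<nu>)\<close>, reaches
  \<open>2 powr (- j / 2)\<close>.  Since \<open>\<epsilon> \<le> t\<close>, it is at most of order \<open>ln (1 / \<epsilon>)\<close>.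
\<close>

lemma resolution_level:
  assumes \<epsilon>: "0 < \<epsilon>" "\<epsilon> \<le> exp (-1)" and J: "2 powr J = t_eps \<epsilon> powr (- 2 / (2 * \<nu> + 1))"
  shows "1 \<le> ln (1 / \<epsilon>)" "\<epsilon> \<le> t_eps \<epsilon>" "0 < t_eps \<epsilon>" "t_eps \<epsilon> < 1" "0 < J"
    and "J \<le> ln (1 / \<epsilon>) / (m * ln 2)"
    and "2 powr (J * y) = t_eps \<epsilon> powr (- (y / m))"
proof -
  define L where "L = ln (1 / \<epsilon>)"
  define t where "t = t_eps \<epsilon>"
  have "ln \<epsilon> \<le> -1" using \<epsilon> by (metis ln_exp ln_le_cancel_iff exp_gt_zero)
  then show L: "1 \<le> ln (1 / \<epsilon>)" using \<epsilon> by (simp add: ln_div)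
  have "\<epsilon> * 1 \<le> \<epsilon> * sqrt (ln (1 / \<epsilon>))" using L \<epsilon> by (intro mult_left_mono) auto
  then show \<epsilon>t: "\<epsilon> \<le> t_eps \<epsilon>" by (simp add: t_eps_def)
  then show t0: "0 < t_eps \<epsilon>" using \<epsilon> by linarith
  have "\<epsilon> < 1" using \<epsilon> by (smt (verit) exp_less_one_iff)
  have "ln (1 / \<epsilon>) < 1 / \<epsilon>" using \<epsilon> ln_less_self[of "1 / \<epsilon>"] by simp
  then have "\<epsilon>\<^sup>2 * ln (1 / \<epsilon>) < \<epsilon>\<^sup>2 * (1 / \<epsilon>)" using \<epsilon> by (intro mult_strict_left_mono) auto
  also have "\<dots> < 1" using \<epsilon> \<open>\<epsilon> < 1\<close> by (simp add: power2_eq_square)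
  finally have "(t_eps \<epsilon>)\<^sup>2 < 1\<^sup>2" using L by (simp add: t_eps_def power_mult_distrib)
  then show t1: "t_eps \<epsilon> < 1" by (rule power2_less_imp_less) simp
  have "- 2 / (2 * \<nu> + 1) = - (1 / m)" using ill_posed by (simp add: field_simps)
  then have J': "2 powr J = t_eps \<epsilon> powr (- (1 / m))" using J by simp
  then have "ln (2 powr J) = ln (t_eps \<epsilon> powr (- (1 / m)))" by simp
  then have Jln: "J * ln 2 = - (1 / m) * ln (t_eps \<epsilon>)" using t0 by (simp add: ln_powr)
  have "ln (t_eps \<epsilon>) < 0" using t0 t1 by simp
  then have "J * ln 2 > 0" unfolding Jln using m_pos by (simp add: divide_neg_pos)
  then show "0 < J" by (simp add: zero_less_mult_iff)
  have "- ln (t_eps \<epsilon>) \<le> ln (1 / \<epsilon>)" using \<epsilon> \<epsilon>t t0 by (simp add: ln_div)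
  then have "(1 / m) * (- ln (t_eps \<epsilon>)) \<le> (1 / m) * ln (1 / \<epsilon>)"
    using m_pos by (intro mult_left_mono) auto
  then have "J * ln 2 \<le> (1 / m) * ln (1 / \<epsilon>)"
    unfolding Jln by simp
  moreover have "J \<le> y / (k * ln 2)" if "k > 0" "J * ln 2 \<le> (1 / k) * y" for k y :: real
    using that by (simp add: field_simps)
  ultimately show "J \<le> ln (1 / \<epsilon>) / (m * ln 2)"
    using m_pos by blast
  have "2 powr (J * y) = (2 powr J) powr y" by (simp add: powr_powr)
  also have "\<dots> = t_eps \<epsilon> powr (- (y / m))" unfolding J' by (simp add: powr_powr)
  finally show "2 powr (J * y) = t_eps \<epsilon> powr (- (y / m))" .
qed

lemma beta_hat_measurable:
  assumes W: "gaussian_white_noise P W"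
  shows "(\<lambda>\<omega>. beta_hat M e b lam \<phi> (observation K g W \<epsilon> f \<omega>) j \<eta>) \<in> borel_measurable P"
proof -
  have [measurable]: "W h \<in> borel_measurable P" for h
    using W by (simp add: gaussian_white_noise_def)
  show ?thesis unfolding beta_hat_def observation_def by measurable
qed

text \<open>
  Both the threshold error and the bias are of the order of \<open>t powr (rate * p)\<close>.  The large deviations
  sum to the order of \<open>\<epsilon> powr (2 * p) * 2 powr (J * p * m) = \<epsilon> powr (2 * p) * t powr (- p)\<close>, which is at most \<open>t powr p\<close>
  and hence negligible, because the rate does not exceed \<open>1\<close>.
\<close>

lemma need_d_risk_le:
  assumes svd: "svd M K e g b" and P: "prob_space P" and W: "gaussian_white_noise P W"
    and \<kappa>: "\<kappa> > 0" "\<kappa>\<^sup>2 \<ge> 16 * p"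
    and S: "S > 0" "\<And>j. j \<ge> -1 \<Longrightarrow> sqrt (noise_level_sq M e b X lam \<phi> j) \<le> S * 2 powr (real_of_int j * \<nu>)"
    and R: "R > 0" and r: "r \<ge> 1" and critical: "s = m * (p / \<pi> - 1) \<Longrightarrow> r \<le> ereal \<pi>"
  shows "\<exists>C'>0. \<forall>\<epsilon> J. 0 < \<epsilon> \<longrightarrow> \<epsilon> \<le> exp (-1) \<longrightarrow> 2 powr J = t_eps \<epsilon> powr (- 2 / (2 * \<nu> + 1)) \<longrightarrow>
    (\<forall>f\<in>besov_ball M e X lam \<phi> s \<pi> r R.
      (\<integral>\<^sup>+\<omega>. Lq_norm_pow M p (\<lambda>x. need_d M e b X lam \<phi> \<kappa> \<epsilon> J (observation K g W \<epsilon> f \<omega>) x - f x) \<partial>P)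
        \<le> ennreal (C' * ln (1 / \<epsilon>) powr (p - 1) * t_eps \<epsilon> powr (rate * p)))"
proof -
  interpret P: prob_space P by (rule P)
  define \<sigma> where "\<sigma> j = sqrt (noise_level_sq M e b X lam \<phi> j)" for j
  have \<sigma>_nonneg: "\<sigma> j \<ge> 0" for j
  proof -
    obtain \<eta> where "\<eta> \<in> Z X j" using Z_nonempty by blast
    then show ?thesis
      using beta_hat_error[OF svd W] norm_ge_zero order_trans unfolding \<sigma>_def by blast
  qed
  have "\<kappa> * S > 0" using \<kappa> S by simp
  from sum_threshold_levels_le[OF C this R]
  obtain A where A: "A \<ge> 0" and thresholds: "\<forall>t>0. \<forall>F (I :: int \<Rightarrow> 'y set) x T.
      admissible_levels C (\<kappa> * S) R t F I x T \<longrightarrow>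
      (\<Sum>j\<in>F. 2 powr (real_of_int j * (p / 2 - 1)) * (\<Sum>\<eta>\<in>I j. min \<bar>x j \<eta>\<bar> (T j) powr p)) \<le> A * t powr (rate * p)"
    by blast
  define H where "H = tilted_moment p * C * S powr p * (1 / (1 - 2 powr (- (p * m))))"
  define cN where "cN = 1 / (m * ln 2) + 2"
  define C' where "C' = 2 powr p * (cN powr (p - 1) * G * (6 powr p * (A + H)) + bias_const R) + 1"
  \<comment> \<open>The summand \<open>1\<close> only makes the constant positive.\<close>
  have H: "H \<ge> 0"
    unfolding H_def using C p m_pos tilted_moment_nonneg
    by (intro mult_nonneg_nonneg geometric_limit_nonneg) auto
  have cN: "cN > 0" using m_pos by (simp add: cN_def add_nonneg_pos)
  have C'_pos: "C' > 0"
    unfolding C'_def using A H G bias_const_nonneg by (intro add_nonneg_pos mult_nonneg_nonneg add_nonneg_nonneg) auto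
  show ?thesis
  proof (intro exI[of _ C'] conjI C'_pos allI impI ballI)
    fix \<epsilon> J :: real and f
    assume \<epsilon>: "0 < \<epsilon>" "\<epsilon> \<le> exp (-1)" and J: "2 powr J = t_eps \<epsilon> powr (- 2 / (2 * \<nu> + 1))"
      and f: "f \<in> besov_ball M e X lam \<phi> s \<pi> r R"
    note res = resolution_level[OF \<epsilon> J]
    have f2: "f \<in> L2_space M" using f by (simp add: besov_ball_def)
    define t where "t = t_eps \<epsilon>"
    define L where "L = ln (1 / \<epsilon>)"
    define n where "n = nat \<lfloor>J\<rfloor>"
    define T where "T j = \<kappa> * t * \<sigma> j" for j
    define F where "F = {j::int. -1 \<le> j \<and> real_of_int j \<le> J}"
    have t: "0 < t" "t < 1" "\<epsilon> \<le> t" and L: "1 \<le> L" using res by (auto simp: t_def L_def)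
    have n: "real n \<le> J" "J < real n + 1"
      using res(5) unfolding n_def by linarith+
    have F_eq: "F = {-1..int n}" using res(5) by (auto simp: F_def n_def le_floor_iff)
    have F: "finite F" "F \<subseteq> {-1..}" "\<And>j. j \<in> F \<Longrightarrow> j \<ge> -1" "\<And>j. j \<in> F \<Longrightarrow> real_of_int j \<le> J"
      by (auto simp: F_eq) (use n in \<open>auto intro: order_trans[rotated]\<close>)
    have rate_t: "t powr y \<le> t powr (rate * p)" if "rate * p \<le> y" for y
      using t that by (intro powr_mono') auto
    \<comment> \<open>There are at most \<open>J + 2\<close> levels because they start at \<open>-1\<close>.\<close>
    have card: "real (card F) powr (p - 1) \<le> cN powr (p - 1) * L powr (p - 1)"
    proof -
      have "real (card F) = real n + 2" by (simp add: F_eq)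
      also have "\<dots> \<le> L / (m * ln 2) + 2 * L" using n res(6) L by (simp add: L_def)
      also have "\<dots> = cN * L" by (simp add: cN_def algebra_simps)
      finally have "real (card F) powr (p - 1) \<le> (cN * L) powr (p - 1)"
        using p by (intro powr_mono2) auto
      then show ?thesis by (simp add: powr_mult)
    qed
    have main: "(\<Sum>j\<in>F. 2 powr (real_of_int j * (p / 2 - 1)) * (\<Sum>\<eta>\<in>Z X j. min \<bar>coef f j \<eta>\<bar> (T j) powr p))
        \<le> A * t powr (rate * p)"
    proof (rule thresholds[rule_format, OF t(1)])
      have "0 \<le> T j \<and> T j \<le> \<kappa> * S * t * 2 powr (real_of_int j * \<nu>)" if "j \<in> F" for j
      proof -
        have "\<kappa> * t * \<sigma> j \<le> \<kappa> * t * (S * 2 powr (real_of_int j * \<nu>))"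
          unfolding \<sigma>_def using S(2)[OF F(3)[OF that]] \<kappa> t by (intro mult_left_mono) auto
        then show ?thesis using \<kappa> t \<sigma>_nonneg by (simp add: T_def mult_ac)
      qed
      then show "admissible_levels C (\<kappa> * S) R t F (Z X) (coef f) T"
        unfolding admissible_levels_def
        using F card_Z Z_properties(1) besov_ball_scaled_norm_le[OF f r R] besov_ball_sum_powr_le[OF f r _ R F(1,2)] critical
        by auto
    qed
    have noise: "(\<Sum>j\<in>F. 2 powr (real_of_int j * (p / 2 - 1)) * (\<Sum>\<eta>\<in>Z X j. tilted_moment p * \<epsilon> powr (2 * p) * \<sigma> j powr p))
        \<le> H * t powr (rate * p)"
    proof -
      define E where "E = tilted_moment p * C * S powr p * \<epsilon> powr (2 * p)"
      have E: "E \<ge> 0" using C tilted_moment_nonneg by (simp add: E_def)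
      have "(\<Sum>j\<in>F. 2 powr (real_of_int j * (p / 2 - 1)) * (\<Sum>\<eta>\<in>Z X j. tilted_moment p * \<epsilon> powr (2 * p) * \<sigma> j powr p))
          \<le> (\<Sum>j\<in>F. E * 2 powr (J * (p * m)) * 2 powr ((p * m) * (real_of_int j - J)))"
      proof (intro sum_mono)
        fix j assume j: "j \<in> F"
        have "\<sigma> j powr p \<le> (S * 2 powr (real_of_int j * \<nu>)) powr p"
          using S(2)[OF F(3)[OF j]] \<sigma>_nonneg p unfolding \<sigma>_def by (intro powr_mono2) auto
        also have "\<dots> = S powr p * 2 powr (real_of_int j * \<nu> * p)"
          by (simp add: powr_mult powr_powr)
        finally have 1: "\<sigma> j powr p \<le> S powr p * 2 powr (real_of_int j * \<nu> * p)" .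
        have "2 powr (real_of_int j * (p / 2 - 1)) * (\<Sum>\<eta>\<in>Z X j. tilted_moment p * \<epsilon> powr (2 * p) * \<sigma> j powr p)
            = 2 powr (real_of_int j * (p / 2 - 1)) * (tilted_moment p * \<epsilon> powr (2 * p)) * (real (card (Z X j)) * \<sigma> j powr p)"
          by simp
        also have "\<dots> \<le> 2 powr (real_of_int j * (p / 2 - 1)) * (tilted_moment p * \<epsilon> powr (2 * p)) *
            ((C * 2 powr real_of_int j) * (S powr p * 2 powr (real_of_int j * \<nu> * p)))"
          using card_Z[OF F(3)[OF j]] 1 C tilted_moment_nonneg by (intro mult_left_mono mult_mono) auto
        also have "\<dots> = E * (2 powr (real_of_int j * (p / 2 - 1)) * 2 powr real_of_int j * 2 powr (real_of_int j * \<nu> * p))"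
          by (simp add: E_def)
        also have "2 powr (real_of_int j * (p / 2 - 1)) * 2 powr real_of_int j * 2 powr (real_of_int j * \<nu> * p)
            = 2 powr (J * (p * m)) * 2 powr ((p * m) * (real_of_int j - J))"
          unfolding powr_add[symmetric] by (intro arg_cong[where f = "\<lambda>u. 2 powr u"]) (simp add: field_simps)
        finally show "2 powr (real_of_int j * (p / 2 - 1)) * (\<Sum>\<eta>\<in>Z X j. tilted_moment p * \<epsilon> powr (2 * p) * \<sigma> j powr p)
            \<le> E * 2 powr (J * (p * m)) * 2 powr ((p * m) * (real_of_int j - J))"
          by (simp only: mult.assoc)
      qed
      also have "\<dots> = E * 2 powr (J * (p * m)) * (\<Sum>j\<in>F. 2 powr ((p * m) * (real_of_int j - J)))"
        by (simp only: sum_distrib_left)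
      also have "\<dots> \<le> E * 2 powr (J * (p * m)) * (1 / (1 - 2 powr (- (p * m))))"
        using F E p m_pos by (intro mult_left_mono sum_geometric_below) auto
      also have "\<dots> = H * (\<epsilon> powr (2 * p) * t powr (- p))"
      proof -
        have "2 powr (J * (p * m)) = t powr (- p)"
          using res(7)[of "p * m"] m_pos by (simp add: t_def)
        then show ?thesis by (simp add: E_def H_def)
      qed
      also have "\<epsilon> powr (2 * p) * t powr (- p) \<le> t powr (2 * p) * t powr (- p)"
        using t \<epsilon> p by (intro mult_right_mono powr_mono2) auto
      also have "t powr (2 * p) * t powr (- p) = t powr p"
        by (simp flip: powr_add)
      also have "t powr p \<le> t powr (rate * p)"
        using rate_le_1 p by (intro rate_t) simp
      finally show ?thesis using H by (simp add: mult_left_mono)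
    qed
    define V where "V \<omega> = (\<Sum>j\<in>F. 2 powr (real_of_int j * (p / 2 - 1)) * (\<Sum>\<eta>\<in>Z X j.
        \<bar>hard_threshold (T j) (beta_hat M e b lam \<phi> (observation K g W \<epsilon> f \<omega>) j \<eta>) - coef f j \<eta>\<bar> powr p))" for \<omega>
    have V_measurable [measurable]: "V \<in> borel_measurable P"
    proof -
      note beta_hat_measurable[OF W, measurable]
      show ?thesis unfolding V_def[abs_def] hard_threshold_def by measurable
    qed
    have V: "(\<integral>\<^sup>+\<omega>. ennreal (V \<omega>) \<partial>P) \<le> ennreal (6 powr p * (A + H) * t powr (rate * p))"
    proof -
      define q where "q j = (2::real) powr (real_of_int j * (p / 2 - 1))" for j :: int
      define v where "v j \<eta> \<omega> = \<bar>hard_threshold (T j) (beta_hat M e b lam \<phi> (observation K g W \<epsilon> f \<omega>) j \<eta>) - coef f j \<eta>\<bar> powr p" for j \<eta> \<omega>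
      have [measurable]: "v j \<eta> \<in> borel_measurable P" for j \<eta>
      proof -
        note beta_hat_measurable[OF W, measurable]
        show ?thesis unfolding v_def[abs_def] hard_threshold_def by measurable
      qed
      define w where "w j \<eta> = 6 powr p * (min \<bar>coef f j \<eta>\<bar> (T j) powr p + tilted_moment p * \<epsilon> powr (2 * p) * \<sigma> j powr p)" for j \<eta>
      have w: "w j \<eta> \<ge> 0" for j \<eta> using tilted_moment_nonneg by (simp add: w_def)
      have vw: "(\<integral>\<^sup>+\<omega>. ennreal (v j \<eta> \<omega>) \<partial>P) \<le> ennreal (w j \<eta>)" if "\<eta> \<in> Z X j" for j \<eta>
        using threshold_risk_le[OF svd P W f2 \<epsilon>(1) _ \<kappa> that] t
        by (simp add: v_def w_def T_def t_def \<sigma>_def)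
      have "(\<integral>\<^sup>+\<omega>. ennreal (V \<omega>) \<partial>P) = (\<integral>\<^sup>+\<omega>. (\<Sum>j\<in>F. ennreal (q j) * (\<Sum>\<eta>\<in>Z X j. ennreal (v j \<eta> \<omega>))) \<partial>P)"
        unfolding V_def q_def[symmetric] v_def[symmetric]
        by (simp add: ennreal_mult' q_def v_def sum_nonneg flip: sum_ennreal)
      also have "\<dots> = (\<Sum>j\<in>F. ennreal (q j) * (\<Sum>\<eta>\<in>Z X j. \<integral>\<^sup>+\<omega>. ennreal (v j \<eta> \<omega>) \<partial>P))"
        by (simp add: nn_integral_sum nn_integral_cmult)
      also have "\<dots> \<le> (\<Sum>j\<in>F. ennreal (q j) * (\<Sum>\<eta>\<in>Z X j. ennreal (w j \<eta>)))"
        by (intro sum_mono mult_left_mono vw) auto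
      also have "\<dots> = ennreal (\<Sum>j\<in>F. q j * (\<Sum>\<eta>\<in>Z X j. w j \<eta>))"
        using w by (simp add: ennreal_mult' q_def sum_nonneg flip: sum_ennreal)
      also have "(\<Sum>j\<in>F. q j * (\<Sum>\<eta>\<in>Z X j. w j \<eta>))
          = 6 powr p * ((\<Sum>j\<in>F. q j * (\<Sum>\<eta>\<in>Z X j. min \<bar>coef f j \<eta>\<bar> (T j) powr p))
              + (\<Sum>j\<in>F. q j * (\<Sum>\<eta>\<in>Z X j. tilted_moment p * \<epsilon> powr (2 * p) * \<sigma> j powr p)))"
        unfolding w_def sum_distrib_left[symmetric] sum.distrib distrib_left
        by (simp add: sum_distrib_left sum.distrib algebra_simps)
      also have "ennreal \<dots> \<le> ennreal (6 powr p * (A * t powr (rate * p) + H * t powr (rate * p)))"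
        unfolding q_def by (intro ennreal_leI mult_left_mono add_mono main noise) auto
      finally show ?thesis by (simp add: algebra_simps)
    qed
    have bias: "Lq_norm_pow M p (\<lambda>x. (\<Sum>j\<in>F. level f j x) - f x) \<le> ennreal (bias_const R * t powr (rate * p))"
    proof -
      have "2 powr (- ((real n + 1) * (p * decay))) \<le> 2 powr (J * (- (p * decay)))"
      proof (intro powr_mono)
        have "J * (p * decay) \<le> (real n + 1) * (p * decay)"
          using n p decay_pos by (intro mult_right_mono) auto
        then show "- ((real n + 1) * (p * decay)) \<le> J * (- (p * decay))" by simp
      qed simp
      also have "\<dots> = t powr (p * decay / m)"
        unfolding t_def res(7) by simp
      also have "\<dots> \<le> t powr (rate * p)"
        using mult_right_mono[OF rate_le_decay, of p] p by (intro rate_t) (simp add: mult.commute)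
      finally have "bias_const R * 2 powr (- ((real n + 1) * (p * decay))) \<le> bias_const R * t powr (rate * p)"
        by (intro mult_left_mono bias_const_nonneg)
      then show ?thesis
        unfolding F_eq using bias_le[OF f r R, of n] by (meson ennreal_leI order_trans)
    qed
    have "(\<integral>\<^sup>+\<omega>. Lq_norm_pow M p (\<lambda>x. need_d M e b X lam \<phi> \<kappa> \<epsilon> J (observation K g W \<epsilon> f \<omega>) x - f x) \<partial>P)
        \<le> (\<integral>\<^sup>+\<omega>. ennreal (2 powr p) * (ennreal (real (card F) powr (p - 1) * G) * ennreal (V \<omega>)
              + ennreal (bias_const R * t powr (rate * p))) \<partial>P)"
    proof (intro nn_integral_mono)
      fix \<omega>
      have "Lq_norm_pow M p (\<lambda>x. need_d M e b X lam \<phi> \<kappa> \<epsilon> J (observation K g W \<epsilon> f \<omega>) x - f x)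
          \<le> ennreal (2 powr p) * (ennreal (real (card F) powr (p - 1) * G) * ennreal (V \<omega>)
              + Lq_norm_pow M p (\<lambda>x. (\<Sum>j\<in>F. level f j x) - f x))"
        unfolding V_def T_def F_def t_def \<sigma>_def by (rule need_d_error_le[OF f2])
      also have "\<dots> \<le> ennreal (2 powr p) * (ennreal (real (card F) powr (p - 1) * G) * ennreal (V \<omega>)
              + ennreal (bias_const R * t powr (rate * p)))"
        by (intro mult_left_mono add_left_mono bias) auto
      finally show "Lq_norm_pow M p (\<lambda>x. need_d M e b X lam \<phi> \<kappa> \<epsilon> J (observation K g W \<epsilon> f \<omega>) x - f x)
          \<le> ennreal (2 powr p) * (ennreal (real (card F) powr (p - 1) * G) * ennreal (V \<omega>)
              + ennreal (bias_const R * t powr (rate * p)))" .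
    qed
    also have "\<dots> = ennreal (2 powr p) * (ennreal (real (card F) powr (p - 1) * G) * (\<integral>\<^sup>+\<omega>. ennreal (V \<omega>) \<partial>P)
              + ennreal (bias_const R * t powr (rate * p)))"
      by (simp add: nn_integral_cmult nn_integral_add P.emeasure_space_1)
    also have "\<dots> \<le> ennreal (2 powr p) * (ennreal (real (card F) powr (p - 1) * G) * ennreal (6 powr p * (A + H) * t powr (rate * p))
              + ennreal (bias_const R * t powr (rate * p)))"
      by (intro mult_left_mono add_right_mono V) auto
    also have "\<dots> = ennreal (2 powr p * (real (card F) powr (p - 1) * G * (6 powr p * (A + H) * t powr (rate * p))
              + bias_const R * t powr (rate * p)))"
    proof -
      have "0 \<le> real (card F) powr (p - 1) * G" "0 \<le> 6 powr p * (A + H) * t powr (rate * p)"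
        "0 \<le> bias_const R * t powr (rate * p)"
        using A H G bias_const_nonneg by auto
      then show ?thesis
        by (simp only: ennreal_mult ennreal_plus powr_ge_zero mult_nonneg_nonneg add_nonneg_nonneg)
    qed
    also have "\<dots> \<le> ennreal (C' * L powr (p - 1) * t powr (rate * p))"
    proof (rule ennreal_leI)
      have L1: "1 \<le> L powr (p - 1)" using L p by (simp add: ge_one_powr_ge_zero)
      have "real (card F) powr (p - 1) * (G * (6 powr p * (A + H)) * t powr (rate * p))
          \<le> cN powr (p - 1) * L powr (p - 1) * (G * (6 powr p * (A + H)) * t powr (rate * p))"
        using A H G by (intro mult_right_mono card) auto
      moreover have "1 * (bias_const R * t powr (rate * p)) \<le> L powr (p - 1) * (bias_const R * t powr (rate * p))"
        using bias_const_nonneg by (intro mult_right_mono L1) auto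
      ultimately have "2 powr p * (real (card F) powr (p - 1) * G * (6 powr p * (A + H) * t powr (rate * p))
              + bias_const R * t powr (rate * p))
          \<le> 2 powr p * (cN powr (p - 1) * L powr (p - 1) * (G * (6 powr p * (A + H)) * t powr (rate * p))
              + L powr (p - 1) * (bias_const R * t powr (rate * p)))"
        by (intro mult_left_mono) (simp_all add: mult.assoc)
      also have "\<dots> = (C' - 1) * L powr (p - 1) * t powr (rate * p)"
        by (simp add: C'_def algebra_simps)
      also have "\<dots> \<le> C' * L powr (p - 1) * t powr (rate * p)"
        by (intro mult_right_mono) auto
      finally show "2 powr p * (real (card F) powr (p - 1) * G * (6 powr p * (A + H) * t powr (rate * p))
              + bias_const R * t powr (rate * p)) \<le> C' * L powr (p - 1) * t powr (rate * p)" .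
    qed
    finally show "(\<integral>\<^sup>+\<omega>. Lq_norm_pow M p (\<lambda>x. need_d M e b X lam \<phi> \<kappa> \<epsilon> J (observation K g W \<epsilon> f \<omega>) x - f x) \<partial>P)
        \<le> ennreal (C' * ln (1 / \<epsilon>) powr (p - 1) * t_eps \<epsilon> powr (rate * p))"
      by (simp add: L_def t_def)
  qed
qed

end

theorem theorem1:
  fixes M :: "'y measure"
    and P :: "'w measure"
    and K :: "('y \<Rightarrow> real) \<Rightarrow> 'k::{real_inner,complete_space}"
    and W :: "'k \<Rightarrow> 'w \<Rightarrow> real"
    and e :: "nat \<Rightarrow> 'y \<Rightarrow> real"
    and g :: "nat \<Rightarrow> 'k"
    and b :: "nat \<Rightarrow> real"
    and X :: "nat \<Rightarrow> 'y set"
    and lam :: "nat \<Rightarrow> 'y \<Rightarrow> real"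
    and \<phi> :: "real \<Rightarrow> real"
    and p \<nu> \<kappa> R \<pi> s \<mu> :: real
    and r :: ereal
  assumes "finite_measure M"
    and "L2_compact_operator M K"
    and "svd M K e g b"
    and "prob_space P"
    and "gaussian_white_noise P W"
    and "needlet_setting M e X lam \<phi>"
    and "\<forall>q\<ge>1. \<exists>C>0. \<exists>c>0. \<exists>C\<^sub>q>0. \<exists>D>0. \<forall>j::int. j \<ge> -1 \<longrightarrow>
           real (card (Z X j)) \<le> C * 2 powr real_of_int j \<and>
           (\<forall>\<eta>\<in>Z X j.
              ennreal (c * 2 powr (real_of_int j * (q/2 - 1)))
                \<le> Lq_norm_pow M q (needlet M e lam \<phi> j \<eta>) \<and>
              Lq_norm_pow M q (needlet M e lam \<phi> j \<eta>)
                \<le> ennreal (C\<^sub>q * 2 powr (real_of_int j * (q/2 - 1)))) \<and>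
           (\<forall>u. Lq_norm_pow M q (\<lambda>x. \<Sum>\<eta>\<in>Z X j. u \<eta> * needlet M e lam \<phi> j \<eta> x)
              \<le> ennreal D *
                (\<Sum>\<eta>\<in>Z X j. ennreal (\<bar>u \<eta>\<bar> powr q) * Lq_norm_pow M q (needlet M e lam \<phi> j \<eta>)))"
    and "1 < p"
    and "2 * \<nu> + 1 > 0"
    and "\<exists>C. \<forall>j::int. j \<ge> 0 \<longrightarrow>
           noise_level_sq M e b X lam \<phi> j \<le> C * 2 powr (2 * real_of_int j * \<nu>)"
    and "\<kappa> > 0" and "\<kappa>\<^sup>2 \<ge> 16 * p"
    and "R > 0" and "\<pi> \<ge> 1" and "s \<ge> 1 / \<pi>" and "r \<ge> 1"
    and "s = (\<nu> + 1/2) * (p / \<pi> - 1) \<longrightarrow> r \<le> ereal \<pi>"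
    and "\<mu> = (if s \<ge> (\<nu> + 1/2) * (p / \<pi> - 1)
              then s / (s + \<nu> + 1/2)
              else (s - 1/\<pi> + 1/p) / (s + \<nu> + 1/2 - 1/\<pi>))"
  shows "\<exists>C'>0. \<forall>\<^sub>F \<epsilon> in at_right 0. \<forall>J. 2 powr J = t_eps \<epsilon> powr (- 2 / (2 * \<nu> + 1)) \<longrightarrow>
           (\<forall>f\<in>besov_ball M e X lam \<phi> s \<pi> r R.
              (\<integral>\<^sup>+\<omega>. Lq_norm_pow M p
                  (\<lambda>x. need_d M e b X lam \<phi> \<kappa> \<epsilon> J (observation K g W \<epsilon> f \<omega>) x - f x) \<partial>P)
              \<le> ennreal (C' * ln (1/\<epsilon>) powr (p - 1) * (\<epsilon> * sqrt (ln (1/\<epsilon>))) powr (\<mu> * p)))"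
proof -
  interpret besov_exponents p \<nu> \<pi> s
    using assms(8,9,14,15) by unfold_locales
  have "L2_orthonormal_basis M e" using assms(3) unfolding svd_def by (rule conjunct1)
  then interpret needlet_frame M e X lam \<phi>
    by (intro needlet_frame.intro assms)
  obtain C c C\<^sub>p D where C: "C > 0" "C\<^sub>p > 0" "D > 0"
    and levels: "\<forall>j::int. j \<ge> -1 \<longrightarrow>
           real (card (Z X j)) \<le> C * 2 powr real_of_int j \<and>
           (\<forall>\<eta>\<in>Z X j.
              ennreal (c * 2 powr (real_of_int j * (p/2 - 1))) \<le> Lq_norm_pow M p (psi j \<eta>) \<and>
              Lq_norm_pow M p (psi j \<eta>) \<le> ennreal (C\<^sub>p * 2 powr (real_of_int j * (p/2 - 1)))) \<and>
           (\<forall>u. Lq_norm_pow M p (\<lambda>x. \<Sum>\<eta>\<in>Z X j. u \<eta> * psi j \<eta> x)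
              \<le> ennreal D * (\<Sum>\<eta>\<in>Z X j. ennreal (\<bar>u \<eta>\<bar> powr p) * Lq_norm_pow M p (psi j \<eta>)))"
    using assms(7)[rule_format, OF less_imp_le[OF p]] by (elim exE conjE) (rule that)
  interpret needlet_estimation M e X lam \<phi> p \<nu> \<pi> s C "D * C\<^sub>p"
  proof unfold_locales
    show "C > 0" "D * C\<^sub>p > 0" using C by auto
    show "real (card (Z X j)) \<le> C * 2 powr real_of_int j" if "j \<ge> -1" for j
      using levels that by blast
    show "Lq_norm_pow M p (\<lambda>x. \<Sum>\<eta>\<in>Z X j. u \<eta> * psi j \<eta> x)
      \<le> ennreal (D * C\<^sub>p * (2 powr (real_of_int j * (p / 2 - 1)) * (\<Sum>\<eta>\<in>Z X j. \<bar>u \<eta>\<bar> powr p)))"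
      if j: "j \<ge> -1" for j u
    proof -
      have "Lq_norm_pow M p (\<lambda>x. \<Sum>\<eta>\<in>Z X j. u \<eta> * psi j \<eta> x)
          \<le> ennreal D * (\<Sum>\<eta>\<in>Z X j. ennreal (\<bar>u \<eta>\<bar> powr p) * Lq_norm_pow M p (psi j \<eta>))"
        using levels j by blast
      also have "\<dots> \<le> ennreal D * (\<Sum>\<eta>\<in>Z X j. ennreal (\<bar>u \<eta>\<bar> powr p) * ennreal (C\<^sub>p * 2 powr (real_of_int j * (p / 2 - 1))))"
        using levels j by (intro mult_left_mono sum_mono) auto
      also have "\<dots> = ennreal (D * (\<Sum>\<eta>\<in>Z X j. \<bar>u \<eta>\<bar> powr p * (C\<^sub>p * 2 powr (real_of_int j * (p / 2 - 1)))))"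
        using C by (simp add: ennreal_mult' less_imp_le flip: sum_ennreal)
      also have "(\<Sum>\<eta>\<in>Z X j. \<bar>u \<eta>\<bar> powr p * (C\<^sub>p * 2 powr (real_of_int j * (p / 2 - 1))))
          = C\<^sub>p * (2 powr (real_of_int j * (p / 2 - 1)) * (\<Sum>\<eta>\<in>Z X j. \<bar>u \<eta>\<bar> powr p))"
        unfolding sum_distrib_left by (intro sum.cong refl) (simp only: mult_ac)
      finally show ?thesis by (simp only: mult.assoc)
    qed
  qed
  obtain C\<^sub>\<sigma> where C\<sigma>: "\<And>j. j \<ge> 0 \<Longrightarrow> noise_level_sq M e b X lam \<phi> j \<le> C\<^sub>\<sigma> * 2 powr (2 * real_of_int j * \<nu>)"
    using assms(10) by blast
  \<comment> \<open>The growth of the noise level is assumed from level \<open>0\<close> on; the constant is enlarged to cover level \<open>-1\<close>.\<close>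
  define S where "S = max 1 (max C\<^sub>\<sigma> (noise_level_sq M e b X lam \<phi> (-1) * 2 powr (2 * \<nu>)))"
  have S: "sqrt S > 0" by (simp add: S_def less_max_iff_disj)
  have noise: "sqrt (noise_level_sq M e b X lam \<phi> j) \<le> sqrt S * 2 powr (real_of_int j * \<nu>)" if j: "j \<ge> -1" for j
  proof -
    have "noise_level_sq M e b X lam \<phi> j \<le> S * 2 powr (2 * real_of_int j * \<nu>)"
    proof (cases "j \<ge> 0")
      case True
      have "C\<^sub>\<sigma> * 2 powr (2 * real_of_int j * \<nu>) \<le> S * 2 powr (2 * real_of_int j * \<nu>)"
        by (intro mult_right_mono) (auto simp: S_def)
      then show ?thesis using C\<sigma>[OF True] by linarith
    next
      case False
      then have j1: "j = -1" using j by simp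
      have "noise_level_sq M e b X lam \<phi> (-1)
          = noise_level_sq M e b X lam \<phi> (-1) * 2 powr (2 * \<nu>) * 2 powr (2 * real_of_int (-1) * \<nu>)"
        by (simp add: mult.assoc flip: powr_add)
      also have "\<dots> \<le> S * 2 powr (2 * real_of_int (-1) * \<nu>)"
        by (intro mult_right_mono) (auto simp: S_def)
      finally show ?thesis unfolding j1 .
    qed
    also have "2 powr (2 * real_of_int j * \<nu>) = (2 powr (real_of_int j * \<nu>))\<^sup>2"
      unfolding power2_eq_square powr_add[symmetric] by (simp add: algebra_simps)
    finally have "sqrt (noise_level_sq M e b X lam \<phi> j) \<le> sqrt (S * (2 powr (real_of_int j * \<nu>))\<^sup>2)"
      by simp
    then show ?thesis by (simp add: real_sqrt_mult)
  qed
  have \<mu>: "\<mu> = rate"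
    using assms(18) by (simp add: rate_def add.assoc)
  obtain C' where C': "C' > 0" and risk: "\<forall>\<epsilon> J. 0 < \<epsilon> \<longrightarrow> \<epsilon> \<le> exp (-1) \<longrightarrow> 2 powr J = t_eps \<epsilon> powr (- 2 / (2 * \<nu> + 1)) \<longrightarrow>
    (\<forall>f\<in>besov_ball M e X lam \<phi> s \<pi> r R.
      (\<integral>\<^sup>+\<omega>. Lq_norm_pow M p (\<lambda>x. need_d M e b X lam \<phi> \<kappa> \<epsilon> J (observation K g W \<epsilon> f \<omega>) x - f x) \<partial>P)
        \<le> ennreal (C' * ln (1 / \<epsilon>) powr (p - 1) * t_eps \<epsilon> powr (rate * p)))"
    using need_d_risk_le[OF assms(3,4,5,11,12) S noise assms(13,16)] assms(17) by blast
  have "\<forall>\<^sub>F \<epsilon> in at_right 0. \<epsilon> \<in> {0<..<exp (-1::real)}"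
    by (rule eventually_at_right_real) simp
  then show ?thesis
    using C' risk unfolding \<mu>
    by (intro exI[of _ C'] conjI) (auto elim!: eventually_mono simp: t_eps_def)
qed

end
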